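(* Let $0<\beta\le1$ and let $\Omega:\mathbb R\to\mathbb R$ be a positive function with $\Omega\in L^1\bigl(\mathbb R,\tfrac{dx}{1+x^2}\bigr)\cap V_\beta$. Then for each $\varepsilon>0$ there exists a function $\Omega_1:\mathbb R\to\mathbb R$ satisfying: (A) $\Omega(x)\le\Omega_1(x)$ for all $x\in\mathbb R$; (B) $\Omega_1\in L^1\bigl(\mathbb R,\tfrac{dx}{1+x^2}\bigr)$; (C) $\mathcal H\Omega_1\in\mathrm{Lip}(\varepsilon,\mathbb R)$, i.e. $\mathcal H\Omega_1$ is Lipschitz on $\mathbb R$ with Lipschitz constant $\varepsilon$.
   Context: Define intervals $J_0=[-2,2)$ and, for $j\in\mathbb N=\{1,2,\dots\}$, $J_j=[2^j,2^{j+1})$ and $J_{-j}=[-2^{j+1},-2^j)$. The class $V_\beta$: for $\beta\in(0,1)$, a function $\varphi:\mathbb R\to\mathbb R$ that is absolutely continuous on every compact interval belongs to $V_\beta$ if for each $j\in\mathbb Z$ it is $\beta$-Hölder on $J_j$ with some constant $\kappa_j$, i.e. $|\varphi(x)-\varphi(y)|\le\kappa_j|x-y|^\beta$ for all $x,y\in J_j$, and these constants satisfy $$\Bigl(\sum_{j\in\mathbb Z}2^{-|j|}\kappa_j^{1/(1-\beta)}\Bigr)^{1-\beta}<\infty.$$ For $\beta=1$, $V_1=\mathrm{Lip}(\mathbb R)$ is the space of all Lipschitz functions on $\mathbb R$. The Hilbert transform of $f\in L^1\bigl(\mathbb R,\tfrac{dx}{1+x^2}\bigr)$ is the principal value integral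 $$\mathcal Hf(x)=\mathrm{p.v.}\int_{\mathbb R}\Bigl(\frac1{x-t}+\frac{t}{t^2+1}\Bigr)f(t)\,dt,$$ which converges for almost every $x\in\mathbb R$; functions are identified when equal almost everywhere in (C). *)

theory Defs
  imports "HOL-Analysis.Analysis"
begin

definition J :: "int \<Rightarrow> real set" where
  "J j = (if j = 0 then {-2..<2}
          else if j > 0 then {2 ^ nat j ..< 2 ^ (nat j + 1)}
          else {- (2 ^ (nat (- j) + 1)) ..< - (2 ^ nat (- j))})"

text \<open>Absolute continuity of a function on an interval. (The library constant
  \<open>absolutely_continuous\<close> is about measures.)\<close>

definition abs_cont_on :: "real set \<Rightarrow> (real \<Rightarrow> real) \<Rightarrow> bool" where
  "abs_cont_on S f \<longleftrightarrow>
     (\<forall>e>0. \<exists>d>0. \<forall>(n::nat) (a :: nat \<Rightarrow> real) (b :: nat \<Rightarrow> real).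
        (\<forall>i<n. a i \<le> b i \<and> {a i..b i} \<subseteq> S) \<and>
        disjoint_family_on (\<lambda>i. {a i<..<b i}) {..<n} \<and>
        (\<Sum>i<n. b i - a i) < d \<longrightarrow>
        (\<Sum>i<n. \<bar>f (b i) - f (a i)\<bar>) < e)"

definition hoelder_on :: "real \<Rightarrow> real \<Rightarrow> real set \<Rightarrow> (real \<Rightarrow> real) \<Rightarrow> bool" where
  "hoelder_on \<beta> C S f \<longleftrightarrow> (\<forall>x\<in>S. \<forall>y\<in>S. \<bar>f x - f y\<bar> \<le> C * \<bar>x - y\<bar> powr \<beta>)"

text \<open>The class \<open>V \<beta>\<close>, meant for \<open>0 < \<beta> \<le> 1\<close>. The series has nonnegative terms, so for
  \<open>\<beta> < 1\<close> its power with exponent \<open>1 - \<beta> > 0\<close> is finite exactly if the series is summable.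
  (Nonnegativity of the constants \<open>\<kappa> j\<close> also follows from the Hoelder condition.)\<close>

definition V :: "real \<Rightarrow> (real \<Rightarrow> real) set" where
  "V \<beta> = (if \<beta> = 1 then {\<phi>. \<exists>C. C-lipschitz_on UNIV \<phi>}
     else {\<phi>. (\<forall>a b. abs_cont_on {a..b} \<phi>) \<and>
             (\<exists>\<kappa> :: int \<Rightarrow> real.
                (\<forall>j. 0 \<le> \<kappa> j \<and> hoelder_on \<beta> (\<kappa> j) (J j) \<phi>) \<and>
                (\<lambda>j. 2 powr (- real_of_int \<bar>j\<bar>) * \<kappa> j powr (1 / (1 - \<beta>))) summable_on UNIV)})"

definition poisson_measure :: "real measure" where
  "poisson_measure = density lebesgue (\<lambda>x. ennreal (1 / (1 + x\<^sup>2)))"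

text \<open>\<open>has_hilbert_transform f x y\<close>: the principal value integral defining the Hilbert transform
  of \<open>f\<close> at the point \<open>x\<close> converges and equals \<open>y\<close>. The kernel is of order \<open>1 / t\<^sup>2\<close>
  at infinity, so only the singularity at \<open>t = x\<close> needs to be cut out.\<close>

definition has_hilbert_transform :: "(real \<Rightarrow> real) \<Rightarrow> real \<Rightarrow> real \<Rightarrow> bool" where
  "has_hilbert_transform f x y \<longleftrightarrow>
     ((\<lambda>\<delta>. LINT t:{t. \<delta> < \<bar>x - t\<bar>}|lebesgue. (1 / (x - t) + t / (t\<^sup>2 + 1)) * f t)
        \<longlongrightarrow> y) (at_right 0)"

text \<open>\<open>g\<close> is a representative of the Hilbert transform of \<open>f\<close>, which is determined
  almost everywhere.\<close>

definition is_hilbert_transform :: "(real \<Rightarrow> real) \<Rightarrow> (real \<Rightarrow> real) \<Rightarrow> bool" where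
  "is_hilbert_transform f g \<longleftrightarrow> (AE x in lebesgue. has_hilbert_transform f x (g x))"

end

theory Submission
  imports Defs "HOL-Real_Asymp.Real_Asymp"
begin

text \<open>Let \<open>P\<^sub>s\<close> be convolution with the Poisson kernel at height \<open>s\<close>. For \<open>F = \<integral>\<^sub>1\<^sup>2 P\<^sub>s v ds\<close> the
  Cauchy--Riemann equations give \<open>(H F)' = P\<^sub>1 v - P\<^sub>2 v = P\<^sub>1 (v - P\<^sub>1 v)\<close>, while Harnack's inequality
  gives \<open>F \<ge> P\<^sub>1 v / 2\<close> up to normalisation. So it suffices to majorise \<open>\<Omega>\<close> by a Poisson integrable
  \<open>v\<close> with \<open>\<bar>v - P\<^sub>1 v\<bar> \<le> \<epsilon>\<close>.

  If \<open>f \<ge> 0\<close> satisfies the one-sided bound \<open>f - P\<^sub>1 f \<le> \<epsilon>\<close>, the least majorant \<open>u\<close> of \<open>f\<close> with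
  \<open>P\<^sub>1 u - u \<le> \<epsilon>\<close> satisfies both bounds, and \<open>\<integral> u \<le> 2 \<integral> f\<close> since \<open>\<integral> u (u - P\<^sub>1 u) \<ge> 0\<close>.
  A maximum of parabolic bumps of small slope is such an \<open>f\<close>. On a dyadic interval of length \<open>2\<^sup>j\<close>, outside
  the set where \<open>\<Omega> \<le> A\<^sub>j = (2 \<kappa>\<^sub>j) powr (1 / (1 - \<beta>))\<close>, the Hoelder condition keeps \<open>\<Omega>\<close> comparable to
  \<open>\<Omega> y\<close> at distance \<open>\<Omega> y\<close> from \<open>y\<close>, so bumps of height and width proportional to \<open>\<Omega> y\<close> cost no
  more than \<open>\<integral> \<Omega>\<close>, and the values below \<open>A\<^sub>j\<close> cost \<open>A\<^sub>j 2\<^sup>j\<close>. For large \<open>j\<close> a barrier confines \<open>u\<close>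
  to a neighbourhood of the interval, so the pieces for all \<open>j\<close> add up with bounded overlap; a constant
  takes care of the rest of the line.\<close>

section \<open>Poisson kernels\<close>

text \<open>The difficulty is that \<epsilon> is arbitrary while the modulus of continuity of
  \<Omega> is fixed. Small slopes are bought by wide bumps, at the price of a large factor in the
  mass. Mass on a dyadic interval, however, counts only relative to the square of the distance from
  the origin. Measured that way, both costs are terms of convergent series: the integral of \<Omega>
  by Poisson integrability, and the threshold cost because the series in the definition of
  \<open>V\<close> is, up to a constant factor, the series of threshold times length divided by
  length squared. Far out the tails beat any constant; what remains near the origin is bounded, and
  constants are invariant under the Poisson average.

  Working with one averaging step instead of a derivative keeps the obstacle problem elementary: the
  average is linear, order preserving and bounded, so monotone iteration and dominated convergence
  solve it, and no regularity theory enters. Integrating over heights converts the resulting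
  difference bound back into a bound on a derivative.\<close>

lemma FTC_nonneg_UNIV:
  fixes f F :: "real \<Rightarrow> real"
  assumes F: "\<And>x. (F has_real_derivative f x) (at x)" and f: "\<And>x. isCont f x"
    and nonneg: "\<And>x. 0 \<le> f x"
    and A: "(F \<longlongrightarrow> A) at_bot" and B: "(F \<longlongrightarrow> B) at_top"
  shows "integrable lborel f" and "(\<integral>x. f x \<partial>lborel) = B - A"
proof -
  have *: "((F \<circ> real_of_ereal) \<longlongrightarrow> A) (at_right (-\<infinity>))" "((F \<circ> real_of_ereal) \<longlongrightarrow> B) (at_left \<infinity>)"
    using A B by (simp_all add: ereal_tendsto_simps1)
  have e: "einterval (-\<infinity>) \<infinity> = (UNIV :: real set)" by (auto simp: einterval_def)
  show "integrable lborel f"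
    using interval_integral_FTC_nonneg(1)[of "-\<infinity>" \<infinity> F f, OF _ _ _ _ *] F f nonneg
    by (simp add: e set_integrable_def)
  show "(\<integral>x. f x \<partial>lborel) = B - A"
    using interval_integral_FTC_nonneg(2)[of "-\<infinity>" \<infinity> F f, OF _ _ _ _ *] F f nonneg
    by (simp add: e interval_lebesgue_integral_def set_lebesgue_integral_def)
qed

text \<open>Up to the factor \<open>1 / pi\<close> these are the Poisson kernel at height \<open>s\<close> and its conjugate.\<close>

definition pker :: "real \<Rightarrow> real \<Rightarrow> real" where "pker s z = s / (s\<^sup>2 + z\<^sup>2)"

definition qker :: "real \<Rightarrow> real \<Rightarrow> real" where "qker s z = z / (s\<^sup>2 + z\<^sup>2)"

lemma pker_measurable [measurable]: "(\<lambda>x. pker (f x) (g x)) \<in> borel_measurable M"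
  if [measurable]: "f \<in> borel_measurable M" "g \<in> borel_measurable M"
  unfolding pker_def by measurable

lemma qker_measurable [measurable]: "(\<lambda>x. qker (f x) (g x)) \<in> borel_measurable M"
  if [measurable]: "f \<in> borel_measurable M" "g \<in> borel_measurable M"
  unfolding qker_def by measurable

lemma pker_nonneg: "0 < s \<Longrightarrow> 0 \<le> pker s z" by (simp add: pker_def)

lemma pker_minus [simp]: "pker s (- z) = pker s z" by (simp add: pker_def)

lemma pker_commute: "pker s (x - y) = pker s (y - x)" by (simp add: pker_def power2_commute)

lemma square_sum_pos: "0 < s \<Longrightarrow> 0 < s\<^sup>2 + (z::real)\<^sup>2"
  by (simp add: add_pos_nonneg)

lemma pker_integral:
  assumes "0 < s"
  shows "integrable lborel (pker s)" "(\<integral>x. pker s x \<partial>lborel) = pi"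
proof -
  have d: "((\<lambda>x. arctan (x / s)) has_real_derivative pker s x) (at x)" for x
    using assms square_sum_pos[OF assms, of x]
    by (auto intro!: derivative_eq_intros simp: pker_def field_simps power2_eq_square)
  have c: "isCont (pker s) x" for x
    unfolding pker_def using square_sum_pos[OF assms, of x] by (auto intro!: continuous_intros)
  have A: "((\<lambda>x. arctan (x / s)) \<longlongrightarrow> - (pi / 2)) at_bot"
    using assms by real_asymp
  have B: "((\<lambda>x. arctan (x / s)) \<longlongrightarrow> pi / 2) at_top"
    using assms by real_asymp
  show "integrable lborel (pker s)" "(\<integral>x. pker s x \<partial>lborel) = pi"
    using FTC_nonneg_UNIV[OF d c pker_nonneg[OF assms] A B] by auto
qed

text \<open>Peetre's inequality for the Poisson weight, a consequence of
  \<open>(2 * x - y)\<^sup>2 \<ge> 0\<close>. It exchanges the weight at \<open>y\<close> for the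
  weight at \<open>x\<close> at the price of a kernel denominator.\<close>

lemma weight_shift: "1 + y\<^sup>2 \<le> 2 * (1 + x\<^sup>2) * (1 + (x - y :: real)\<^sup>2)"
proof -
  have "y\<^sup>2 \<le> 2 * x\<^sup>2 + 2 * (x - y)\<^sup>2"
    using zero_le_power2[of "2 * x - y"] by (simp add: power2_eq_square algebra_simps)
  then show ?thesis by (simp add: algebra_simps)
      (smt (verit) mult_nonneg_nonneg zero_le_power2)
qed

lemma pker_le:
  assumes "1 \<le> s" "s \<le> 2"
  shows "pker s z \<le> 2 / (1 + z\<^sup>2)"
proof -
  have "1 \<le> s\<^sup>2" using assms by (simp add: one_le_power)
  then have "s * (1 + z\<^sup>2) \<le> 2 * (s\<^sup>2 + z\<^sup>2)" using assms by (intro mult_mono) auto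
  then show ?thesis using square_sum_pos[of s z] assms unfolding pker_def
    by (simp add: divide_simps add_pos_nonneg add_nonneg_eq_0_iff)
qed

text \<open>Harnack's inequality for heights between 1 and 2, in the direction that later bounds the
  superposition \<open>F\<close> from below.\<close>

lemma pker_ge:
  assumes "1 \<le> s" "s \<le> 2"
  shows "pker 1 z / 2 \<le> pker s z"
proof -
  have "s * s \<le> 2 * s" using assms by (intro mult_right_mono) auto
  moreover have "1 * z\<^sup>2 \<le> s * z\<^sup>2" using assms by (intro mult_right_mono) auto
  moreover have "2 * s * (1 + z\<^sup>2) = 2 * s + 2 * (s * z\<^sup>2)" by (simp add: algebra_simps)
  ultimately have "s\<^sup>2 + z\<^sup>2 \<le> 2 * s * (1 + z\<^sup>2)"
    using zero_le_power2[of z] unfolding power2_eq_square[of s] by linarith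
  then show ?thesis using square_sum_pos[of s z] assms unfolding pker_def
    by (simp add: divide_simps add_pos_nonneg add_nonneg_eq_0_iff algebra_simps)
qed

text \<open>The decay of the kernel compensates the growth of the weight, uniformly in the centre
  \<open>y\<close>. So Poisson integrability of \<open>u\<close> suffices for convolution with
  \<open>pker s\<close>, and the weighted kernels \<open>kap\<close> are bounded for each
  \<open>t\<close>.\<close>

lemma pker_weight_le:
  assumes "1 \<le> s" "s \<le> 2"
  shows "(1 + y\<^sup>2) * pker s (x - y) \<le> 4 * (1 + x\<^sup>2)"
proof -
  have p: "0 < 1 + (x - y)\<^sup>2" by (simp add: add_pos_nonneg)
  have "(1 + y\<^sup>2) * pker s (x - y) \<le> (2 * (1 + x\<^sup>2) * (1 + (x - y)\<^sup>2)) * (2 / (1 + (x - y)\<^sup>2))"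
    using weight_shift[of y x] pker_le[OF assms] pker_nonneg[of s] assms
    by (intro mult_mono) (auto simp: add_nonneg_nonneg)
  also have "\<dots> = 4 * (1 + x\<^sup>2)" using p by (simp add: field_simps)
  finally show ?thesis .
qed

text \<open>Phrased with Borel measurability and \<open>lborel\<close> rather than the completion,
  so that convolutions are measurable and Fubini applies on product measures; the passage to
  \<open>lebesgue\<close> is made separately.\<close>

definition poisson_integrable :: "(real \<Rightarrow> real) \<Rightarrow> bool" where
  "poisson_integrable u \<longleftrightarrow> u \<in> borel_measurable borel \<and> integrable lborel (\<lambda>y. u y / (1 + y\<^sup>2))"

lemma integrable_pker_mult:
  assumes u: "poisson_integrable u" and s: "1 \<le> s" "s \<le> 2"
  shows "integrable lborel (\<lambda>y. pker s (x - y) * u y)"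
proof (rule Bochner_Integration.integrable_bound)
  have [measurable]: "u \<in> borel_measurable borel" using u by (simp add: poisson_integrable_def)
  show "integrable lborel (\<lambda>y. 4 * (1 + x\<^sup>2) * (u y / (1 + y\<^sup>2)))"
    using u unfolding poisson_integrable_def by (intro integrable_mult_right) simp
  show "(\<lambda>y. pker s (x - y) * u y) \<in> borel_measurable lborel" by measurable
  show "AE y in lborel. norm (pker s (x - y) * u y) \<le> norm (4 * (1 + x\<^sup>2) * (u y / (1 + y\<^sup>2)))"
  proof (rule AE_I2)
    fix y :: real
    have p: "0 < 1 + y\<^sup>2" by (simp add: add_pos_nonneg)
    have "pker s (x - y) \<le> 4 * (1 + x\<^sup>2) / (1 + y\<^sup>2)"
      using pker_weight_le[OF s, of y x] p by (simp add: field_simps)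
    then have "pker s (x - y) * \<bar>u y\<bar> \<le> 4 * (1 + x\<^sup>2) / (1 + y\<^sup>2) * \<bar>u y\<bar>"
      by (rule mult_right_mono) simp
    then show "norm (pker s (x - y) * u y) \<le> norm (4 * (1 + x\<^sup>2) * (u y / (1 + y\<^sup>2)))"
      using pker_nonneg[of s] s by (simp add: abs_mult)
  qed
qed

text \<open>The integrand is the symmetric difference quotient
  \<open>(pker s (z - r) - pker s (z + r)) / r\<close>, so the Hilbert transform of the Poisson
  kernel is \<open>pi\<close> times the conjugate kernel. As the integrand is even in
  \<open>r\<close>, doubling it also yields \<open>pker_semigroup\<close>. An explicit
  antiderivative settles \<open>z > 0\<close>; oddness in \<open>z\<close> gives the rest.\<close>

lemma pker_conjugate:
  assumes s: "0 < s"
  shows "integrable lborel (\<lambda>r. indicator {0..} r * (4 * z / s * pker s (z - r) * pker s (z + r)))"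
    and "(\<integral>r. indicator {0..} r * (4 * z / s * pker s (z - r) * pker s (z + r)) \<partial>lborel) = pi * qker s z"
proof -
  define I where "I = (\<lambda>z. has_bochner_integral lborel
     (\<lambda>r. indicator {0..} r * (4 * z / s * pker s (z - r) * pker s (z + r))) (pi * qker s z))"
  have pos: "I z" if z: "0 < z" for z
  proof -
    \<comment> \<open>Partial fractions of \<open>4 * z * s / (a * b)\<close>, with \<open>a\<close>
      and \<open>b\<close> the two denominators, multiplied by \<open>s\<^sup>2 + z\<^sup>2\<close>.
      The arctangents supply the limit at infinity; the logarithms cancel there and at 0.\<close>
    let ?G = "\<lambda>r. z * (arctan ((r - z) / s) + arctan ((r + z) / s))
        + (s / 2) * (ln (s\<^sup>2 + (r + z)\<^sup>2) - ln (s\<^sup>2 + (r - z)\<^sup>2))"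
    let ?F = "\<lambda>r. ?G r / (s\<^sup>2 + z\<^sup>2)"
    let ?f = "\<lambda>r. 4 * z / s * pker s (z - r) * pker s (z + r)"
    have d: "(?F has_real_derivative ?f r) (at r)" for r
    proof -
      let ?a = "s\<^sup>2 + (r - z)\<^sup>2" and ?b = "s\<^sup>2 + (r + z)\<^sup>2"
      have ab: "?a > 0" "?b > 0" "s\<^sup>2 + z\<^sup>2 > 0" using square_sum_pos[OF s] by auto
      have at: "((\<lambda>r. arctan ((r + c) / s)) has_real_derivative s / (s\<^sup>2 + (r + c)\<^sup>2)) (at r)" for c
        using s square_sum_pos[OF s, of "r + c"]
        by (auto intro!: derivative_eq_intros simp: divide_simps power2_eq_square)
      have at2: "((\<lambda>r. arctan ((r - z) / s)) has_real_derivative s / ?a) (at r)"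
        using at[of "-z"] by simp
      have G: "(?G has_real_derivative z * (s / ?a + s / ?b) + (s/2) * (2 * (r + z) / ?b - 2 * (r - z) / ?a)) (at r)"
      proof (rule DERIV_add[OF DERIV_cmult[OF DERIV_add[OF at2 at[of z]]]])
        show "((\<lambda>r. (s / 2) * (ln (s\<^sup>2 + (r + z)\<^sup>2) - ln (s\<^sup>2 + (r - z)\<^sup>2))) has_real_derivative
           (s/2) * (2 * (r + z) / ?b - 2 * (r - z) / ?a)) (at r)"
          using ab by (auto intro!: derivative_eq_intros)
      qed
      have e: "z * (s / ?a + s / ?b) + (s/2) * (2 * (r + z) / ?b - 2 * (r - z) / ?a)
        = 4 * z * s * (s\<^sup>2 + z\<^sup>2) / (?a * ?b)"
      proof -
        have "z * (s / ?a + s / ?b) + (s/2) * (2 * (r + z) / ?b - 2 * (r - z) / ?a)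
          = (z * s * (?b + ?a) + s * ((r + z) * ?a - (r - z) * ?b)) / (?a * ?b)"
          using ab by (simp add: divide_simps) (simp add: algebra_simps)
        also have "z * s * (?b + ?a) + s * ((r + z) * ?a - (r - z) * ?b) = 4 * z * s * (s\<^sup>2 + z\<^sup>2)"
          by (simp add: power2_eq_square algebra_simps)
        finally show ?thesis .
      qed
      have "4 * z * s * (s\<^sup>2 + z\<^sup>2) / (?a * ?b) / (s\<^sup>2 + z\<^sup>2) = ?f r"
        using ab s unfolding pker_def power2_commute[of z r] add.commute[of z r]
        by (simp add: divide_simps power2_eq_square)
      then show ?thesis using DERIV_cdivide[OF G, of "s\<^sup>2 + z\<^sup>2"] e by simp
    qed
    have nn: "0 \<le> ?f r" for r using z s by (intro mult_nonneg_nonneg divide_nonneg_pos pker_nonneg) auto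
    have "((\<lambda>r. arctan ((r - z) / s)) \<longlongrightarrow> pi / 2) at_top"
         "((\<lambda>r. arctan ((r + z) / s)) \<longlongrightarrow> pi / 2) at_top"
         "((\<lambda>r. ln (s\<^sup>2 + (r + z)\<^sup>2) - ln (s\<^sup>2 + (r - z)\<^sup>2)) \<longlongrightarrow> 0) at_top"
      using s by real_asymp+
    then have "(?G \<longlongrightarrow> z * (pi / 2 + pi / 2) + (s / 2) * 0) at_top"
      by (intro tendsto_intros)
    from tendsto_divide[OF this tendsto_const[of "s\<^sup>2 + z\<^sup>2"]]
    have lim: "(?F \<longlongrightarrow> pi * qker s z) at_top"
      using square_sum_pos[OF s, of z] s by (simp add: qker_def mult.commute)
    have "arctan (- (z / s)) + arctan (z / s) = 0" by (simp add: arctan_minus)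
    then have F0: "?F 0 = 0" by simp
    have m: "?f \<in> borel_measurable borel" by measurable
    have "(\<integral>\<^sup>+r. ennreal (?f r) * indicator {0..} r \<partial>lborel) = pi * qker s z"
      using nn_integral_FTC_atLeast[OF m d nn lim, of 0] unfolding F0 by simp
    then have "(\<integral>\<^sup>+r. ennreal (indicator {0..} r * ?f r) \<partial>lborel) = ennreal (pi * qker s z)"
      by (subst nn_integral_cong[where v = "\<lambda>r. ennreal (?f r) * indicator {0..} r"])
         (auto simp: indicator_def)
    moreover have "0 \<le> indicator {0..} r * ?f r" for r using nn[of r] by (simp only: mult_nonneg_nonneg indicator_pos_le)
    moreover have "0 \<le> pi * qker s z" using z s by (simp add: qker_def)
    ultimately show ?thesis unfolding I_def using m
      by (intro has_bochner_integral_nn_integral AE_I2) auto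
  qed
  have neg: "I z" if z: "z < 0" for z
  proof -
    have "I (- z)" using pos z by simp
    then have "has_bochner_integral lborel (\<lambda>r. - (indicator {0..} r * (4 * (-z) / s * pker s (-z - r) * pker s (-z + r)))) (- (pi * qker s (-z)))"
      unfolding I_def by (rule has_bochner_integral_minus)
    moreover have "pker s (-z - r) = pker s (z + r)" "pker s (-z + r) = pker s (z - r)" for r
      unfolding pker_def by (simp_all add: power2_eq_square algebra_simps)
    ultimately show ?thesis unfolding I_def by (simp add: qker_def mult_ac)
  qed
  have "I z" using pos[of z] neg[of z] by (cases "z = 0") (auto simp: I_def qker_def not_less neq_iff)
  then show "integrable lborel (\<lambda>r. indicator {0..} r * (4 * z / s * pker s (z - r) * pker s (z + r)))"
    and "(\<integral>r. indicator {0..} r * (4 * z / s * pker s (z - r) * pker s (z + r)) \<partial>lborel) = pi * qker s z"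
    unfolding I_def by (auto simp: has_bochner_integral_iff)
qed

section \<open>Hilbert transforms of superpositions of Poisson kernels\<close>

lemma integrable_pker_shift:
  assumes "0 < s"
  shows "integrable lborel (\<lambda>t. pker s (t - y))" "(\<integral>t. pker s (t - y) \<partial>lborel) = pi"
proof -
  have "integrable lborel (\<lambda>t. pker s (-y + 1 * t))"
    by (rule lborel_integrable_real_affine[OF pker_integral(1)[OF assms]]) simp
  then show "integrable lborel (\<lambda>t. pker s (t - y))" by (simp add: algebra_simps)
  have "(\<integral>t. pker s t \<partial>lborel) = \<bar>1\<bar> *\<^sub>R (\<integral>t. pker s (-y + 1 * t) \<partial>lborel)"
    by (rule lborel_integral_real_affine) simp
  then show "(\<integral>t. pker s (t - y) \<partial>lborel) = pi"
    using pker_integral(2)[OF assms] by (simp add: algebra_simps)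
qed

text \<open>The harmonic-mean estimate \<open>1 / (a b) = (1 / a + 1 / b) / (a + b)\<close> integrates a product of two kernels.\<close>

lemma pker_product_le:
  "pker 1 (t - y) * pker 1 t \<le> 2 / (1 + y\<^sup>2) * (pker 1 (t - y) + pker 1 t)" for t y :: real
proof -
  define a where "a = 1 + t\<^sup>2"
  define b where "b = 1 + (t - y)\<^sup>2"
  have ab: "a \<ge> 1" "b \<ge> 1" by (auto simp: a_def b_def)
  have "y\<^sup>2 \<le> 2 * t\<^sup>2 + 2 * (t - y)\<^sup>2"
    using zero_le_power2[of "2 * t - y"] by (simp add: power2_eq_square algebra_simps)
  then have *: "1 + y\<^sup>2 \<le> 2 * (a + b)" by (simp add: a_def b_def)
  have "pker 1 (t - y) * pker 1 t = 1 / (a * b)" by (simp add: pker_def a_def b_def)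
  also have "\<dots> \<le> 2 / (1 + y\<^sup>2) * ((a + b) / (a * b))"
    using * ab by (simp add: divide_simps add_pos_nonneg mult_ac add_nonneg_eq_0_iff)
  also have "(a + b) / (a * b) = pker 1 (t - y) + pker 1 t"
    using ab by (simp add: pker_def a_def[symmetric] b_def[symmetric] divide_simps)
  finally show ?thesis .
qed

definition hkernel :: "real \<Rightarrow> real \<Rightarrow> real" where
  "hkernel x t = 1 / (x - t) + t / (t\<^sup>2 + 1)"

lemma hkernel_measurable [measurable]: "(\<lambda>x. hkernel (f x) (g x)) \<in> borel_measurable M"
  if [measurable]: "f \<in> borel_measurable M" "g \<in> borel_measurable M"
  unfolding hkernel_def by measurable

text \<open>The two terms of the kernel cancel to order \<open>1 / t\<^sup>2\<close>: their sum is
  \<open>((1 + x\<^sup>2) / (x - t) - x) * pker 1 t\<close>. Away from the singularity this gives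
  domination by the Poisson weight.\<close>

lemma hkernel_le:
  assumes d: "0 < \<delta>" "\<delta> < \<bar>x - t\<bar>"
  shows "\<bar>hkernel x t\<bar> \<le> ((1 + x\<^sup>2) / \<delta> + \<bar>x\<bar>) * pker 1 t"
proof -
  have "x - t \<noteq> 0" using d by auto
  then have "hkernel x t = ((1 + x\<^sup>2) / (x - t) - x) * pker 1 t"
    by (simp add: hkernel_def pker_def divide_simps add_nonneg_eq_0_iff) (simp add: power2_eq_square algebra_simps)
  moreover have "\<bar>(1 + x\<^sup>2) / (x - t) - x\<bar> \<le> (1 + x\<^sup>2) / \<delta> + \<bar>x\<bar>"
  proof -
    have "\<bar>(1 + x\<^sup>2) / (x - t)\<bar> = (1 + x\<^sup>2) / \<bar>x - t\<bar>" by (simp add: abs_divide)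
    also have "\<dots> \<le> (1 + x\<^sup>2) / \<delta>" using d by (intro divide_left_mono) auto
    finally show ?thesis by linarith
  qed
  ultimately show ?thesis
    by (simp add: abs_mult pker_nonneg mult_right_mono)
qed

section \<open>Weighted superpositions of Poisson kernels\<close>

locale poisson_superposition = finite_measure N for N :: "(real \<times> real) measure" +
  assumes sets_N [measurable_cong]: "sets N = sets borel"
    and scale: "AE p in N. fst p \<in> {1..2}"
begin

text \<open>The factor \<open>1 + (snd p)\<^sup>2\<close> is taken out of the measure: a density
  that is only Poisson integrable then still gives a finite \<open>N\<close>.\<close>

definition kap :: "real \<Rightarrow> real \<times> real \<Rightarrow> real" where
  "kap t p = (1 + (snd p)\<^sup>2) * pker (fst p) (t - snd p)"

definition F :: "real \<Rightarrow> real" where "F t = (\<integral>p. kap t p \<partial>N)"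

lemma kap_measurable [measurable]: "case_prod kap \<in> borel_measurable (lborel \<Otimes>\<^sub>M N)"
proof -
  have "case_prod kap \<in> borel_measurable (borel \<Otimes>\<^sub>M (borel \<Otimes>\<^sub>M borel))"
    unfolding kap_def by measurable
  moreover have "sets (lborel \<Otimes>\<^sub>M N) = sets (borel \<Otimes>\<^sub>M (borel \<Otimes>\<^sub>M borel))"
  proof (rule sets_pair_measure_cong)
    show "sets N = sets (borel \<Otimes>\<^sub>M borel)" by (subst borel_prod) (rule sets_N)
  qed simp
  ultimately show ?thesis by (subst measurable_cong_sets) auto
qed

lemma kap_bounds:
  assumes "fst p \<in> {1..2}"
  shows "0 \<le> kap t p" "kap t p \<le> 4 * (1 + t\<^sup>2)"
proof -
  have "0 \<le> (1 + (snd p)\<^sup>2) * pker (fst p) (t - snd p)"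
    using assms by (intro mult_nonneg_nonneg pker_nonneg) auto
  then show "0 \<le> kap t p" unfolding kap_def .
  show "kap t p \<le> 4 * (1 + t\<^sup>2)"
    using assms pker_weight_le[of "fst p" "snd p" t] by (auto simp: kap_def)
qed

lemma F_measurable [measurable]: "F \<in> borel_measurable borel"
  unfolding F_def by measurable

lemma F_nonneg: "0 \<le> F t"
  unfolding F_def using scale kap_bounds(1) by (intro integral_nonneg_AE) (rule eventually_mono)

text \<open>By \<open>pker_product_le\<close> the product of two kernels carries a factor
  \<open>2 / (1 + y\<^sup>2)\<close> that cancels the weight in \<open>kap\<close>. Two kernels of
  mass \<open>pi\<close> remain, so the bound is uniform in the centre, and Tonelli yields the
  Poisson integrability of \<open>F\<close>.\<close>

lemma nn_integral_kap_le:
  assumes "fst p \<in> {1..2}"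
  shows "(\<integral>\<^sup>+t. ennreal (kap t p * pker 1 t) \<partial>lborel) \<le> ennreal (8 * pi)"
proof -
  obtain s y where p: "p = (s, y)" by (cases p)
  have s: "1 \<le> s" "s \<le> 2" using assms p by auto
  let ?g = "\<lambda>t. 4 * (pker 1 (t - y) + pker 1 (t - 0))"
  have y: "0 < 1 + y\<^sup>2" by (simp add: add_pos_nonneg)
  have le: "kap t p * pker 1 t \<le> ?g t" for t
  proof -
    have "pker s (t - y) \<le> 2 * pker 1 (t - y)"
      using pker_le[OF s] by (simp add: pker_def)
    then have "kap t p * pker 1 t \<le> (1 + y\<^sup>2) * (2 * pker 1 (t - y)) * pker 1 t"
      unfolding kap_def p using y by (intro mult_right_mono) (auto simp: pker_nonneg intro!: mult_left_mono)
    also have "\<dots> = 2 * (1 + y\<^sup>2) * (pker 1 (t - y) * pker 1 t)" by simp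
    also have "\<dots> \<le> 2 * (1 + y\<^sup>2) * (2 / (1 + y\<^sup>2) * (pker 1 (t - y) + pker 1 t))"
      using y by (intro mult_left_mono pker_product_le) auto
    also have "\<dots> = ?g t" using y by (simp add: divide_simps) (simp add: algebra_simps)
    finally show ?thesis .
  qed
  have nn: "0 \<le> kap t p * pker 1 t" for t using kap_bounds[OF assms] by (simp add: pker_nonneg)
  have gi: "integrable lborel ?g"
    by (intro integrable_mult_right Bochner_Integration.integrable_add integrable_pker_shift) auto
  have I: "(\<integral>t. ?g t \<partial>lborel) = 8 * pi"
    using integrable_pker_shift[of 1 y] integrable_pker_shift[of 1 0] by simp
  have m: "(\<lambda>t. kap t p * pker 1 t) \<in> borel_measurable lborel" unfolding kap_def by measurable
  have i: "integrable lborel (\<lambda>t. kap t p * pker 1 t)"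
    using le nn by (intro Bochner_Integration.integrable_bound[OF gi m] AE_I2) (smt (verit) real_norm_def)
  have b: "(\<integral>t. kap t p * pker 1 t \<partial>lborel) \<le> 8 * pi"
    using integral_mono[OF i gi le] I by simp
  show "(\<integral>\<^sup>+t. ennreal (kap t p * pker 1 t) \<partial>lborel) \<le> ennreal (8 * pi)"
    using nn_integral_eq_integral[OF i] nn b by (simp add: ennreal_leI)
qed

lemma integrable_pair:
  "integrable (lborel \<Otimes>\<^sub>M N) (\<lambda>(t, p). kap t p * pker 1 t)"
proof -
  interpret P: pair_sigma_finite lborel N ..
  interpret Q: pair_sigma_finite N lborel ..
  have [measurable]: "(\<lambda>(t, p). kap t p * pker 1 t) \<in> borel_measurable (lborel \<Otimes>\<^sub>M N)"
    by measurable
  have "AE p in N. (\<integral>\<^sup>+t. ennreal (norm (kap t p * pker 1 t)) \<partial>lborel) \<le> ennreal (8 * pi)"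
    using scale
  proof eventually_elim
    case (elim p)
    then show ?case using nn_integral_kap_le[OF elim] kap_bounds(1)[OF elim]
      by (simp add: abs_mult pker_nonneg)
  qed
  then have "(\<integral>\<^sup>+p. \<integral>\<^sup>+t. ennreal (norm (kap t p * pker 1 t)) \<partial>lborel \<partial>N) \<le> (\<integral>\<^sup>+p. ennreal (8 * pi) \<partial>N)"
    by (rule nn_integral_mono_AE)
  also have "\<dots> < \<infinity>" by (simp add: emeasure_eq_measure ennreal_mult_less_top)
  finally have fin: "(\<integral>\<^sup>+p. \<integral>\<^sup>+t. ennreal (norm (kap t p * pker 1 t)) \<partial>lborel \<partial>N) < \<infinity>" .
  have "(\<integral>\<^sup>+z. ennreal (norm ((\<lambda>(t, p). kap t p * pker 1 t) z)) \<partial>(lborel \<Otimes>\<^sub>M N))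
     = (\<integral>\<^sup>+p. \<integral>\<^sup>+t. ennreal (norm (kap t p * pker 1 t)) \<partial>lborel \<partial>N)"
    by (subst P.nn_integral_snd[symmetric]) auto
  then show ?thesis using fin by (intro integrableI_bounded) auto
qed

lemma integrable_F: "integrable lborel (\<lambda>t. F t * pker 1 t)"
proof -
  interpret P: pair_sigma_finite lborel N ..
  have "integrable lborel (\<lambda>t. \<integral>p. kap t p * pker 1 t \<partial>N)"
    using P.integrable_fst[OF integrable_pair] by simp
  then show ?thesis by (simp add: F_def)
qed

end

section \<open>Symmetric truncation of the principal value\<close>

lemma integral_indicator_Icc_bound:
  fixes f :: "real \<Rightarrow> real"
  assumes "a \<le> b" and le: "\<And>t. a \<le> t \<Longrightarrow> t \<le> b \<Longrightarrow> \<bar>f t\<bar> \<le> D"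
  shows "\<bar>\<integral>t. indicator {a..b} t * f t \<partial>lborel\<bar> \<le> D * (b - a)"
proof (cases "integrable lborel (\<lambda>t. indicator {a..b} t * f t)")
  case True
  have D: "0 \<le> D" using le[of a] assms(1) by linarith
  have "\<bar>\<integral>t. indicator {a..b} t * f t \<partial>lborel\<bar> \<le> (\<integral>t. \<bar>indicator {a..b} t * f t\<bar> \<partial>lborel)"
    by (rule integral_abs_bound)
  also have "\<dots> \<le> (\<integral>t. D * indicator {a..b} t \<partial>lborel)"
    using True le assms(1) by (intro integral_mono integrable_abs integrable_mult_right) (auto simp: integrable_indicator_iff less_top[symmetric] split: split_indicator)
  also have "\<dots> = D * (b - a)" using assms(1) by simp
  finally show ?thesis .
next
  \<comment> \<open>The integral of a non-integrable function is 0 by convention, and the right-hand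
    side is nonnegative.\<close>
  case False
  have "0 \<le> D" using le[of a] assms(1) by linarith
  then show ?thesis using False assms(1) by (simp add: not_integrable_integral_eq)
qed

text \<open>Folding the line at \<open>x\<close> pairs the points \<open>x - r\<close> and
  \<open>x + r\<close>. The singular kernel becomes a difference quotient, which stays bounded near
  \<open>r = 0\<close> for smooth \<open>g\<close>, so the principal value turns into an ordinary
  integral.\<close>

lemma truncated_symmetric:
  fixes g :: "real \<Rightarrow> real"
  assumes g: "integrable lborel g" and d: "0 < \<delta>"
  shows "integrable lborel (\<lambda>t. indicator {t. \<delta> < \<bar>x - t\<bar>} t * (g t / (x - t)))"
    and "(\<integral>t. indicator {t. \<delta> < \<bar>x - t\<bar>} t * (g t / (x - t)) \<partial>lborel)
       = (\<integral>r. indicator {\<delta><..} r * ((g (x - r) - g (x + r)) / r) \<partial>lborel)"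
proof -
  have [measurable]: "g \<in> borel_measurable borel" using g by auto
  have bnd: "integrable lborel (\<lambda>t. indicator S t * (g (x + c * t) / t))"
    if S: "S \<in> sets borel" "\<And>t. t \<in> S \<Longrightarrow> \<delta> < \<bar>t\<bar>" and c: "c \<noteq> 0" for S c
  proof (rule Bochner_Integration.integrable_bound)
    have [measurable]: "S \<in> sets borel" by fact
    show "integrable lborel (\<lambda>t. 1 / \<delta> * g (x + c * t))"
      using lborel_integrable_real_affine[OF g c, of x] by (rule integrable_mult_right)
    show "(\<lambda>t. indicator S t * (g (x + c * t) / t)) \<in> borel_measurable lborel" by measurable
    show "AE t in lborel. norm (indicator S t * (g (x + c * t) / t)) \<le> norm (1 / \<delta> * g (x + c * t))"
    proof (rule AE_I2)
      fix t show "norm (indicator S t * (g (x + c * t) / t)) \<le> norm (1 / \<delta> * g (x + c * t))"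
      proof (cases "t \<in> S")
        case True
        then have "\<delta> < \<bar>t\<bar>" by (rule S)
        then show ?thesis using d True by (auto simp: abs_mult abs_divide intro!: divide_left_mono)
      qed simp
    qed
  qed
  have A: "integrable lborel (\<lambda>r. indicator {\<delta><..} r * (g (x - r) / r))"
  proof -
    have "integrable lborel (\<lambda>r. indicator {\<delta><..} r * (g (x + (-1) * r) / r))"
      by (rule bnd) (use d in auto)
    then show ?thesis by simp
  qed
  have B: "integrable lborel (\<lambda>r. indicator {\<delta><..} r * (g (x + r) / r))"
  proof -
    have "integrable lborel (\<lambda>r. indicator {\<delta><..} r * (g (x + 1 * r) / r))"
      by (rule bnd) (use d in auto)
    then show ?thesis by simp
  qed
  have A': "integrable lborel (\<lambda>r. indicator {..<-\<delta>} r * (g (x - r) / r))"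
  proof -
    have "integrable lborel (\<lambda>r. indicator {..<-\<delta>} r * (g (x + (-1) * r) / r))"
      by (rule bnd) (use d in auto)
    then show ?thesis by simp
  qed
  have C: "integrable lborel (\<lambda>r. indicator {r. \<delta> < \<bar>r\<bar>} r * (g (x - r) / r))"
  proof -
    have "integrable lborel (\<lambda>r. indicator {r. \<delta> < \<bar>r\<bar>} r * (g (x + (-1) * r) / r))"
      by (rule bnd) (use d in auto)
    then show ?thesis by simp
  qed
  have "integrable lborel (\<lambda>t. indicator {r. \<delta> < \<bar>r\<bar>} (x + (-1) * t) * (g (x - (x + (-1) * t)) / (x + (-1) * t)))"
    by (rule lborel_integrable_real_affine[OF C]) simp
  then show "integrable lborel (\<lambda>t. indicator {t. \<delta> < \<bar>x - t\<bar>} t * (g t / (x - t)))"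
    by (simp add: indicator_def)
  have "(\<integral>t. indicator {t. \<delta> < \<bar>x - t\<bar>} t * (g t / (x - t)) \<partial>lborel)
     = \<bar>-1\<bar> *\<^sub>R (\<integral>r. indicator {t. \<delta> < \<bar>x - t\<bar>} (x + (-1) * r) * (g (x + (-1) * r) / (x - (x + (-1) * r))) \<partial>lborel)"
    by (rule lborel_integral_real_affine) simp
  also have "\<dots> = (\<integral>r. indicator {r. \<delta> < \<bar>r\<bar>} r * (g (x - r) / r) \<partial>lborel)"
    by (simp add: indicator_def)
  also have "\<dots> = (\<integral>r. indicator {\<delta><..} r * (g (x - r) / r) + indicator {..<-\<delta>} r * (g (x - r) / r) \<partial>lborel)"
    using d by (intro Bochner_Integration.integral_cong) (auto simp: indicator_def)
  also have "\<dots> = (\<integral>r. indicator {\<delta><..} r * (g (x - r) / r) \<partial>lborel) + (\<integral>r. indicator {..<-\<delta>} r * (g (x - r) / r) \<partial>lborel)"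
    by (rule Bochner_Integration.integral_add[OF A A'])
  also have "(\<integral>r. indicator {..<-\<delta>} r * (g (x - r) / r) \<partial>lborel)
     = \<bar>-1\<bar> *\<^sub>R (\<integral>r. indicator {..<-\<delta>} (0 + (-1) * r) * (g (x - (0 + (-1) * r)) / (0 + (-1) * r)) \<partial>lborel)"
    by (rule lborel_integral_real_affine) simp
  also have "\<dots> = (\<integral>r. - (indicator {\<delta><..} r * (g (x + r) / r)) \<partial>lborel)"
    by (auto simp: indicator_def intro!: Bochner_Integration.integral_cong)
  also have "\<dots> = - (\<integral>r. indicator {\<delta><..} r * (g (x + r) / r) \<partial>lborel)" by simp
  also have "(\<integral>r. indicator {\<delta><..} r * (g (x - r) / r) \<partial>lborel) + \<dots>
     = (\<integral>r. indicator {\<delta><..} r * (g (x - r) / r) - indicator {\<delta><..} r * (g (x + r) / r) \<partial>lborel)"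
    using A B by (simp add: Bochner_Integration.integral_diff)
  also have "\<dots> = (\<integral>r. indicator {\<delta><..} r * ((g (x - r) - g (x + r)) / r) \<partial>lborel)"
    by (simp only: diff_divide_distrib right_diff_distrib)
  finally show "(\<integral>t. indicator {t. \<delta> < \<bar>x - t\<bar>} t * (g t / (x - t)) \<partial>lborel)
       = (\<integral>r. indicator {\<delta><..} r * ((g (x - r) - g (x + r)) / r) \<partial>lborel)" .
qed

lemma abs_mult_pker_le: "0 < s \<Longrightarrow> \<bar>w\<bar> * pker s w \<le> 1 / 2"
proof -
  assume s: "0 < s"
  have "2 * (s * \<bar>w\<bar>) \<le> s\<^sup>2 + w\<^sup>2"
    using zero_le_power2[of "s - \<bar>w\<bar>"] by (simp add: power2_diff)
  then show ?thesis using square_sum_pos[OF s, of w] by (simp add: pker_def divide_simps mult.commute)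
qed

lemma pker_diff_quotient:
  assumes s: "0 < s" and r: "r \<noteq> 0"
  shows "(pker s (z - r) - pker s (z + r)) / r = 4 * z / s * pker s (z - r) * pker s (z + r)"
proof -
  let ?a = "s\<^sup>2 + (z - r)\<^sup>2" and ?b = "s\<^sup>2 + (z + r)\<^sup>2"
  have ab: "?a \<noteq> 0" "?b \<noteq> 0" using square_sum_pos[OF s] by (metis less_irrefl)+
  have "pker s (z - r) - pker s (z + r) = s * (?b - ?a) / (?a * ?b)"
    using ab by (simp add: pker_def divide_simps) (simp add: algebra_simps)
  also have "?b - ?a = 4 * z * r" by (simp add: power2_eq_square algebra_simps)
  finally show ?thesis using ab r s by (simp add: pker_def divide_simps power2_eq_square)
qed

text \<open>The factor \<open>z\<close> is split between \<open>z - r\<close> and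
  \<open>z + r\<close>, and each part is absorbed by its own kernel through
  \<open>abs_mult_pker_le\<close>. A bound by kernel values alone is what \<open>kap_bounds\<close>
  controls uniformly in the centre.\<close>

lemma pker_conjugate_bound:
  assumes s: "1 \<le> s"
  shows "\<bar>4 * z / s * pker s (z - r) * pker s (z + r)\<bar> \<le> pker s (z - r) + pker s (z + r)"
proof -
  let ?p = "pker s (z - r)" and ?q = "pker s (z + r)"
  have nn: "0 \<le> ?p" "0 \<le> ?q" using s by (auto intro!: pker_nonneg)
  have 1: "\<bar>z - r\<bar> * ?p * ?q \<le> 1/2 * ?q" "\<bar>z + r\<bar> * ?q * ?p \<le> 1/2 * ?p"
    using abs_mult_pker_le[of s "z - r"] abs_mult_pker_le[of s "z + r"] s nn by (intro mult_right_mono; simp)+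
  have "2 * \<bar>z\<bar> \<le> \<bar>z - r\<bar> + \<bar>z + r\<bar>" by linarith
  then have "2 * \<bar>z\<bar> * (?p * ?q) \<le> (\<bar>z - r\<bar> + \<bar>z + r\<bar>) * (?p * ?q)"
    using nn by (intro mult_right_mono) auto
  also have "\<dots> \<le> (?p + ?q) / 2" using 1 by (simp add: algebra_simps)
  finally have "4 * \<bar>z\<bar> * ?p * ?q \<le> ?p + ?q" by simp
  also have "\<dots> \<le> s * (?p + ?q)" using s nn mult_right_mono[of 1 s "?p + ?q"] by simp
  finally have "4 * \<bar>z\<bar> * ?p * ?q / s \<le> ?p + ?q" using s by (simp add: divide_simps mult.commute)
  then show ?thesis using nn s by (simp add: abs_mult)
qed

section \<open>Hilbert transform of a superposition\<close>

context poisson_superposition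
begin

definition trunc :: "real \<Rightarrow> real \<Rightarrow> real \<times> real \<Rightarrow> real" where
  "trunc \<delta> x p = (\<integral>t. indicator {t. \<delta> < \<bar>x - t\<bar>} t * (hkernel x t * kap t p) \<partial>lborel)"

definition hconst :: "real \<times> real \<Rightarrow> real" where
  "hconst p = (\<integral>t. t / (t\<^sup>2 + 1) * kap t p \<partial>lborel)"

text \<open>The limit of \<open>trunc \<delta> x p\<close> as \<delta> tends to 0, that is, the
  Hilbert transform of one weighted kernel. The summand \<open>hconst\<close> is independent of
  \<open>x\<close> and drops out of differences.\<close>

definition h0 :: "real \<Rightarrow> real \<times> real \<Rightarrow> real" where
  "h0 x p = (1 + (snd p)\<^sup>2) * (pi * qker (fst p) (x - snd p)) + hconst p"

lemma trunc_measurable [measurable]: "trunc \<delta> x \<in> borel_measurable N"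
proof -
  have [measurable]: "(\<lambda>(p, t). kap t p) \<in> borel_measurable (N \<Otimes>\<^sub>M lborel)"
    using measurable_compose[OF measurable_pair_swap' kap_measurable] by (simp add: split_beta')
  show ?thesis unfolding trunc_def by measurable
qed

lemma hconst_measurable [measurable]: "hconst \<in> borel_measurable N"
proof -
  have [measurable]: "(\<lambda>(p, t). kap t p) \<in> borel_measurable (N \<Otimes>\<^sub>M lborel)"
    using measurable_compose[OF measurable_pair_swap' kap_measurable] by (simp add: split_beta')
  show ?thesis unfolding hconst_def by measurable
qed

lemma h0_measurable [measurable]: "h0 x \<in> borel_measurable N"
proof -
  have "fst \<in> borel_measurable N" "snd \<in> borel_measurable N"
    by (subst measurable_cong_sets[OF sets_N refl], simp add: borel_prod[symmetric])+
  note [measurable] = this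
  show ?thesis unfolding h0_def by measurable
qed

lemma truncated_integral_F:
  assumes d: "0 < \<delta>"
  shows "integrable N (trunc \<delta> x)"
    and "(\<integral>t. indicator {t. \<delta> < \<bar>x - t\<bar>} t * (hkernel x t * F t) \<partial>lborel) = (\<integral>p. trunc \<delta> x p \<partial>N)"
proof -
  interpret P: pair_sigma_finite lborel N ..
  let ?C = "(1 + x\<^sup>2) / \<delta> + \<bar>x\<bar>"
  let ?f = "\<lambda>t p. indicator {t. \<delta> < \<bar>x - t\<bar>} t * (hkernel x t * kap t p)"
  have C: "0 \<le> ?C" using d by simp
  have i: "integrable (lborel \<Otimes>\<^sub>M N) (case_prod ?f)"
  proof (rule Bochner_Integration.integrable_bound)
    show "integrable (lborel \<Otimes>\<^sub>M N) (\<lambda>z. ?C * (case z of (t, p) \<Rightarrow> kap t p * pker 1 t))"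
      using integrable_pair by (rule integrable_mult_right)
    show "case_prod ?f \<in> borel_measurable (lborel \<Otimes>\<^sub>M N)" by measurable
    have "norm (?f t p) \<le> norm (?C * (kap t p * pker 1 t))" for t p
    proof (cases "\<delta> < \<bar>x - t\<bar>")
      case True
      then have "\<bar>hkernel x t\<bar> * \<bar>kap t p\<bar> \<le> ?C * pker 1 t * \<bar>kap t p\<bar>"
        using hkernel_le[OF d, of x t] by (intro mult_right_mono) auto
      then show ?thesis using True C by (simp add: abs_mult pker_nonneg mult_ac)
    qed simp
    then show "AE z in lborel \<Otimes>\<^sub>M N. norm (case_prod ?f z) \<le> norm (?C * (case z of (t, p) \<Rightarrow> kap t p * pker 1 t))"
      by (intro AE_I2) auto
  qed
  show "integrable N (trunc \<delta> x)"
    using P.integrable_snd[OF i] by (simp add: trunc_def[abs_def])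
  show "(\<integral>t. indicator {t. \<delta> < \<bar>x - t\<bar>} t * (hkernel x t * F t) \<partial>lborel) = (\<integral>p. trunc \<delta> x p \<partial>N)"
    using P.Fubini_integral[OF i] by (simp add: trunc_def F_def)
qed

text \<open>The cut-out parts are integrals over intervals of length \<open>2 * \<delta>\<close> and
  \<delta>, of integrands bounded by \<open>D\<close> and \<open>2 * D\<close>, where
  \<open>D\<close> bounds the weighted kernel near \<open>x\<close>. The error is linear in \<delta>
  with a constant free of \<open>p\<close>, so the limit passes under the integral over the finite
  measure \<open>N\<close>.\<close>

lemma trunc_approx:
  assumes p: "fst p \<in> {1..2}" and d: "0 < \<delta>" "\<delta> \<le> 1"
  shows "\<bar>trunc \<delta> x p - h0 x p\<bar> \<le> 16 * (1 + (\<bar>x\<bar> + 1)\<^sup>2) * \<delta>"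
proof -
  define s where "s = fst p"
  define y where "y = snd p"
  define w where "w = 1 + y\<^sup>2"
  define z where "z = x - y"
  define g where "g t = kap t p" for t
  define D where "D = 4 * (1 + (\<bar>x\<bar> + 1)\<^sup>2)"
  have s: "1 \<le> s" "s \<le> 2" "0 < s" using p by (auto simp: s_def)
  have w: "0 < w" by (simp add: w_def add_pos_nonneg)
  have g_eq: "g t = w * pker s (t - y)" for t by (simp add: g_def kap_def w_def s_def y_def)
  have g0: "0 \<le> g t" and gle: "g t \<le> 4 * (1 + t\<^sup>2)" for t using kap_bounds[OF p] by (auto simp: g_def)
  have gD: "g t \<le> D" if "\<bar>x - t\<bar> \<le> 1" for t
  proof -
    have "\<bar>t\<bar> \<le> \<bar>x\<bar> + 1" using that by linarith
    then have "t\<^sup>2 \<le> (\<bar>x\<bar> + 1)\<^sup>2" by (metis abs_ge_zero abs_le_square_iff abs_of_nonneg add_nonneg_nonneg zero_le_one)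
    then show ?thesis using gle[of t] by (simp add: D_def)
  qed
  have gi: "integrable lborel g" unfolding g_eq using integrable_pker_shift(1)[OF s(3)] by simp
  have [measurable]: "g \<in> borel_measurable borel" using gi by auto
  have t1: "\<bar>t / (t\<^sup>2 + 1)\<bar> \<le> 1" for t :: real
  proof -
    have "2 * \<bar>t\<bar> \<le> t\<^sup>2 + 1" using zero_le_power2[of "\<bar>t\<bar> - 1"] by (simp add: power2_diff)
    then have "\<bar>t\<bar> \<le> t\<^sup>2 + 1" using abs_ge_zero[of t] by linarith
    moreover have "0 < t\<^sup>2 + 1" by (simp add: add_nonneg_pos)
    ultimately show ?thesis by (simp add: abs_divide divide_le_eq)
  qed
  have hi: "integrable lborel (\<lambda>t. t / (t\<^sup>2 + 1) * g t)"
  proof (rule Bochner_Integration.integrable_bound[OF gi])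
    show "AE t in lborel. norm (t / (t\<^sup>2 + 1) * g t) \<le> norm (g t)"
    proof (rule AE_I2)
      fix t show "norm (t / (t\<^sup>2 + 1) * g t) \<le> norm (g t)"
        using mult_right_mono[OF t1[of t], of "\<bar>g t\<bar>"] unfolding real_norm_def abs_mult by simp
    qed
  qed measurable
  have cut: "integrable lborel (\<lambda>t. indicator S t * f t)" if "integrable lborel f" "S \<in> sets borel" for f :: "real \<Rightarrow> real" and S
    using integrable_mult_indicator[of S lborel f] that by simp
  let ?S = "{t. \<delta> < \<bar>x - t\<bar>}"
  note i1 = truncated_symmetric(1)[OF gi d(1), of x]
  have i2: "integrable lborel (\<lambda>t. indicator ?S t * (t / (t\<^sup>2 + 1) * g t))"
    by (rule cut[OF hi]) measurable
  have "trunc \<delta> x p = (\<integral>t. indicator ?S t * (g t / (x - t)) + indicator ?S t * (t / (t\<^sup>2 + 1) * g t) \<partial>lborel)"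
    unfolding trunc_def g_def[symmetric] hkernel_def
    by (rule Bochner_Integration.integral_cong) (simp_all add: distrib_left distrib_right)
  then have split: "trunc \<delta> x p = (\<integral>t. indicator ?S t * (g t / (x - t)) \<partial>lborel) + (\<integral>t. indicator ?S t * (t / (t\<^sup>2 + 1) * g t) \<partial>lborel)"
    using Bochner_Integration.integral_add[OF i1 i2] by simp
  have "t \<in> {x - \<delta>..x + \<delta>} \<longleftrightarrow> t \<notin> ?S" for t by (simp add: not_less abs_le_iff) linarith
  then have ind: "indicator ?S t = 1 - (indicator {x - \<delta>..x + \<delta>} t :: real)" for t
    by (simp add: indicator_def)
  have "(\<integral>t. indicator ?S t * (t / (t\<^sup>2 + 1) * g t) \<partial>lborel) =
     (\<integral>t. t / (t\<^sup>2 + 1) * g t - indicator {x - \<delta>..x + \<delta>} t * (t / (t\<^sup>2 + 1) * g t) \<partial>lborel)"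
    by (simp only: ind left_diff_distrib mult_1)
  also have "\<dots> = hconst p - (\<integral>t. indicator {x - \<delta>..x + \<delta>} t * (t / (t\<^sup>2 + 1) * g t) \<partial>lborel)"
    unfolding hconst_def g_def[symmetric]
    by (intro Bochner_Integration.integral_diff hi cut) auto
  finally have second: "(\<integral>t. indicator ?S t * (t / (t\<^sup>2 + 1) * g t) \<partial>lborel) =
     hconst p - (\<integral>t. indicator {x - \<delta>..x + \<delta>} t * (t / (t\<^sup>2 + 1) * g t) \<partial>lborel)" .
  have b2: "\<bar>\<integral>t. indicator {x - \<delta>..x + \<delta>} t * (t / (t\<^sup>2 + 1) * g t) \<partial>lborel\<bar> \<le> D * ((x + \<delta>) - (x - \<delta>))"
  proof (rule integral_indicator_Icc_bound)
    fix t assume t: "x - \<delta> \<le> t" "t \<le> x + \<delta>"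
    have "\<bar>t / (t\<^sup>2 + 1)\<bar> * g t \<le> 1 * D"
      using t1 gD[of t] g0[of t] t d by (intro mult_mono) auto
    then show "\<bar>t / (t\<^sup>2 + 1) * g t\<bar> \<le> D" using g0[of t] by (simp add: abs_mult)
  qed (use d in auto)
  define k where "k r = 4 * z / s * pker s (z - r) * pker s (z + r)" for r
  have ki: "integrable lborel (\<lambda>r. indicator {0..} r * k r)"
    and kI: "(\<integral>r. indicator {0..} r * k r \<partial>lborel) = pi * qker s z"
    using pker_conjugate[OF s(3), of z] by (auto simp: k_def)
  have gk: "(g (x - r) - g (x + r)) / r = w * k r" if "r \<noteq> 0" for r
  proof -
    have "(g (x - r) - g (x + r)) / r = w * ((pker s (z - r) - pker s (z + r)) / r)"
      by (simp add: g_eq z_def algebra_simps diff_divide_distrib)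
    then show ?thesis using pker_diff_quotient[OF s(3) that, of z] by (simp add: k_def)
  qed
  have kc: "integrable lborel (\<lambda>r. indicator {0..\<delta>} r * k r)"
    using cut[OF ki, of "{0..\<delta>}"] by (rule Bochner_Integration.integrable_cong[THEN iffD1, rotated 2]) (auto simp: indicator_def)
  have "(\<integral>t. indicator ?S t * (g t / (x - t)) \<partial>lborel)
      = (\<integral>r. indicator {\<delta><..} r * ((g (x - r) - g (x + r)) / r) \<partial>lborel)"
    by (rule truncated_symmetric(2)[OF gi d(1)])
  also have "\<dots> = (\<integral>r. w * (indicator {0..} r * k r - indicator {0..\<delta>} r * k r) \<partial>lborel)"
  proof (rule Bochner_Integration.integral_cong)
    fix r
    show "indicator {\<delta><..} r * ((g (x - r) - g (x + r)) / r) = w * (indicator {0..} r * k r - indicator {0..\<delta>} r * k r)"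
      using gk[of r] d by (auto simp: indicator_def)
  qed simp
  also have "\<dots> = w * (pi * qker s z) - w * (\<integral>r. indicator {0..\<delta>} r * k r \<partial>lborel)"
    using ki kc kI by (simp add: algebra_simps)
  finally have first: "(\<integral>t. indicator ?S t * (g t / (x - t)) \<partial>lborel) =
     w * (pi * qker s z) - (\<integral>r. indicator {0..\<delta>} r * (w * k r) \<partial>lborel)"
    by (subst (asm) integral_mult_right_zero[symmetric]) (simp add: mult_ac)
  have b1: "\<bar>\<integral>r. indicator {0..\<delta>} r * (w * k r) \<partial>lborel\<bar> \<le> (2 * D) * (\<delta> - 0)"
  proof (rule integral_indicator_Icc_bound)
    fix r assume r: "0 \<le> r" "r \<le> \<delta>"
    have "\<bar>k r\<bar> \<le> pker s (z - r) + pker s (z + r)"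
      unfolding k_def by (rule pker_conjugate_bound[OF s(1)])
    then have "w * \<bar>k r\<bar> \<le> w * (pker s (z - r) + pker s (z + r))" using w by (intro mult_left_mono) auto
    also have "\<dots> = g (x - r) + g (x + r)" by (simp add: g_eq z_def algebra_simps)
    also have "\<dots> \<le> D + D" using r d by (intro add_mono gD) auto
    finally show "\<bar>w * k r\<bar> \<le> 2 * D" using w by (simp add: abs_mult)
  qed (use d in auto)
  have "h0 x p = w * (pi * qker s z) + hconst p" by (simp add: h0_def w_def s_def y_def z_def)
  then have "trunc \<delta> x p - h0 x p = - (\<integral>r. indicator {0..\<delta>} r * (w * k r) \<partial>lborel)
     - (\<integral>t. indicator {x - \<delta>..x + \<delta>} t * (t / (t\<^sup>2 + 1) * g t) \<partial>lborel)"
    using split first second by simp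
  then have "\<bar>trunc \<delta> x p - h0 x p\<bar> \<le> 2 * D * \<delta> + D * (2 * \<delta>)" using b1 b2 by simp
  then show ?thesis by (simp add: D_def algebra_simps)
qed

definition hilbert_F :: "real \<Rightarrow> real" where "hilbert_F x = (\<integral>p. h0 x p \<partial>N)"

text \<open>\<open>trunc 1 x\<close> is integrable by Fubini, and \<open>h0 x\<close> differs from
  it by a bounded function.\<close>

lemma integrable_h0: "integrable N (h0 x)"
proof -
  have i: "integrable N (trunc 1 x)" by (rule truncated_integral_F) simp
  have "integrable N (\<lambda>p. trunc 1 x p - h0 x p)"
  proof (rule integrable_const_bound)
    show "AE p in N. norm (trunc 1 x p - h0 x p) \<le> 16 * (1 + (\<bar>x\<bar> + 1)\<^sup>2) * 1"
      using scale by eventually_elim (simp only: real_norm_def, rule trunc_approx, auto)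
  qed measurable
  from Bochner_Integration.integrable_diff[OF i this] show ?thesis by simp
qed

lemma has_hilbert_transform_F: "has_hilbert_transform F x (hilbert_F x)"
proof -
  define C where "C = 16 * (1 + (\<bar>x\<bar> + 1)\<^sup>2) * measure N (space N)"
  have le: "\<bar>(\<integral>p. trunc \<delta> x p \<partial>N) - hilbert_F x\<bar> \<le> C * \<delta>" if d: "0 < \<delta>" "\<delta> \<le> 1" for \<delta>
  proof -
    have "(\<integral>p. trunc \<delta> x p \<partial>N) - hilbert_F x = (\<integral>p. trunc \<delta> x p - h0 x p \<partial>N)"
      unfolding hilbert_F_def using truncated_integral_F(1)[OF d(1)] integrable_h0 by simp
    also have "\<bar>\<dots>\<bar> \<le> (\<integral>p. \<bar>trunc \<delta> x p - h0 x p\<bar> \<partial>N)" by (rule integral_abs_bound)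
    also have "\<dots> \<le> (\<integral>p. 16 * (1 + (\<bar>x\<bar> + 1)\<^sup>2) * \<delta> \<partial>N)"
    proof (rule integral_mono_AE)
      show "AE p in N. \<bar>trunc \<delta> x p - h0 x p\<bar> \<le> 16 * (1 + (\<bar>x\<bar> + 1)\<^sup>2) * \<delta>"
        using scale by eventually_elim (rule trunc_approx[OF _ d])
    qed (use truncated_integral_F(1)[OF d(1)] integrable_h0 in auto)
    also have "\<dots> = C * \<delta>" by (simp add: C_def mult_ac)
    finally show ?thesis .
  qed
  have "((\<lambda>\<delta>. (\<integral>p. trunc \<delta> x p \<partial>N) - hilbert_F x) \<longlongrightarrow> 0) (at_right 0)"
  proof (rule tendsto_rabs_zero_cancel, rule tendsto_sandwich)
    show "\<forall>\<^sub>F \<delta> in at_right 0. 0 \<le> \<bar>(\<integral>p. trunc \<delta> x p \<partial>N) - hilbert_F x\<bar>" by simp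
    show "\<forall>\<^sub>F \<delta> in at_right 0. \<bar>(\<integral>p. trunc \<delta> x p \<partial>N) - hilbert_F x\<bar> \<le> C * \<delta>"
      unfolding eventually_at_right_field by (intro exI[of _ 1]) (auto intro!: le)
    show "((\<lambda>\<delta>. C * \<delta>) \<longlongrightarrow> 0) (at_right 0)" by (auto intro!: tendsto_eq_intros)
  qed simp
  then have lim: "((\<lambda>\<delta>. \<integral>p. trunc \<delta> x p \<partial>N) \<longlongrightarrow> hilbert_F x) (at_right 0)"
    by (simp add: LIM_zero_iff)
  show ?thesis unfolding has_hilbert_transform_def
  proof (rule Lim_transform_eventually[OF lim])
    show "\<forall>\<^sub>F \<delta> in at_right 0. (\<integral>p. trunc \<delta> x p \<partial>N) =
       (LINT t:{t. \<delta> < \<bar>x - t\<bar>}|lebesgue. (1 / (x - t) + t / (t\<^sup>2 + 1)) * F t)"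
    proof (unfold eventually_at_right_field, intro exI[of _ 1] conjI allI impI)
      fix \<delta> :: real assume "0 < \<delta>" "\<delta> < 1"
      have "(LINT t:{t. \<delta> < \<bar>x - t\<bar>}|lebesgue. (1 / (x - t) + t / (t\<^sup>2 + 1)) * F t)
        = (\<integral>t. indicator {t. \<delta> < \<bar>x - t\<bar>} t * (hkernel x t * F t) \<partial>lebesgue)"
        by (simp add: set_lebesgue_integral_def hkernel_def)
      also have "\<dots> = (\<integral>t. indicator {t. \<delta> < \<bar>x - t\<bar>} t * (hkernel x t * F t) \<partial>lborel)"
        by (rule integral_completion) measurable
      finally show "(\<integral>p. trunc \<delta> x p \<partial>N) = (LINT t:{t. \<delta> < \<bar>x - t\<bar>}|lebesgue. (1 / (x - t) + t / (t\<^sup>2 + 1)) * F t)"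
        using truncated_integral_F(2)[OF \<open>0 < \<delta>\<close>] by simp
    qed simp
  qed
qed

lemma hilbert_F_diff:
  "hilbert_F x - hilbert_F x' = pi * (\<integral>p. (1 + (snd p)\<^sup>2) * (qker (fst p) (x - snd p) - qker (fst p) (x' - snd p)) \<partial>N)"
  (is "_ = pi * (\<integral>p. ?d p \<partial>N)")
proof -
  have "hilbert_F x - hilbert_F x' = (\<integral>p. h0 x p - h0 x' p \<partial>N)"
    unfolding hilbert_F_def using integrable_h0 by simp
  also have "\<dots> = (\<integral>p. pi * ?d p \<partial>N)"
  proof (rule Bochner_Integration.integral_cong)
    fix p show "h0 x p - h0 x' p = pi * ?d p"
      unfolding h0_def right_diff_distrib by (simp only: mult_ac add_diff_cancel_right)
  qed simp
  finally show ?thesis by simp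
qed

end

section \<open>Smearing with the Poisson kernel\<close>

text \<open>Convolution with the normalised Poisson kernel at height 1; the division by
  \<open>pi\<close> makes it fix constants and preserve integrals.\<close>

definition smear :: "(real \<Rightarrow> real) \<Rightarrow> real \<Rightarrow> real" where
  "smear u x = (\<integral>y. pker 1 (x - y) * u y \<partial>lborel) / pi"

lemma smear_measurable [measurable]:
  assumes [measurable]: "u \<in> borel_measurable borel"
  shows "smear u \<in> borel_measurable borel"
  unfolding smear_def by measurable

text \<open>Centred at the midpoint of \<open>x\<close> and \<open>y\<close>, the product of the
  kernels is the even integrand of \<open>pker_conjugate\<close> with
  \<open>z = (x - y) / 2\<close>, up to the factor \<open>4 * z\<close>. Dividing by it excludes
  \<open>x = y\<close>, which is a null set for the use under the integral in
  \<open>pker_smear\<close>.\<close>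

lemma pker_semigroup:
  assumes "x \<noteq> y"
  shows "integrable lborel (\<lambda>w. pker 1 (x - w) * pker 1 (w - y))"
    and "(\<integral>w. pker 1 (x - w) * pker 1 (w - y) \<partial>lborel) = pi * pker 2 (x - y)"
proof -
  define z where "z = (x - y) / 2"
  define k where "k r = 4 * z / 1 * pker 1 (z - r) * pker 1 (z + r)" for r
  have z: "z \<noteq> 0" using assms by (simp add: z_def)
  have "has_bochner_integral lborel (\<lambda>r. indicator {0..} r *\<^sub>R k r) (pi * qker 1 z)"
    using pker_conjugate[of 1 z] by (simp add: has_bochner_integral_iff k_def)
  then have "has_bochner_integral lborel k (2 *\<^sub>R (pi * qker 1 z))"
    by (rule has_bochner_integral_even_function) (simp add: k_def)
  then have ki: "integrable lborel k" "integral\<^sup>L lborel k = 2 * (pi * qker 1 z)"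
    by (auto simp: has_bochner_integral_iff)
  have *: "pker 1 (x - w) * pker 1 (w - y) = k (- ((x + y) / 2) + 1 * w) / (4 * z)" for w
  proof -
    have "x - w = z - (- ((x + y) / 2) + 1 * w)" "w - y = z + (- ((x + y) / 2) + 1 * w)"
      by (simp_all add: z_def field_simps)
    note e = this
    show ?thesis unfolding k_def e[symmetric] using z by simp
  qed
  have "integrable lborel (\<lambda>w. k (- ((x + y) / 2) + 1 * w))"
    by (rule lborel_integrable_real_affine[OF ki(1)]) simp
  then show "integrable lborel (\<lambda>w. pker 1 (x - w) * pker 1 (w - y))" unfolding * by simp
  have "integral\<^sup>L lborel k = \<bar>1\<bar> *\<^sub>R (\<integral>w. k (- ((x + y) / 2) + 1 * w) \<partial>lborel)"
    by (rule lborel_integral_real_affine) simp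
  then have "(\<integral>w. k (- ((x + y) / 2) + 1 * w) / (4 * z) \<partial>lborel) = 2 * (pi * qker 1 z) / (4 * z)"
    using ki(2) by simp
  also have "\<dots> = pi * pker 2 (x - y)"
  proof -
    have "x - y = 2 * z" by (simp add: z_def)
    moreover have "0 < 1 + z\<^sup>2" by (simp add: add_pos_nonneg)
    ultimately show ?thesis using z by (simp add: qker_def pker_def divide_simps)
  qed
  finally show "(\<integral>w. pker 1 (x - w) * pker 1 (w - y) \<partial>lborel) = pi * pker 2 (x - y)"
    unfolding * .
qed

lemma pker_smear:
  assumes v: "poisson_integrable v" and nn: "\<And>x. 0 \<le> v x"
  shows "integrable lborel (\<lambda>w. pker 1 (x - w) * smear v w)"
    and "(\<integral>w. pker 1 (x - w) * smear v w \<partial>lborel) = (\<integral>y. pker 2 (x - y) * v y \<partial>lborel)"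
proof -
  have [measurable]: "v \<in> borel_measurable borel" using v by (simp add: poisson_integrable_def)
  let ?f = "\<lambda>w y. pker 1 (x - w) * pker 1 (w - y) * v y"
  have I: "(\<integral>w. ?f w y \<partial>lborel) = pi * (pker 2 (x - y) * v y)" "integrable lborel (\<lambda>w. ?f w y)" if "y \<noteq> x" for y
    using pker_semigroup[of x y] that by simp_all
  have ae: "AE y in lborel. y \<noteq> x" by (rule AE_lborel_singleton)
  have f0: "0 \<le> ?f w y" for w y using nn by (simp add: pker_nonneg)
  have i2: "integrable lborel (\<lambda>y. pi * (pker 2 (x - y) * v y))"
    using integrable_pker_mult[OF v, of 2 x] by simp
  have "(\<integral>\<^sup>+z. ennreal (norm (case_prod ?f z)) \<partial>(lborel \<Otimes>\<^sub>M lborel)) = (\<integral>\<^sup>+y. \<integral>\<^sup>+w. ennreal (norm (?f w y)) \<partial>lborel \<partial>lborel)"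
    by (subst lborel_pair.nn_integral_snd[symmetric]) auto
  also have "\<dots> = (\<integral>\<^sup>+y. ennreal (pi * (pker 2 (x - y) * v y)) \<partial>lborel)"
  proof (rule nn_integral_cong_AE)
    show "AE y in lborel. (\<integral>\<^sup>+w. ennreal (norm (?f w y)) \<partial>lborel) = ennreal (pi * (pker 2 (x - y) * v y))"
      using ae
    proof eventually_elim
      case (elim y)
      show ?case using nn_integral_eq_integral[OF I(2)[OF elim] AE_I2, OF f0] f0
        unfolding I(1)[OF elim] real_norm_def by (simp only: abs_of_nonneg)
    qed
  qed
  also have "\<dots> < \<infinity>"
    using i2 nn_integral_eq_integral[OF i2] nn by (simp add: pker_nonneg)
  finally have fin: "(\<integral>\<^sup>+z. ennreal (norm (case_prod ?f z)) \<partial>(lborel \<Otimes>\<^sub>M lborel)) < \<infinity>" .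
  have i: "integrable (lborel \<Otimes>\<^sub>M lborel) (case_prod ?f)"
    by (intro integrableI_bounded fin) measurable
  have eq: "(\<integral>y. ?f w y \<partial>lborel) = pi * (pker 1 (x - w) * smear v w)" for w
    by (simp add: smear_def mult.assoc)
  show "integrable lborel (\<lambda>w. pker 1 (x - w) * smear v w)"
    using lborel_pair.integrable_fst[OF i] unfolding eq by simp
  have "pi * (\<integral>w. pker 1 (x - w) * smear v w \<partial>lborel) = (\<integral>w. \<integral>y. ?f w y \<partial>lborel \<partial>lborel)"
    unfolding eq by simp
  also have "\<dots> = (\<integral>y. \<integral>w. ?f w y \<partial>lborel \<partial>lborel)"
    by (rule lborel_pair.Fubini_integral[OF i, symmetric])
  also have "\<dots> = (\<integral>y. pi * (pker 2 (x - y) * v y) \<partial>lborel)"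
  proof (rule integral_cong_AE)
    show "AE y in lborel. (\<integral>w. ?f w y \<partial>lborel) = pi * (pker 2 (x - y) * v y)"
      using ae by eventually_elim (rule I)
  qed measurable
  finally show "(\<integral>w. pker 1 (x - w) * smear v w \<partial>lborel) = (\<integral>y. pker 2 (x - y) * v y \<partial>lborel)"
    by simp
qed

lemma pker_1_minus_2_bound:
  assumes v: "poisson_integrable v" and nn: "\<And>x. 0 \<le> v x"
    and e: "\<And>x. \<bar>v x - smear v x\<bar> \<le> e"
  shows "\<bar>(\<integral>y. pker 1 (x - y) * v y \<partial>lborel) - (\<integral>y. pker 2 (x - y) * v y \<partial>lborel)\<bar> \<le> pi * e"
proof -
  have i: "integrable lborel (\<lambda>y. pker 1 (x - y))"
    using integrable_pker_shift[of 1 x] by (simp add: pker_commute)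
  have I: "(\<integral>y. pker 1 (x - y) \<partial>lborel) = pi"
    using integrable_pker_shift[of 1 x] by (simp add: pker_commute)
  have i1: "integrable lborel (\<lambda>y. pker 1 (x - y) * v y)" by (rule integrable_pker_mult[OF v]) auto
  note i2 = pker_smear(1)[OF v nn, of x]
  have eq: "(\<integral>y. pker 1 (x - y) * v y \<partial>lborel) - (\<integral>y. pker 2 (x - y) * v y \<partial>lborel)
      = (\<integral>y. pker 1 (x - y) * v y - pker 1 (x - y) * smear v y \<partial>lborel)"
    unfolding Bochner_Integration.integral_diff[OF i1 i2] pker_smear(2)[OF v nn] ..
  have "\<bar>(\<integral>y. pker 1 (x - y) * v y - pker 1 (x - y) * smear v y \<partial>lborel)\<bar> \<le> (\<integral>y. \<bar>pker 1 (x - y) * v y - pker 1 (x - y) * smear v y\<bar> \<partial>lborel)"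
    by (rule integral_abs_bound)
  also have "\<dots> \<le> (\<integral>y. pker 1 (x - y) * e \<partial>lborel)"
  proof (rule integral_mono)
    fix y
    have "pker 1 (x - y) * \<bar>v y - smear v y\<bar> \<le> pker 1 (x - y) * e"
      using e by (intro mult_left_mono pker_nonneg) auto
    then show "\<bar>pker 1 (x - y) * v y - pker 1 (x - y) * smear v y\<bar> \<le> pker 1 (x - y) * e"
      by (simp add: right_diff_distrib[symmetric] abs_mult pker_nonneg)
  qed (use i i1 i2 in \<open>auto intro!: integrable_abs Bochner_Integration.integrable_diff\<close>)
  also have "\<dots> = pi * e" using I by simp
  finally show ?thesis unfolding eq .
qed

text \<open>Both the integral of \<open>qker s z\<close> over heights from 1 to 2 and an
  antiderivative of \<open>pker 1 - pker 2\<close>: the Cauchy-Riemann equations in integrated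
  form.\<close>

definition psi :: "real \<Rightarrow> real" where "psi z = arctan z - arctan (z / 2)"

lemma qker_integral: "(\<integral>s. indicator {1..2} s * qker s z \<partial>lborel) = psi z"
proof -
  have "(\<integral>s. indicator {1..2} s *\<^sub>R qker s z \<partial>lborel) = (- arctan (z / 2)) - (- arctan (z / 1))"
  proof (rule integral_FTC_atLeastAtMost)
    fix s :: real assume s: "1 \<le> s" "s \<le> 2"
    have "((\<lambda>s. - arctan (z / s)) has_real_derivative qker s z) (at s)"
      using s square_sum_pos[of s z]
      by (auto intro!: derivative_eq_intros simp: qker_def divide_simps power2_eq_square)
    then show "((\<lambda>s. - arctan (z / s)) has_vector_derivative qker s z) (at s within {1..2})"
      using has_real_derivative_iff_has_vector_derivative has_vector_derivative_at_within by blast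
  next
    show "continuous_on {1..2} (\<lambda>s. qker s z)"
      unfolding qker_def using square_sum_pos by (intro continuous_intros) (auto simp: add_nonneg_eq_0_iff)
  qed simp
  then show ?thesis by (simp add: psi_def)
qed

lemma psi_diff:
  assumes "x' \<le> x"
  shows "(\<integral>t. indicator {x'..x} t * (pker 1 (t - y) - pker 2 (t - y)) \<partial>lborel) = psi (x - y) - psi (x' - y)"
proof -
  have "(\<integral>t. indicator {x'..x} t *\<^sub>R (pker 1 (t - y) - pker 2 (t - y)) \<partial>lborel) = psi (x - y) - psi (x' - y)"
  proof (rule integral_FTC_atLeastAtMost[OF assms])
    fix t :: real
    have "((\<lambda>t. psi (t - y)) has_real_derivative pker 1 (t - y) - pker 2 (t - y)) (at t)"
      using square_sum_pos[of 1 "t - y"] square_sum_pos[of 2 "t - y"] unfolding psi_def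
      by (auto intro!: derivative_eq_intros simp: pker_def divide_simps power2_eq_square) (auto simp: algebra_simps)
    then show "((\<lambda>t. psi (t - y)) has_vector_derivative pker 1 (t - y) - pker 2 (t - y)) (at t within {x'..x})"
      using has_real_derivative_iff_has_vector_derivative has_vector_derivative_at_within by blast
  next
    have "1 + (t - y)\<^sup>2 \<noteq> 0" "4 + (t - y)\<^sup>2 \<noteq> 0" for t
      using square_sum_pos[of 1 "t - y"] square_sum_pos[of 2 "t - y"] by auto
    then show "continuous_on {x'..x} (\<lambda>t. pker 1 (t - y) - pker 2 (t - y))"
      unfolding pker_def by (intro continuous_intros) auto
  qed
  then show ?thesis by simp
qed

text \<open>Only a difference of values of \<open>psi\<close> appears, because \<open>psi\<close>
  decays like \<open>1 / z\<close> and is not integrable against a general Poisson integrable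
  \<open>v\<close>. The difference is an integral of \<open>pker 1 - pker 2\<close> over
  \<open>{x'..x}\<close>; after exchanging the integrals the inner one is at most
  \<open>pi * e\<close> by \<open>pker_1_minus_2_bound\<close>.\<close>

lemma psi_convolution_lipschitz:
  assumes v: "poisson_integrable v" and nn: "\<And>x. 0 \<le> v x"
    and e: "\<And>x. \<bar>v x - smear v x\<bar> \<le> e" and le: "x' \<le> x"
  shows "\<bar>\<integral>y. v y * (psi (x - y) - psi (x' - y)) \<partial>lborel\<bar> \<le> pi * e * (x - x')"
proof -
  have [measurable]: "v \<in> borel_measurable borel" using v by (simp add: poisson_integrable_def)
  let ?f = "\<lambda>t y. indicator {x'..x} t * ((pker 1 (t - y) - pker 2 (t - y)) * v y)"
  \<comment> \<open>Twice the bound of \<open>pker_weight_le\<close>, for heights 1 and 2, at a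
    point \<open>t\<close> between \<open>x'\<close> and \<open>x\<close>.\<close>
  define M where "M = 8 * (1 + (\<bar>x\<bar> + \<bar>x'\<bar>)\<^sup>2)"
  have i1: "integrable lborel (\<lambda>y. (pker 1 (t - y) - pker 2 (t - y)) * v y)" for t
    unfolding left_diff_distrib
    by (intro Bochner_Integration.integrable_diff integrable_pker_mult[OF v]) auto
  have vi: "integrable lborel (\<lambda>y. M * (v y / (1 + y\<^sup>2)))"
    using v unfolding poisson_integrable_def by (intro integrable_mult_right) auto
  have bound: "\<bar>?f t y\<bar> \<le> indicator {x'..x} t * (M * (v y / (1 + y\<^sup>2)))" for t y
  proof (cases "t \<in> {x'..x}")
    case True
    then have "\<bar>t\<bar> \<le> \<bar>x\<bar> + \<bar>x'\<bar>" by auto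
    then have "t\<^sup>2 \<le> (\<bar>x\<bar> + \<bar>x'\<bar>)\<^sup>2" by (metis abs_ge_zero abs_le_square_iff abs_of_nonneg add_nonneg_nonneg)
    moreover have y: "0 < 1 + y\<^sup>2" by (simp add: add_pos_nonneg)
    moreover have "(1 + y\<^sup>2) * \<bar>pker 1 (t - y) - pker 2 (t - y)\<bar> \<le> (1 + y\<^sup>2) * (pker 1 (t - y) + pker 2 (t - y))"
      using pker_nonneg[of 1 "t - y"] pker_nonneg[of 2 "t - y"] y by (intro mult_left_mono) auto
    ultimately have "(1 + y\<^sup>2) * \<bar>pker 1 (t - y) - pker 2 (t - y)\<bar> \<le> M"
      using pker_weight_le[of 1 y t] pker_weight_le[of 2 y t] by (simp add: M_def distrib_left)
    then have "\<bar>pker 1 (t - y) - pker 2 (t - y)\<bar> \<le> M / (1 + y\<^sup>2)" using y by (simp add: field_simps)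
    then have "\<bar>pker 1 (t - y) - pker 2 (t - y)\<bar> * v y \<le> M / (1 + y\<^sup>2) * v y"
      using nn by (rule mult_right_mono)
    then show ?thesis using True nn[of y] by (simp add: abs_mult)
  qed simp
  have i: "integrable (lborel \<Otimes>\<^sub>M lborel) (case_prod ?f)"
  proof (rule lborel_pair.Fubini_integrable)
    show "AE t in lborel. integrable lborel (\<lambda>y. case_prod ?f (t, y))"
      using i1 by (intro AE_I2) simp
    show "integrable lborel (\<lambda>t. \<integral>y. norm (case_prod ?f (t, y)) \<partial>lborel)"
    proof (rule Bochner_Integration.integrable_bound)
      let ?K = "\<integral>y. M * (v y / (1 + y\<^sup>2)) \<partial>lborel"
      show "integrable lborel (\<lambda>t. ?K * indicator {x'..x} t)"
        using le by (intro integrable_mult_right integrable_real_indicator) auto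
      show "AE t in lborel. norm (\<integral>y. norm (case_prod ?f (t, y)) \<partial>lborel) \<le> norm (?K * indicator {x'..x} t)"
      proof (rule AE_I2)
        fix t :: real
        have "(\<integral>y. norm (case_prod ?f (t, y)) \<partial>lborel) \<le> (\<integral>y. indicator {x'..x} t * (M * (v y / (1 + y\<^sup>2))) \<partial>lborel)"
        proof (rule integral_mono)
          show "integrable lborel (\<lambda>y. norm (case_prod ?f (t, y)))"
            unfolding prod.case by (intro integrable_norm integrable_mult_right i1)
          show "integrable lborel (\<lambda>y. indicator {x'..x} t * (M * (v y / (1 + y\<^sup>2))))"
            by (intro integrable_mult_right vi)
          show "norm (case_prod ?f (t, y)) \<le> indicator {x'..x} t * (M * (v y / (1 + y\<^sup>2)))" for y
            unfolding prod.case real_norm_def by (rule bound)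
        qed
        also have "\<dots> = ?K * indicator {x'..x} t"
          by (subst integral_mult_right_zero) (rule mult.commute)
        finally show "norm (\<integral>y. norm (case_prod ?f (t, y)) \<partial>lborel) \<le> norm (?K * indicator {x'..x} t)"
          by (smt (verit) Bochner_Integration.integral_nonneg norm_ge_zero real_norm_def)
      qed
    qed measurable
  qed measurable
  have "(\<integral>y. v y * (psi (x - y) - psi (x' - y)) \<partial>lborel) = (\<integral>y. \<integral>t. ?f t y \<partial>lborel \<partial>lborel)"
    unfolding psi_diff[OF le, symmetric] integral_mult_right_zero[symmetric]
    by (intro Bochner_Integration.integral_cong refl) (simp only: mult_ac)
  also have "\<dots> = (\<integral>t. \<integral>y. ?f t y \<partial>lborel \<partial>lborel)"
    by (rule lborel_pair.Fubini_integral[OF i])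
  also have "\<dots> = (\<integral>t. indicator {x'..x} t * (\<integral>y. (pker 1 (t - y) - pker 2 (t - y)) * v y \<partial>lborel) \<partial>lborel)"
    by simp
  finally have eq: "(\<integral>y. v y * (psi (x - y) - psi (x' - y)) \<partial>lborel) = (\<integral>t. indicator {x'..x} t * (\<integral>y. (pker 1 (t - y) - pker 2 (t - y)) * v y \<partial>lborel) \<partial>lborel)" .
  show ?thesis unfolding eq
  proof (rule integral_indicator_Icc_bound[OF le])
    fix t
    have "(\<integral>y. (pker 1 (t - y) - pker 2 (t - y)) * v y \<partial>lborel) = (\<integral>y. pker 1 (t - y) * v y \<partial>lborel) - (\<integral>y. pker 2 (t - y) * v y \<partial>lborel)"
      unfolding left_diff_distrib
      by (intro Bochner_Integration.integral_diff integrable_pker_mult[OF v]) auto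
    then show "\<bar>\<integral>y. (pker 1 (t - y) - pker 2 (t - y)) * v y \<partial>lborel\<bar> \<le> pi * e"
      using pker_1_minus_2_bound[OF v nn e] by simp
  qed
qed

lemma integrable_lborel_imp_lebesgue:
  fixes f :: "real \<Rightarrow> real"
  assumes "integrable lborel f"
  shows "integrable lebesgue f"
proof -
  have [measurable]: "f \<in> borel_measurable lborel" using assms by auto
  show ?thesis using assms by (subst integrable_completion) auto
qed

text \<open>Heights are uniform on \<open>{1..2}\<close>. The division by the weight undoes the
  factor in \<open>kap\<close>, so \<open>F\<close> averages the unnormalised Poisson integrals of
  \<open>v\<close> over these heights.\<close>

definition superposition_measure :: "(real \<Rightarrow> real) \<Rightarrow> (real \<times> real) measure" where
  "superposition_measure v = density (lborel \<Otimes>\<^sub>M lborel) (\<lambda>p. ennreal (indicator {1..2} (fst p) * (v (snd p) / (1 + (snd p)\<^sup>2))))"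

lemma superposition_measure:
  assumes v: "poisson_integrable v" and nn: "\<And>x. 0 \<le> v x"
  shows "poisson_superposition (superposition_measure v)"
    and "\<And>f. integrable (superposition_measure v) f \<Longrightarrow>
      (\<integral>p. f p \<partial>superposition_measure v) = (\<integral>y. v y / (1 + y\<^sup>2) * (\<integral>s. indicator {1..2} s * f (s, y) \<partial>lborel) \<partial>lborel)"
proof -
  let ?N = "superposition_measure v"
  let ?w = "\<lambda>p :: real \<times> real. indicator {1..2} (fst p) * (v (snd p) / (1 + (snd p)\<^sup>2)) :: real"
  have [measurable]: "v \<in> borel_measurable borel" using v by (simp add: poisson_integrable_def)
  have vi: "integrable lborel (\<lambda>y. v y / (1 + y\<^sup>2))" using v by (simp add: poisson_integrable_def)
  have w0: "0 \<le> ?w p" for p using nn by simp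
  have sets: "sets ?N = sets borel" unfolding superposition_measure_def
    by (simp add: borel_prod[symmetric] cong: sets_pair_measure_cong)
  have "emeasure ?N (space ?N) = (\<integral>\<^sup>+p. ennreal (?w p) \<partial>(lborel \<Otimes>\<^sub>M lborel))"
    unfolding superposition_measure_def space_density
    by (subst emeasure_density[OF _ sets.top]) (auto intro!: nn_integral_cong)
  also have "\<dots> = (\<integral>\<^sup>+(s::real). \<integral>\<^sup>+y. indicator {1..2} s * ennreal (v y / (1 + y\<^sup>2)) \<partial>lborel \<partial>lborel)"
    by (subst lborel.nn_integral_fst[symmetric]) (auto simp: nn simp flip: ennreal_indicator ennreal_mult)
  also have "\<dots> = (\<integral>\<^sup>+y. ennreal (v y / (1 + y\<^sup>2)) \<partial>lborel)"
    by (simp add: nn_integral_cmult nn_integral_multc)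
  also have "\<dots> < \<infinity>"
    using nn_integral_eq_integral[OF vi] nn by simp
  finally have fin: "emeasure ?N (space ?N) < \<infinity>" .
  show "poisson_superposition ?N"
  proof (intro poisson_superposition.intro finite_measureI poisson_superposition_axioms.intro)
    show "emeasure ?N (space ?N) \<noteq> \<infinity>" using fin by simp
    show "sets ?N = sets borel" by (rule sets)
    show "AE p in ?N. fst p \<in> {1..2}"
      unfolding superposition_measure_def by (subst AE_density) (auto simp: indicator_def)
  qed
  fix f :: "real \<times> real \<Rightarrow> real" assume fi: "integrable ?N f"
  have "f \<in> borel_measurable ?N" using fi by auto
  then have [measurable]: "f \<in> borel_measurable (lborel \<Otimes>\<^sub>M lborel)"
    unfolding superposition_measure_def by simp
  have fi': "integrable (lborel \<Otimes>\<^sub>M lborel) (\<lambda>p. ?w p * f p)"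
    using fi unfolding superposition_measure_def by (subst (asm) integrable_density) (auto simp: nn)
  have "(\<integral>p. f p \<partial>?N) = (\<integral>p. ?w p * f p \<partial>(lborel \<Otimes>\<^sub>M lborel))"
    unfolding superposition_measure_def by (subst integral_density) (auto simp: nn)
  also have "\<dots> = (\<integral>y. (\<integral>s. ?w (s, y) * f (s, y) \<partial>lborel) \<partial>lborel)"
    using lborel_pair.integral_snd[of "\<lambda>s y. ?w (s, y) * f (s, y)"] fi' by (simp add: split_beta')
  also have "\<dots> = (\<integral>y. v y / (1 + y\<^sup>2) * (\<integral>s. indicator {1..2} s * f (s, y) \<partial>lborel) \<partial>lborel)"
    unfolding integral_mult_right_zero[symmetric] fst_conv snd_conv
    by (intro Bochner_Integration.integral_cong refl) (simp only: mult_ac)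
  finally show "(\<integral>p. f p \<partial>?N) = (\<integral>y. v y / (1 + y\<^sup>2) * (\<integral>s. indicator {1..2} s * f (s, y) \<partial>lborel) \<partial>lborel)" .
qed

text \<open>One \<open>pi\<close> in the Lipschitz constant stems from the transform of the kernel,
  the other from the normalisation of \<open>smear\<close>. Harnack's factor 1/2 is affordable
  because \<open>F\<close> is built from unnormalised kernels: it is at least \<open>pi / 2\<close>
  times \<open>smear v\<close>, and \<open>pi / 2 \<ge> 1\<close>.\<close>

lemma hilbert_transform_lipschitz_majorant:
  assumes v: "poisson_integrable v" and nn: "\<And>x. 0 \<le> v x"
    and e: "\<And>x. \<bar>v x - smear v x\<bar> \<le> e"
  shows "\<exists>F. (\<forall>x. v x - e \<le> F x) \<and> integrable poisson_measure F \<and>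
     (\<exists>g. is_hilbert_transform F g \<and> (pi\<^sup>2 * e)-lipschitz_on UNIV g)"
proof -
  interpret poisson_superposition "superposition_measure v"
    by (rule superposition_measure(1)[OF v nn])
  note int = superposition_measure(2)[OF v nn]
  let ?N = "superposition_measure v"
  have pos: "1 + y\<^sup>2 \<noteq> 0" for y :: real using square_sum_pos[of 1 y] by auto
  have e0: "0 \<le> e" using e[of 0] by linarith
  have lip: "\<bar>hilbert_F x - hilbert_F x'\<bar> \<le> pi\<^sup>2 * e * (x - x')" if le: "x' \<le> x" for x x'
  proof -
    let ?d = "\<lambda>p. (1 + (snd p)\<^sup>2) * (qker (fst p) (x - snd p) - qker (fst p) (x' - snd p))"
    have "integrable ?N (\<lambda>p. (h0 x p - h0 x' p) / pi)"
      by (intro integrable_divide Bochner_Integration.integrable_diff integrable_h0)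
    then have i: "integrable ?N ?d"
      by (rule Bochner_Integration.integrable_cong[THEN iffD1, rotated 2]) (auto simp: h0_def field_simps)
    have inner: "(\<integral>s. indicator {1..2} s * ?d (s, y) \<partial>lborel) = (1 + y\<^sup>2) * (psi (x - y) - psi (x' - y))" for y
    proof -
      have qi: "integrable lborel (\<lambda>s. indicator {1..2} s * qker s z)" for z
      proof -
        have "set_integrable lborel {1..2} (\<lambda>s. qker s z)"
          unfolding qker_def using square_sum_pos by (intro borel_integrable_atLeastAtMost' continuous_intros) (auto simp: add_nonneg_eq_0_iff)
        then show ?thesis by (simp add: set_integrable_def)
      qed
      have "(\<integral>s. indicator {1..2} s * ?d (s, y) \<partial>lborel)
        = (\<integral>s. (1 + y\<^sup>2) * (indicator {1..2} s * qker s (x - y) - indicator {1..2} s * qker s (x' - y)) \<partial>lborel)"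
        by (intro Bochner_Integration.integral_cong refl) (simp add: algebra_simps)
      then show ?thesis using qi by (simp add: qker_integral)
    qed
    have "(\<integral>p. ?d p \<partial>?N) = (\<integral>y. v y * (psi (x - y) - psi (x' - y)) \<partial>lborel)"
      unfolding int[OF i] inner by (intro Bochner_Integration.integral_cong refl) (simp add: pos)
    then have "\<bar>\<integral>p. ?d p \<partial>?N\<bar> \<le> pi * e * (x - x')"
      using psi_convolution_lipschitz[OF v nn e le] by simp
    then have "pi * \<bar>\<integral>p. ?d p \<partial>?N\<bar> \<le> pi * (pi * e * (x - x'))" by (intro mult_left_mono) auto
    then show ?thesis unfolding hilbert_F_diff abs_mult by (simp add: power2_eq_square mult_ac)
  qed
  have Lip: "(pi\<^sup>2 * e)-lipschitz_on UNIV hilbert_F"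
  proof (rule lipschitz_onI)
    fix x y :: real
    show "dist (hilbert_F x) (hilbert_F y) \<le> pi\<^sup>2 * e * dist x y"
      using lip[of x y] lip[of y x] by (cases "x \<le> y") (auto simp: dist_real_def abs_minus_commute)
  qed (use e0 in auto)
  have hil: "is_hilbert_transform F hilbert_F"
    unfolding is_hilbert_transform_def using has_hilbert_transform_F by simp
  have Fi: "integrable poisson_measure F"
  proof -
    have [measurable]: "F \<in> borel_measurable lebesgue"
      by (rule measurable_completion) simp
    have "integrable lborel (\<lambda>t. 1 / (1 + t\<^sup>2) * F t)"
      using integrable_F by (simp add: pker_def mult.commute)
    then have "integrable lebesgue (\<lambda>t. 1 / (1 + t\<^sup>2) * F t)" by (rule integrable_lborel_imp_lebesgue)
    then show ?thesis unfolding poisson_measure_def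
      by (subst integrable_density) (auto intro!: measurable_completion)
  qed
  have kapi: "integrable ?N (kap t)" for t
  proof (rule integrable_const_bound)
    show "AE p in ?N. norm (kap t p) \<le> 4 * (1 + t\<^sup>2)"
      using scale by eventually_elim (use kap_bounds in \<open>simp only: real_norm_def abs_of_nonneg\<close>)
    have "(\<lambda>p. kap t p) \<in> borel_measurable ?N" by measurable
    then show "kap t \<in> borel_measurable ?N" by simp
  qed
  have "v t - e \<le> F t" for t
  proof (cases "v t \<le> e")
    case True
    then show ?thesis using F_nonneg[of t] by simp
  next
    case False
    let ?k = "\<lambda>p. (1 + (snd p)\<^sup>2) * (pker 1 (t - snd p) / 2)"
    have [measurable]: "fst \<in> borel_measurable ?N" "snd \<in> borel_measurable ?N"
      by (subst measurable_cong_sets[OF sets_N refl], simp add: borel_prod[symmetric])+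
    have ki: "integrable ?N ?k"
    proof (rule integrable_const_bound)
      show "AE p in ?N. norm (?k p) \<le> 4 * (1 + t\<^sup>2)"
      proof (rule AE_I2)
        fix p :: "real \<times> real"
        have "0 \<le> (1 + (snd p)\<^sup>2) * pker 1 (t - snd p)" by (simp add: pker_nonneg)
        then show "norm (?k p) \<le> 4 * (1 + t\<^sup>2)"
          using pker_weight_le[of 1 "snd p" t] by (simp add: abs_of_nonneg)
      qed
    qed measurable
    have "pi / 2 * smear v t = (\<integral>y. pker 1 (t - y) * v y / 2 \<partial>lborel)"
      by (simp add: smear_def)
    also have "\<dots> = (\<integral>p. ?k p \<partial>?N)"
      unfolding int[OF ki] by (intro Bochner_Integration.integral_cong refl) (simp add: pos)
    also have "\<dots> \<le> F t" unfolding F_def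
    proof (rule integral_mono_AE[OF ki kapi])
      show "AE p in ?N. ?k p \<le> kap t p" using scale
      proof eventually_elim
        case (elim p)
        show ?case unfolding kap_def using elim by (intro mult_left_mono pker_ge) auto
      qed
    qed
    finally have "pi / 2 * smear v t \<le> F t" .
    moreover have "v t - e \<le> smear v t" using e[of t] by linarith
    moreover have "1 * smear v t \<le> pi / 2 * smear v t"
      using calculation(2) False pi_ge_two by (intro mult_right_mono) auto
    ultimately show ?thesis by linarith
  qed
  with Fi hil Lip show ?thesis by blast
qed

section \<open>The obstacle problem\<close>

lemma integrable_imp_poisson_integrable:
  assumes "integrable lborel u"
  shows "poisson_integrable u"
proof -
  have [measurable]: "u \<in> borel_measurable borel" using assms by auto
  have "integrable lborel (\<lambda>y. u y / (1 + y\<^sup>2))"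
  proof (rule Bochner_Integration.integrable_bound[OF assms])
    have "\<bar>u y\<bar> / (1 + y\<^sup>2) \<le> \<bar>u y\<bar> / 1" for y by (intro divide_left_mono) (auto simp: add_pos_nonneg)
    then show "AE y in lborel. norm (u y / (1 + y\<^sup>2)) \<le> norm (u y)"
      by (intro AE_I2) (simp add: abs_divide add_pos_nonneg)
  qed measurable
  then show ?thesis by (simp add: poisson_integrable_def)
qed

lemma integrable_pker_1_mult: "poisson_integrable u \<Longrightarrow> integrable lborel (\<lambda>y. pker 1 (x - y) * u y)"
  by (rule integrable_pker_mult) auto

lemma smear_mono:
  assumes "poisson_integrable u" "poisson_integrable v" "\<And>y. u y \<le> v y"
  shows "smear u x \<le> smear v x"
  unfolding smear_def using assms
  by (intro divide_right_mono integral_mono integrable_pker_1_mult mult_left_mono pker_nonneg) auto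

lemma smear_nonneg: "(\<And>y. 0 \<le> u y) \<Longrightarrow> 0 \<le> smear u x"
  unfolding smear_def by (intro divide_nonneg_pos Bochner_Integration.integral_nonneg mult_nonneg_nonneg pker_nonneg) auto

lemma smear_minus: "smear (\<lambda>y. - u y) x = - smear u x"
  by (simp add: smear_def)

lemma smear_integral:
  assumes w: "integrable lborel w" and nn: "\<And>x. 0 \<le> w x"
  shows "integrable lborel (smear w)" "integral\<^sup>L lborel (smear w) = integral\<^sup>L lborel w"
proof -
  have [measurable]: "w \<in> borel_measurable borel" using w by auto
  let ?f = "\<lambda>x y. pker 1 (x - y) * w y"
  have I: "integrable lborel (\<lambda>x. ?f x y)" "(\<integral>x. ?f x y \<partial>lborel) = pi * w y" for y
    using integrable_pker_shift[of 1 y] by simp_all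
  have f0: "0 \<le> ?f x y" for x y using nn by (simp add: pker_nonneg)
  have "(\<integral>\<^sup>+z. ennreal (norm (case_prod ?f z)) \<partial>(lborel \<Otimes>\<^sub>M lborel)) = (\<integral>\<^sup>+y. \<integral>\<^sup>+x. ennreal (norm (?f x y)) \<partial>lborel \<partial>lborel)"
    by (subst lborel_pair.nn_integral_snd[symmetric]) auto
  also have "\<dots> = (\<integral>\<^sup>+y. ennreal (pi * w y) \<partial>lborel)"
    using nn_integral_eq_integral[OF I(1) AE_I2, OF f0] f0
    unfolding I(2) real_norm_def by (simp only: abs_of_nonneg)
  also have "\<dots> < \<infinity>"
    using nn_integral_eq_integral[OF integrable_mult_right[OF w, of pi]] nn by simp
  finally have fin: "(\<integral>\<^sup>+z. ennreal (norm (case_prod ?f z)) \<partial>(lborel \<Otimes>\<^sub>M lborel)) < \<infinity>" .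
  have i: "integrable (lborel \<Otimes>\<^sub>M lborel) (case_prod ?f)"
    by (intro integrableI_bounded fin) measurable
  have eq: "(\<integral>y. ?f x y \<partial>lborel) = pi * smear w x" for x
    by (simp add: smear_def)
  show "integrable lborel (smear w)"
    using lborel_pair.integrable_fst[OF i] unfolding eq by simp
  have "pi * integral\<^sup>L lborel (smear w) = pi * integral\<^sup>L lborel w"
    using lborel_pair.Fubini_integral[OF i] unfolding eq I(2) by simp
  then show "integral\<^sup>L lborel (smear w) = integral\<^sup>L lborel w" by simp
qed

text \<open>Averaging with a symmetric kernel contracts the quadratic form:
  \<open>u x * u y \<le> ((u x)\<^sup>2 + (u y)\<^sup>2) / 2\<close>, and \<open>smear\<close>
  preserves the integral of the square. The bound \<open>M\<close> makes the integrable
  \<open>u\<close> square integrable.\<close>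

lemma smear_energy:
  assumes u: "integrable lborel u" and nn: "\<And>x. 0 \<le> u x" and M: "\<And>x. u x \<le> M"
  shows "integrable lborel (\<lambda>x. u x * (u x - smear u x))"
    and "0 \<le> (\<integral>x. u x * (u x - smear u x) \<partial>lborel)"
proof -
  have [measurable]: "u \<in> borel_measurable borel" using u by auto
  have pu: "poisson_integrable u" using u by (rule integrable_imp_poisson_integrable)
  have u2: "integrable lborel (\<lambda>x. (u x)\<^sup>2)"
  proof (rule Bochner_Integration.integrable_bound[OF integrable_mult_right[OF u, of M]])
    have "u x * u x \<le> M * u x" for x using M nn by (intro mult_right_mono) auto
    then show "AE x in lborel. norm ((u x)\<^sup>2) \<le> norm (M * u x)"
      by (intro AE_I2) (smt (verit) power2_eq_square real_norm_def zero_le_power2)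
  qed measurable
  have pu2: "poisson_integrable (\<lambda>x. (u x)\<^sup>2)" using u2 by (rule integrable_imp_poisson_integrable)
  have I: "integrable lborel (\<lambda>y. pker 1 (x - y))" "(\<integral>y. pker 1 (x - y) \<partial>lborel) = pi" for x
    using integrable_pker_shift[of 1 x] by (simp_all add: pker_commute)
  have le: "u x * smear u x \<le> ((u x)\<^sup>2 + smear (\<lambda>x. (u x)\<^sup>2) x) / 2" for x
  proof -
    have "u x * (\<integral>y. pker 1 (x - y) * u y \<partial>lborel) = (\<integral>y. u x * (pker 1 (x - y) * u y) \<partial>lborel)" by simp
    also have "\<dots> \<le> (\<integral>y. pker 1 (x - y) * (u x)\<^sup>2 / 2 + pker 1 (x - y) * (u y)\<^sup>2 / 2 \<partial>lborel)"
    proof (rule integral_mono)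
      fix y
      have "u x * u y \<le> ((u x)\<^sup>2 + (u y)\<^sup>2) / 2"
        using zero_le_power2[of "u x - u y"] by (simp add: power2_diff)
      then have "pker 1 (x - y) * (u x * u y) \<le> pker 1 (x - y) * (((u x)\<^sup>2 + (u y)\<^sup>2) / 2)"
        by (rule mult_left_mono) (simp add: pker_nonneg)
      then show "u x * (pker 1 (x - y) * u y) \<le> pker 1 (x - y) * (u x)\<^sup>2 / 2 + pker 1 (x - y) * (u y)\<^sup>2 / 2"
        by (simp add: algebra_simps)
    qed (use I integrable_pker_1_mult[OF pu] integrable_pker_1_mult[OF pu2] in simp_all)
    also have "\<dots> = pi * (u x)\<^sup>2 / 2 + (\<integral>y. pker 1 (x - y) * (u y)\<^sup>2 \<partial>lborel) / 2"
      using I integrable_pker_1_mult[OF pu2] by simp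
    finally show ?thesis unfolding smear_def by (simp add: field_simps)
  qed
  note s = smear_integral[OF u2]
  have s2: "integrable lborel (\<lambda>x. ((u x)\<^sup>2 + smear (\<lambda>x. (u x)\<^sup>2) x) / 2)" using s u2 by simp
  have us: "integrable lborel (\<lambda>x. u x * smear u x)"
  proof (rule Bochner_Integration.integrable_bound[OF s2])
    show "AE x in lborel. norm (u x * smear u x) \<le> norm (((u x)\<^sup>2 + smear (\<lambda>x. (u x)\<^sup>2) x) / 2)"
    proof (rule AE_I2)
      fix x
      have "0 \<le> u x * smear u x" using nn smear_nonneg[of u] by simp
      then show "norm (u x * smear u x) \<le> norm (((u x)\<^sup>2 + smear (\<lambda>x. (u x)\<^sup>2) x) / 2)"
        using le[of x] unfolding real_norm_def by linarith
    qed
  qed measurable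
  show "integrable lborel (\<lambda>x. u x * (u x - smear u x))"
    using u2 us by (simp add: right_diff_distrib power2_eq_square)
  have "(\<integral>x. u x * smear u x \<partial>lborel) \<le> (\<integral>x. ((u x)\<^sup>2 + smear (\<lambda>x. (u x)\<^sup>2) x) / 2 \<partial>lborel)"
    using us s2 le by (rule integral_mono)
  also have "\<dots> = (\<integral>x. (u x)\<^sup>2 \<partial>lborel)" using s u2 by simp
  finally show "0 \<le> (\<integral>x. u x * (u x - smear u x) \<partial>lborel)"
    using u2 us by (simp add: right_diff_distrib power2_eq_square)
qed

text \<open>Discrete obstacle problem: \<open>u\<close> is the least majorant of \<open>f\<close> with \<open>smear u - u \<le> e\<close>.
  On the contact set \<open>u = f\<close> the opposite bound is inherited from \<open>f\<close>, off it equality holds.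
  Testing this against \<open>u\<close> itself bounds the mass, because the energy is nonnegative.\<close>

lemma obstacle_problem:
  assumes [measurable]: "f \<in> borel_measurable borel"
    and f0: "\<And>x. 0 \<le> f x" and fB: "\<And>x. f x \<le> B x"
    and B: "integrable lborel B" and BM: "\<And>x. B x \<le> M"
    and fe: "\<And>x. f x - smear f x \<le> e" and Be: "\<And>x. smear B x - B x \<le> e" and e: "0 < e"
  shows "\<exists>u. integrable lborel u \<and> (\<forall>x. f x \<le> u x \<and> u x \<le> B x \<and> \<bar>u x - smear u x\<bar> \<le> e) \<and>
     integral\<^sup>L lborel u \<le> 2 * integral\<^sup>L lborel f"
proof -
  have [measurable]: "B \<in> borel_measurable borel" using B by auto
  \<comment> \<open>Iteration from below for the fixed point equation
    \<open>u = max f (smear u - e)\<close>. It increases because \<open>smear\<close> is monotone,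
    and the supersolution \<open>B\<close> keeps all iterates under one integrable bound.\<close>
  define U where "U n = ((\<lambda>u x. max (f x) (smear u x - e)) ^^ n) f" for n
  have U0: "U 0 = f" and US: "U (Suc n) x = max (f x) (smear (U n) x - e)" for n x
    by (simp_all add: U_def)
  have dom: "integrable lborel u" if [measurable]: "u \<in> borel_measurable borel" and "\<And>x. f x \<le> u x" "\<And>x. u x \<le> B x" for u
  proof (rule Bochner_Integration.integrable_bound[OF B])
    show "AE x in lborel. norm (u x) \<le> norm (B x)"
    proof (rule AE_I2)
      fix x show "norm (u x) \<le> norm (B x)" using that(2,3)[of x] f0[of x] by simp
    qed
  qed measurable
  have pB: "poisson_integrable B" using B by (rule integrable_imp_poisson_integrable)
  have bnds: "U n \<in> borel_measurable borel \<and> (\<forall>x. f x \<le> U n x \<and> U n x \<le> B x)" for n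
  proof (induction n)
    case 0
    then show ?case using fB by (simp add: U0)
  next
    case (Suc n)
    then have [measurable]: "U n \<in> borel_measurable borel" by blast
    have "integrable lborel (U n)" by (rule dom) (use Suc in blast)+
    then have "poisson_integrable (U n)" by (rule integrable_imp_poisson_integrable)
    then have le: "smear (U n) x \<le> smear B x" for x
      by (rule smear_mono) (use Suc pB in blast)+
    have "smear (U n) x - e \<le> B x" for x using le[of x] Be[of x] by linarith
    moreover have "(\<lambda>x. max (f x) (smear (U n) x - e)) \<in> borel_measurable borel" by measurable
    moreover have "U (Suc n) = (\<lambda>x. max (f x) (smear (U n) x - e))" using US by auto
    ultimately show ?case using fB by (metis max.cobounded1 max.bounded_iff)
  qed
  then have [measurable]: "U n \<in> borel_measurable borel" for n by blast
  have iU: "integrable lborel (U n)" for n by (rule dom) (use bnds in blast)+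
  have pU: "poisson_integrable (U n)" for n using iU by (rule integrable_imp_poisson_integrable)
  have mono: "U n x \<le> U (Suc n) x" for n x
  proof (induction n arbitrary: x)
    case 0
    then show ?case by (simp add: U0 US)
  next
    case (Suc n)
    have "smear (U n) x \<le> smear (U (Suc n)) x" using pU Suc by (intro smear_mono) auto
    then show ?case unfolding US by linarith
  qed
  have conv: "convergent (\<lambda>n. U n x)" for x
  proof -
    have "Bseq (\<lambda>n. U n x)"
    proof (rule BseqI')
      fix n show "norm (U n x) \<le> B x" using spec[OF conjunct2[OF bnds[of n]], of x] f0[of x] by simp
    qed
    moreover have "incseq (\<lambda>n. U n x)" using mono by (simp add: incseq_Suc_iff)
    ultimately show ?thesis by (auto intro: Bseq_mono_convergent simp: incseq_def)
  qed
  define u where "u x = lim (\<lambda>n. U n x)" for x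
  have lim: "(\<lambda>n. U n x) \<longlonglongrightarrow> u x" for x using conv unfolding u_def by (simp add: convergent_LIMSEQ_iff)
  have [measurable]: "u \<in> borel_measurable borel"
    by (rule borel_measurable_LIMSEQ_real[OF lim]) simp_all
  have fu: "f x \<le> u x" for x by (rule LIMSEQ_le_const[OF lim]) (use bnds in auto)
  have uB: "u x \<le> B x" for x by (rule LIMSEQ_le_const2[OF lim]) (use bnds in auto)
  have iu: "integrable lborel u" by (rule dom[OF _ fu uB]) measurable
  have sm: "(\<lambda>n. smear (U n) x) \<longlonglongrightarrow> smear u x" for x
    unfolding smear_def
  proof (intro tendsto_divide tendsto_const)
    show "(\<lambda>n. \<integral>y. pker 1 (x - y) * U n y \<partial>lborel) \<longlonglongrightarrow> (\<integral>y. pker 1 (x - y) * u y \<partial>lborel)"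
    proof (rule integral_dominated_convergence)
      show "integrable lborel (\<lambda>y. pker 1 (x - y) * B y)" using pB by (rule integrable_pker_1_mult)
      show "AE y in lborel. (\<lambda>n. pker 1 (x - y) * U n y) \<longlonglongrightarrow> pker 1 (x - y) * u y"
        using lim by (intro AE_I2 tendsto_intros)
      show "AE y in lborel. norm (pker 1 (x - y) * U n y) \<le> pker 1 (x - y) * B y" for n
      proof (rule AE_I2)
        fix y
        have "0 \<le> U n y" "U n y \<le> B y" using bnds[of n] f0[of y] order_trans by blast+
        then show "norm (pker 1 (x - y) * U n y) \<le> pker 1 (x - y) * B y"
          by (simp add: abs_mult pker_nonneg mult_left_mono)
      qed
    qed measurable
  qed simp
  have fixpt: "u x = max (f x) (smear u x - e)" for x
  proof (rule LIMSEQ_unique)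
    show "(\<lambda>n. U (Suc n) x) \<longlonglongrightarrow> u x" using lim by (rule LIMSEQ_Suc)
    show "(\<lambda>n. U (Suc n) x) \<longlonglongrightarrow> max (f x) (smear u x - e)"
      unfolding US by (intro tendsto_intros sm)
  qed
  have pu: "poisson_integrable u" using iu by (rule integrable_imp_poisson_integrable)
  have fi: "integrable lborel f" by (rule dom[OF _ order_refl fB]) measurable
  have up: "u x - smear u x \<le> e" if "u x = f x" for x
  proof -
    have "smear f x \<le> smear u x"
      using fu pu integrable_imp_poisson_integrable[OF fi] by (intro smear_mono) auto
    then show ?thesis using fe[of x] that by linarith
  qed
  have abs: "\<bar>u x - smear u x\<bar> \<le> e" for x
    using fixpt[of x] up[of x] e by linarith
  \<comment> \<open>On the contact set the right-hand side is \<open>e * u x\<close>; off it the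
    left-hand side is \<open>- e * u x\<close>. Integrating against the nonnegative energy gives the
    factor 2 in the mass bound.\<close>
  have "u x * (u x - smear u x) \<le> e * (2 * f x - u x)" for x
  proof (cases "u x = f x")
    case True
    have "u x * (u x - smear u x) \<le> u x * e"
      using up[OF True] f0[of x] True by (intro mult_left_mono) auto
    then show ?thesis using True by (simp add: mult.commute)
  next
    case False
    then have eq: "u x - smear u x = - e" using fixpt[of x] by linarith
    have "0 \<le> e * f x" using e f0[of x] by simp
    then show ?thesis unfolding eq by (simp add: algebra_simps)
  qed
  moreover have "0 \<le> u x" "u x \<le> M" for x using f0 fu uB BM order_trans by blast+
  note energy = smear_energy[OF iu this]
  ultimately have "0 \<le> (\<integral>x. e * (2 * f x - u x) \<partial>lborel)"
    using energy(2) integral_mono[OF energy(1), of "\<lambda>x. e * (2 * f x - u x)"] fi iu by simp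
  then have "integral\<^sup>L lborel u \<le> 2 * integral\<^sup>L lborel f"
    using fi iu e by (simp add: zero_le_mult_iff)
  then show ?thesis using iu fu uB abs by blast
qed

section \<open>Bumps\<close>

lemma integrable_indicator_interval:
  "integrable lborel (indicator {a..b} :: real \<Rightarrow> real)" "integrable lborel (indicator {a<..<b} :: real \<Rightarrow> real)"
  by (intro integrable_real_indicator; cases "a \<le> b"; simp)+

text \<open>The term linear in \<open>r\<close> is odd on its cut-off interval, so it does not contribute to the average.\<close>

lemma smear_touch_le:
  assumes p: "poisson_integrable \<phi>" and w: "0 < w"
    and le: "\<And>r. \<phi> (x + r) \<le> \<phi> x + indicator {-w..w} r * (a * r) + C * (2 * r\<^sup>2 / (w\<^sup>2 + r\<^sup>2))" and C: "0 \<le> C"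
  shows "smear \<phi> x \<le> \<phi> x + 2 * C / w"
proof -
  let ?o = "\<lambda>r. indicator {-w..w} r * (r * pker 1 r)"
  let ?g = "\<lambda>r. pker 1 r * \<phi> x + a * ?o r + 2 * C / w * pker w r"
  note P = pker_integral[of 1] pker_integral[OF w]
  have oi: "integrable lborel ?o"
  proof (rule Bochner_Integration.integrable_bound)
    show "integrable lborel (indicator {-w..w} :: real \<Rightarrow> real)" by (rule integrable_indicator_interval)
    show "AE r in lborel. norm (?o r) \<le> norm (indicator {-w..w} r :: real)"
    proof (rule AE_I2)
      fix r
      have "\<bar>r * pker 1 r\<bar> \<le> 1" using abs_mult_pker_le[of 1 r] pker_nonneg[of 1 r] by (simp add: abs_mult)
      then show "norm (?o r) \<le> norm (indicator {-w..w} r :: real)" by (simp split: split_indicator)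
    qed
  qed measurable
  have o: "(\<integral>r. ?o r \<partial>lborel) = 0"
  proof -
    have "(\<integral>r. ?o r \<partial>lborel) = \<bar>-1\<bar> *\<^sub>R (\<integral>r. ?o (0 + (-1) * r) \<partial>lborel)"
      by (rule lborel_integral_real_affine) simp
    also have "\<dots> = (\<integral>r. - ?o r \<partial>lborel)"
      by (auto simp: indicator_def intro!: Bochner_Integration.integral_cong)
    also have "\<dots> = - (\<integral>r. ?o r \<partial>lborel)" by simp
    finally show ?thesis by simp
  qed
  have *: "pker 1 (x - (x + 1 * r)) * \<phi> (x + 1 * r) = pker 1 r * \<phi> (x + r)" for r by simp
  have i: "integrable lborel (\<lambda>r. pker 1 r * \<phi> (x + r))"
    using lborel_integrable_real_affine[OF integrable_pker_1_mult[OF p, of x], of 1 x] unfolding * by simp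
  have "pi * smear \<phi> x = (\<integral>y. pker 1 (x - y) * \<phi> y \<partial>lborel)" by (simp add: smear_def)
  also have "\<dots> = (\<integral>r. pker 1 r * \<phi> (x + r) \<partial>lborel)"
    using lborel_integral_real_affine[of 1 "\<lambda>y. pker 1 (x - y) * \<phi> y" x] unfolding * by simp
  also have "\<dots> \<le> (\<integral>r. ?g r \<partial>lborel)"
  proof (rule integral_mono[OF i])
    show "integrable lborel ?g"
      using oi P by (intro Bochner_Integration.integrable_add integrable_mult_right integrable_mult_left) auto
    fix r
    \<comment> \<open>Dropping the factor \<open>r\<^sup>2 / (1 + r\<^sup>2) \<le> 1\<close> leaves
      a Poisson kernel of height \<open>w\<close>, whose mass is \<open>pi\<close> for every
      \<open>w\<close>; this produces the bound \<open>2 * C / w\<close>.\<close>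
    have "pker 1 r * (2 * r\<^sup>2 / (w\<^sup>2 + r\<^sup>2)) \<le> 2 / w * pker w r"
    proof -
      have "2 * r\<^sup>2 / (1 + r\<^sup>2) \<le> 2" using square_sum_pos[of 1 r] by (simp add: divide_le_eq)
      then have "2 * r\<^sup>2 / (1 + r\<^sup>2) / (w\<^sup>2 + r\<^sup>2) \<le> 2 / (w\<^sup>2 + r\<^sup>2)"
        using square_sum_pos[OF w, of r] by (intro divide_right_mono) auto
      then show ?thesis using w by (simp add: pker_def)
    qed
    then have "C * (pker 1 r * (2 * r\<^sup>2 / (w\<^sup>2 + r\<^sup>2))) \<le> C * (2 / w * pker w r)"
      using C by (rule mult_left_mono)
    moreover have "pker 1 r * \<phi> (x + r) \<le> pker 1 r * (\<phi> x + indicator {-w..w} r * (a * r) + C * (2 * r\<^sup>2 / (w\<^sup>2 + r\<^sup>2)))"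
      using le by (rule mult_left_mono) (simp add: pker_nonneg)
    ultimately show "pker 1 r * \<phi> (x + r) \<le> ?g r" by (simp add: algebra_simps)
  qed
  also have "\<dots> = pi * (\<phi> x + 2 * C / w)"
  proof (rule has_bochner_integral_integral_eq)
    have "has_bochner_integral lborel ?g (pi * \<phi> x + a * 0 + 2 * C / w * pi)"
      using oi P o by (intro has_bochner_integral_add has_bochner_integral_mult_left has_bochner_integral_mult_right)
        (simp_all add: has_bochner_integral_iff)
    then show "has_bochner_integral lborel ?g (pi * (\<phi> x + 2 * C / w))" by (simp add: algebra_simps)
  qed
  finally show ?thesis by simp
qed

definition bump :: "real \<Rightarrow> real \<Rightarrow> real \<Rightarrow> real \<Rightarrow> real" where
  "bump c w h x = h * max 0 (1 - ((x - c) / w)\<^sup>2)"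

lemma bump_measurable [measurable]: "bump c w h \<in> borel_measurable borel"
  unfolding bump_def by measurable

lemma bump_bounds:
  assumes "0 < w" "0 \<le> h"
  shows "0 \<le> bump c w h x" "bump c w h x \<le> h * indicator {c - w..c + w} x"
proof -
  show "0 \<le> bump c w h x" using assms by (simp add: bump_def)
  show "bump c w h x \<le> h * indicator {c - w..c + w} x"
  proof (cases "x \<in> {c - w..c + w}")
    case True
    have "h * max 0 (1 - ((x - c) / w)\<^sup>2) \<le> h * 1" using assms by (intro mult_left_mono) auto
    then show ?thesis using True by (simp add: bump_def)
  next
    case False
    then have "1 \<le> \<bar>(x - c) / w\<bar>" using assms by (auto simp: abs_divide le_divide_eq)
    then have "1 \<le> ((x - c) / w)\<^sup>2" by (metis one_le_power power2_abs)
    then show ?thesis using False by (simp add: bump_def)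
  qed
qed

lemma bump_integrable: "0 < w \<Longrightarrow> 0 \<le> h \<Longrightarrow> integrable lborel (bump c w h)"
proof (rule Bochner_Integration.integrable_bound)
  assume *: "0 < w" "0 \<le> h"
  show "integrable lborel (\<lambda>x. h * indicator {c - w..c + w} x)"
    by (intro integrable_mult_right integrable_indicator_interval)
  show "AE x in lborel. norm (bump c w h x) \<le> norm (h * indicator {c - w..c + w} x)"
    using bump_bounds[OF *] by (intro AE_I2) (metis abs_of_nonneg order_trans real_norm_def)
qed measurable

text \<open>One function dominates the parabola for small \<open>r\<close> and a constant for large
  \<open>r\<close>: in \<open>smear_touch_le\<close> it covers the quadratic remainder within
  distance \<open>w\<close> and the full height beyond.\<close>

lemma quotient_ge_square:
  fixes r w :: real
  assumes "0 < w"
  shows "\<bar>r\<bar> \<le> w \<Longrightarrow> (r / w)\<^sup>2 \<le> 2 * r\<^sup>2 / (w\<^sup>2 + r\<^sup>2)" "w \<le> \<bar>r\<bar> \<Longrightarrow> 1 \<le> 2 * r\<^sup>2 / (w\<^sup>2 + r\<^sup>2)"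
proof -
  note sp = square_sum_pos[OF assms, of r]
  show "(r / w)\<^sup>2 \<le> 2 * r\<^sup>2 / (w\<^sup>2 + r\<^sup>2)" if "\<bar>r\<bar> \<le> w"
  proof -
    have "r\<^sup>2 \<le> w\<^sup>2" using that by (metis abs_ge_zero power2_abs power_mono)
    then have "r\<^sup>2 * (w\<^sup>2 + r\<^sup>2) \<le> r\<^sup>2 * (2 * w\<^sup>2)" by (intro mult_left_mono) auto
    then show ?thesis using sp assms by (simp add: power_divide divide_simps mult_ac)
  qed
  show "1 \<le> 2 * r\<^sup>2 / (w\<^sup>2 + r\<^sup>2)" if "w \<le> \<bar>r\<bar>"
  proof -
    have "w\<^sup>2 \<le> r\<^sup>2" using that assms by (metis less_imp_le power2_abs power_mono)
    then show ?thesis using sp by (simp add: le_divide_eq)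
  qed
qed

text \<open>With the sign reversed, the touching from above required by
  \<open>smear_touch_le\<close> is possible everywhere: the corners of a bump at the edge of its
  support become concave and harmless.\<close>

lemma bump_smear:
  assumes w: "0 < w" and h: "0 \<le> h"
  shows "bump c w h x - smear (bump c w h) x \<le> 2 * h / w"
proof -
  \<comment> \<open>The slope of the negated bump at \<open>x\<close>, and 0 outside the
    support.\<close>
  define a where "a = (if \<bar>x - c\<bar> < w then 2 * h * (x - c) / w\<^sup>2 else 0)"
  have le: "- bump c w h (x + r) \<le> - bump c w h x + indicator {-w..w} r * (a * r) + h * (2 * r\<^sup>2 / (w\<^sup>2 + r\<^sup>2))" for r
  proof -
    define q where "q = 2 * r\<^sup>2 / (w\<^sup>2 + r\<^sup>2)"
    have q0: "0 \<le> h * q" using h by (simp add: q_def)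
    have b0: "0 \<le> bump c w h (x + r)" using bump_bounds[OF w h] by simp
    show ?thesis
    proof (cases "\<bar>x - c\<bar> < w")
      case False
      then have "1 \<le> \<bar>(x - c) / w\<bar>" using w by (simp add: abs_divide le_divide_eq)
      then have "1 \<le> ((x - c) / w)\<^sup>2" by (metis one_le_power power2_abs)
      then have "bump c w h x = 0" by (simp add: bump_def)
      then show ?thesis using False b0 q0 by (simp add: a_def q_def)
    next
      case True
      have "((x - c) / w)\<^sup>2 \<le> 1" using True w by (simp add: abs_square_le_1 abs_divide)
      then have bx: "bump c w h x = h * (1 - ((x - c) / w)\<^sup>2)" by (simp add: bump_def)
      show ?thesis
      proof (cases "\<bar>r\<bar> \<le> w")
        case r: True
        then have "h * (r / w)\<^sup>2 \<le> h * q" unfolding q_def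
          by (intro mult_left_mono quotient_ge_square(1)[OF w] h)
        moreover have "h * (1 - ((x + r - c) / w)\<^sup>2) \<le> bump c w h (x + r)"
          unfolding bump_def using h by (intro mult_left_mono) auto
        moreover have "h * (1 - ((x + r - c) / w)\<^sup>2) = h * (1 - ((x - c) / w)\<^sup>2) - a * r - h * (r / w)\<^sup>2"
          using True w by (simp add: a_def power2_eq_square field_simps)
        ultimately show ?thesis using r bx by (simp add: q_def[symmetric] indicator_def abs_le_iff)
      next
        case False
        then have "h * 1 \<le> h * q" unfolding q_def
          by (intro mult_left_mono quotient_ge_square(2)[OF w] h) auto
        moreover have "bump c w h x \<le> h" using bump_bounds(2)[OF w h, of c x] h by (auto split: split_indicator_asm)
        moreover have "indicator {-w..w} r = (0::real)" using False by (auto simp: indicator_def)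
        ultimately show ?thesis using b0 by (simp add: q_def[symmetric])
      qed
    qed
  qed
  have "poisson_integrable (\<lambda>x. - bump c w h x)"
    using bump_integrable[OF w h] by (intro integrable_imp_poisson_integrable) simp
  from smear_touch_le[OF this w le h] show ?thesis by (simp add: smear_minus)
qed

text \<open>The barrier has to satisfy the opposite inequality, hence be touched from above without
  a change of sign, which a convex corner such as the edge of a \<open>bump\<close> rules out. The
  squared tent reaches 0 tangentially, and its only corner, at the centre, is concave.\<close>

definition cap :: "real \<Rightarrow> real \<Rightarrow> real \<Rightarrow> real \<Rightarrow> real" where
  "cap c w M x = M * (max 0 (2 - \<bar>(x - c) / w\<bar>))\<^sup>2"

lemma cap_measurable [measurable]: "cap c w M \<in> borel_measurable borel"
  unfolding cap_def by measurable

lemma cap_bounds: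
  assumes "0 < w" "0 \<le> M"
  shows "0 \<le> cap c w M x" "cap c w M x \<le> 4 * M * indicator {c - 2 * w<..<c + 2 * w} x"
    and "\<bar>x - c\<bar> \<le> w \<Longrightarrow> M \<le> cap c w M x"
proof -
  show "0 \<le> cap c w M x" using assms by (simp add: cap_def)
  show "cap c w M x \<le> 4 * M * indicator {c - 2 * w<..<c + 2 * w} x"
  proof (cases "x \<in> {c - 2 * w<..<c + 2 * w}")
    case True
    have "(max 0 (2 - \<bar>(x - c) / w\<bar>))\<^sup>2 \<le> 2\<^sup>2" by (intro power_mono) auto
    then have "M * (max 0 (2 - \<bar>(x - c) / w\<bar>))\<^sup>2 \<le> M * 2\<^sup>2" using assms by (intro mult_left_mono) auto
    then show ?thesis using True by (simp add: cap_def)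
  next
    case False
    then have "2 \<le> \<bar>(x - c) / w\<bar>" using assms by (auto simp: abs_divide le_divide_eq)
    then show ?thesis using False by (simp add: cap_def)
  qed
  assume "\<bar>x - c\<bar> \<le> w"
  then have "\<bar>(x - c) / w\<bar> \<le> 1" using assms by (simp add: abs_divide)
  then have "1\<^sup>2 \<le> (max 0 (2 - \<bar>(x - c) / w\<bar>))\<^sup>2" by (intro power_mono) auto
  then have "M * 1 \<le> M * (max 0 (2 - \<bar>(x - c) / w\<bar>))\<^sup>2" using assms by (intro mult_left_mono) auto
  then show "M \<le> cap c w M x" by (simp add: cap_def)
qed

lemma cap_integrable: "0 < w \<Longrightarrow> 0 \<le> M \<Longrightarrow> integrable lborel (cap c w M)"
proof (rule Bochner_Integration.integrable_bound)
  assume *: "0 < w" "0 \<le> M"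
  show "integrable lborel (\<lambda>x. 4 * M * indicator {c - 2 * w<..<c + 2 * w} x)"
    by (intro integrable_mult_right integrable_indicator_interval)
  show "AE x in lborel. norm (cap c w M x) \<le> norm (4 * M * indicator {c - 2 * w<..<c + 2 * w} x)"
    using cap_bounds(1,2)[OF *] by (intro AE_I2) (metis abs_of_nonneg order_trans real_norm_def)
qed measurable

lemma cap_smear:
  assumes w: "0 < w" and M: "0 \<le> M"
  shows "smear (cap c w M) x - cap c w M x \<le> 8 * M / w"
proof -
  define X where "X = (x - c) / w"
  define m where "m = max 0 (2 - \<bar>X\<bar>)"
  define \<sigma> :: real where "\<sigma> = (if 0 \<le> X then 1 else -1)"
  define a where "a = - 2 * M * m * \<sigma> / w"
  \<comment> \<open>The constant \<open>4 * M\<close> is the height of the cap and serves for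
    \<open>r\<close> beyond distance \<open>w\<close>; within it the remainder is only
    \<open>M * (r / w)\<^sup>2\<close>.\<close>
  have le: "cap c w M (x + r) \<le> cap c w M x + indicator {-w..w} r * (a * r) + (4 * M) * (2 * r\<^sup>2 / (w\<^sup>2 + r\<^sup>2))" for r
  proof -
    define q where "q = 2 * r\<^sup>2 / (w\<^sup>2 + r\<^sup>2)"
    have q0: "0 \<le> M * q" using M by (simp add: q_def)
    define R where "R = r / w"
    have XR: "(x + r - c) / w = X + R" by (simp add: X_def R_def diff_divide_distrib add_divide_distrib)
    have cx: "cap c w M x = M * m\<^sup>2" by (simp add: cap_def m_def X_def)
    show ?thesis
    proof (cases "\<bar>r\<bar> \<le> w")
      case True
      \<comment> \<open>Extending the branch of the tent on the side of \<open>x\<close> across the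
        centre can only increase it, so its square lies below an exact parabola.\<close>
      have "\<bar>X\<bar> + \<sigma> * R \<le> \<bar>X + R\<bar>" by (auto simp: \<sigma>_def)
      then have "max 0 (2 - \<bar>X + R\<bar>) \<le> \<bar>m - \<sigma> * R\<bar>"
        by (auto simp: m_def max_def)
      then have "(max 0 (2 - \<bar>X + R\<bar>))\<^sup>2 \<le> (m - \<sigma> * R)\<^sup>2"
        by (metis max.cobounded1 power2_abs power_mono)
      also have "\<dots> = m\<^sup>2 - 2 * m * \<sigma> * R + R\<^sup>2"
        by (simp add: \<sigma>_def power2_eq_square algebra_simps)
      finally have "M * (max 0 (2 - \<bar>X + R\<bar>))\<^sup>2 \<le> M * (m\<^sup>2 - 2 * m * \<sigma> * R + R\<^sup>2)"
        using M by (rule mult_left_mono)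
      moreover have "M * R\<^sup>2 \<le> M * q" unfolding q_def R_def
        by (intro mult_left_mono quotient_ge_square(1)[OF w] M True)
      moreover have "M * (2 * m * \<sigma> * R) = - (a * r)" by (simp add: a_def R_def)
      ultimately have "cap c w M (x + r) \<le> cap c w M x + a * r + 4 * (M * q)"
        using q0 unfolding cap_def[of c w M "x + r"] XR cx by (simp add: algebra_simps)
      then show ?thesis using True by (simp add: q_def indicator_def abs_le_iff mult_ac)
    next
      case False
      then have "M * 1 \<le> M * q" unfolding q_def
        by (intro mult_left_mono quotient_ge_square(2)[OF w] M) auto
      moreover have "cap c w M (x + r) \<le> 4 * M" using cap_bounds(2)[OF w M, of c "x + r"] M by (auto split: split_indicator_asm)
      moreover have "indicator {-w..w} r = (0::real)" using False by (auto simp: indicator_def)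
      ultimately show ?thesis using cap_bounds(1)[OF w M, of c x] by (simp add: q_def)
    qed
  qed
  have "0 \<le> 4 * M" using M by simp
  from smear_touch_le[OF integrable_imp_poisson_integrable[OF cap_integrable[OF w M]] w le this]
  show ?thesis by simp
qed

text \<open>The maximum of the bumps inherits the one-sided bound, since at each point it equals one
  bump while \<open>smear\<close> is monotone. The cap around \<open>c0\<close> is a supersolution
  and confines the solution of the obstacle problem to distance \<open>2 * w0\<close>. The cost is
  twice the mass of the bumps, each of which lies below a rectangle of area
  \<open>2 * h i * w i\<close>.\<close>

lemma bump_regularization:
  fixes c w h :: "'i \<Rightarrow> real"
  assumes I: "finite I" "I \<noteq> {}"
    and pos: "\<And>i. i \<in> I \<Longrightarrow> 0 < w i \<and> 0 \<le> h i \<and> h i \<le> M"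
    and slope: "\<And>i. i \<in> I \<Longrightarrow> 2 * h i / w i \<le> e"
    and supp: "\<And>i. i \<in> I \<Longrightarrow> \<bar>c i - c0\<bar> + w i \<le> w0"
    and M: "8 * M / w0 \<le> e" and e: "0 < e"
  shows "\<exists>u. integrable lborel u \<and> (\<forall>x. 0 \<le> u x \<and> (u x \<noteq> 0 \<longrightarrow> \<bar>x - c0\<bar> < 2 * w0) \<and> \<bar>u x - smear u x\<bar> \<le> e)
     \<and> (\<forall>i\<in>I. \<forall>x. bump (c i) (w i) (h i) x \<le> u x) \<and> integral\<^sup>L lborel u \<le> (\<Sum>i\<in>I. 4 * h i * w i)"
proof -
  define f where "f x = Max ((\<lambda>i. bump (c i) (w i) (h i) x) ` I)" for x
  obtain i0 where i0: "i0 \<in> I" using I by auto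
  have w0: "0 < w0" using pos[OF i0] supp[OF i0] by linarith
  have M0: "0 \<le> M" using pos[OF i0] by linarith
  have [measurable]: "f \<in> borel_measurable borel"
    unfolding f_def using I by (intro borel_measurable_Max) auto
  have ge: "bump (c i) (w i) (h i) x \<le> f x" if "i \<in> I" for i x
    unfolding f_def using I that by (intro Max_ge) auto
  have attained: "\<exists>i\<in>I. f x = bump (c i) (w i) (h i) x" for x
  proof -
    have "f x \<in> (\<lambda>i. bump (c i) (w i) (h i) x) ` I" unfolding f_def by (rule Max_in) (use I in auto)
    then show ?thesis by auto
  qed
  have f0: "0 \<le> f x" for x using ge[OF i0, of x] bump_bounds(1)[of "w i0" "h i0" "c i0" x] pos[OF i0] by linarith
  have fB: "f x \<le> cap c0 w0 M x" for x
  proof -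
    obtain i where i: "i \<in> I" "f x = bump (c i) (w i) (h i) x" using attained by blast
    note b = bump_bounds(2)[of "w i" "h i" "c i" x]
    show ?thesis
    proof (cases "\<bar>x - c0\<bar> \<le> w0")
      case True
      then show ?thesis using cap_bounds(3)[OF w0 M0 True] b i pos[OF i(1)]
        by (auto split: split_indicator_asm)
    next
      case False
      then have "x \<notin> {c i - w i..c i + w i}" using supp[OF i(1)] by auto
      then show ?thesis using b i pos[OF i(1)] cap_bounds(1)[OF w0 M0, of c0 x] by simp
    qed
  qed
  have fi: "integrable lborel f"
  proof (rule Bochner_Integration.integrable_bound[OF cap_integrable[OF w0 M0, of c0]])
    show "AE x in lborel. norm (f x) \<le> norm (cap c0 w0 M x)"
      using f0 fB by (intro AE_I2) (metis abs_of_nonneg order_trans real_norm_def)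
  qed measurable
  have fe: "f x - smear f x \<le> e" for x
  proof -
    obtain i where i: "i \<in> I" "f x = bump (c i) (w i) (h i) x" using attained by blast
    have w: "0 < w i" "0 \<le> h i" using pos[OF i(1)] by auto
    have "smear (bump (c i) (w i) (h i)) x \<le> smear f x"
      using ge[OF i(1)] by (intro smear_mono integrable_imp_poisson_integrable fi bump_integrable w)
    then show ?thesis using bump_smear[OF w, of "c i" x] slope[OF i(1)] i by linarith
  qed
  have Be: "smear (cap c0 w0 M) x - cap c0 w0 M x \<le> e" for x using cap_smear[OF w0 M0] M by (rule order_trans)
  have BM: "cap c0 w0 M x \<le> 4 * M" for x using cap_bounds(2)[OF w0 M0, of c0 x] M0 by (auto split: split_indicator_asm)
  obtain u where u: "integrable lborel u" "\<And>x. f x \<le> u x" "\<And>x. u x \<le> cap c0 w0 M x" "\<And>x. \<bar>u x - smear u x\<bar> \<le> e"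
      "integral\<^sup>L lborel u \<le> 2 * integral\<^sup>L lborel f"
    using obstacle_problem[OF _ f0 fB cap_integrable[OF w0 M0] BM fe Be e] by auto
  have "integral\<^sup>L lborel f \<le> (\<integral>x. (\<Sum>i\<in>I. h i * indicator {c i - w i..c i + w i} x) \<partial>lborel)"
  proof (rule integral_mono[OF fi])
    show "integrable lborel (\<lambda>x. (\<Sum>i\<in>I. h i * indicator {c i - w i..c i + w i} x))"
      by (intro Bochner_Integration.integrable_sum integrable_mult_right integrable_indicator_interval)
    fix x
    obtain i where i: "i \<in> I" "f x = bump (c i) (w i) (h i) x" using attained by blast
    have "f x \<le> h i * indicator {c i - w i..c i + w i} x" using i bump_bounds(2) pos[OF i(1)] by auto
    also have "\<dots> \<le> (\<Sum>i\<in>I. h i * indicator {c i - w i..c i + w i} x)"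
      using I pos by (intro member_le_sum i) auto
    finally show "f x \<le> (\<Sum>i\<in>I. h i * indicator {c i - w i..c i + w i} x)" .
  qed
  also have "\<dots> = (\<Sum>i\<in>I. h i * (2 * w i))"
  proof (subst Bochner_Integration.integral_sum)
    show "integrable lborel (\<lambda>x. h i * indicator {c i - w i..c i + w i} x)" for i
      by (intro integrable_mult_right integrable_indicator_interval)
    show "(\<Sum>i\<in>I. \<integral>x. h i * indicator {c i - w i..c i + w i} x \<partial>lborel) = (\<Sum>i\<in>I. h i * (2 * w i))"
      using pos by (intro sum.cong) (auto dest: less_imp_le)
  qed
  finally have "2 * integral\<^sup>L lborel f \<le> 2 * (\<Sum>i\<in>I. h i * (2 * w i))" by simp
  also have "\<dots> = (\<Sum>i\<in>I. 4 * h i * w i)" unfolding sum_distrib_left by (intro sum.cong) auto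
  finally have "2 * integral\<^sup>L lborel f \<le> (\<Sum>i\<in>I. 4 * h i * w i)" .
  then have int: "integral\<^sup>L lborel u \<le> (\<Sum>i\<in>I. 4 * h i * w i)" using u(5) by linarith
  have supp_u: "\<bar>x - c0\<bar> < 2 * w0" if "u x \<noteq> 0" for x
  proof (rule ccontr)
    assume "\<not> ?thesis"
    then have "x \<notin> {c0 - 2 * w0<..<c0 + 2 * w0}" by (auto simp: abs_less_iff)
    then have "cap c0 w0 M x \<le> 0" using cap_bounds(2)[OF w0 M0, of c0 x] by simp
    then show False using u(2)[of x] u(3)[of x] f0[of x] that by linarith
  qed
  show ?thesis
  proof (intro exI[of _ u] conjI allI ballI impI)
    show "0 \<le> u x" for x using f0 u(2) by (rule order_trans)
    show "bump (c i) (w i) (h i) x \<le> u x" if "i \<in> I" for i x using ge[OF that] u(2) by (rule order_trans)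
  qed (use u int supp_u in auto)
qed

section \<open>Majorants on dyadic intervals\<close>

lemma sum_powers_le:
  fixes K t :: real
  assumes K: "0 < K" and t: "0 \<le> t" and Q: "finite Q" "\<And>k. k \<in> Q \<Longrightarrow> K * 2 ^ k \<le> t"
  shows "(\<Sum>k\<in>Q. K * 2 ^ k) \<le> 2 * t"
proof (cases "Q = {}")
  case False
  define n where "n = Max Q"
  have n: "n \<in> Q" using Q False by (simp add: n_def)
  have "(\<Sum>k\<in>Q. (2::real) ^ k) \<le> (\<Sum>k<Suc n. 2 ^ k)"
    using Q by (intro sum_mono2) (auto simp: n_def less_Suc_eq_le)
  also have "\<dots> \<le> 2 * 2 ^ n" unfolding sum_gp_strict by simp
  finally have "K * (\<Sum>k\<in>Q. (2::real) ^ k) \<le> K * (2 * 2 ^ n)" using K by (intro mult_left_mono) auto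
  then show ?thesis using Q(2)[OF n] by (simp add: sum_distrib_left)
qed (use t in simp)

text \<open>A dyadic subinterval of length \<open>2 ^ k\<close> is heavy (an element of \<open>H\<close>) if it contains a point where
  \<open>f \<ge> K * 2 ^ k\<close> and \<open>f \<ge> A\<close>; then \<open>f \<ge> K * 2 ^ k / 2\<close> on all of it. This pays for a bump of
  height \<open>3 * K * 2 ^ k\<close> and width \<open>W * 2 ^ k\<close>.\<close>

lemma interval_majorant:
  fixes f :: "real \<Rightarrow> real" and j :: nat and c0 :: real
  defines "l \<equiv> (2::real) ^ j"
  defines "Q \<equiv> {c0 - l..<c0 + l}"
  assumes K: "0 < K" and e: "0 < e" and W: "2 \<le> W" "6 * K / W \<le> e"
    and A: "0 \<le> A" "A \<le> e * l / 20"
    and f0: "\<And>x. 0 \<le> f x" and fi: "integrable lebesgue (\<lambda>x. indicator Q x * f x)"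
    and half: "\<And>x y. x \<in> Q \<Longrightarrow> y \<in> Q \<Longrightarrow> A \<le> f y \<Longrightarrow> \<bar>x - y\<bar> \<le> f y / K \<Longrightarrow> f y / 2 \<le> f x"
    and small: "(\<integral>x. indicator Q x * f x \<partial>lebesgue) \<le> K * l\<^sup>2 / (32 * W\<^sup>2)"
  shows "\<exists>u. integrable lborel u \<and> (\<forall>x. 0 \<le> u x \<and> (u x \<noteq> 0 \<longrightarrow> \<bar>x - c0\<bar> < 5 / 2 * l) \<and> \<bar>u x - smear u x\<bar> \<le> e)
     \<and> (\<forall>x\<in>Q. f x \<le> u x + K)
     \<and> integral\<^sup>L lborel u \<le> 48 * W * (\<integral>x. indicator Q x * f x \<partial>lebesgue) + 15 * A * l"
proof -
  define a where "a = c0 - l"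
  define m where "m = (\<integral>x. indicator Q x * f x \<partial>lebesgue)"
  define D where "D k i = {a + real i * 2 ^ k..<a + (real i + 1) * 2 ^ k}" for k i :: nat
  define H where "H = {(k, i). k \<le> j \<and> i < 2 ^ (j + 1 - k) \<and> (\<exists>y\<in>D k i. K * 2 ^ k \<le> f y \<and> A \<le> f y)}"
  have l: "0 < l" by (simp add: l_def)
  have W0: "0 < W" using W by simp
  have finH: "finite H"
  proof (rule finite_subset)
    show "H \<subseteq> {..j} \<times> {..<2 ^ (j + 1)}"
    proof
      fix p assume "p \<in> H"
      then obtain k i where p: "p = (k, i)" "k \<le> j" "i < 2 ^ (j + 1 - k)" by (auto simp: H_def)
      note p(3)
      also have "(2::nat) ^ (j + 1 - k) \<le> 2 ^ (j + 1)" by (intro power_increasing) auto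
      finally show "p \<in> {..j} \<times> {..<2 ^ (j + 1)}" using p by simp
    qed
  qed auto
  have DQ: "D k i \<subseteq> Q" if "k \<le> j" "i < 2 ^ (j + 1 - k)" for k i
  proof -
    have "i + 1 \<le> 2 ^ (j + 1 - k)" using that by simp
    then have "real (i + 1) \<le> real (2 ^ (j + 1 - k))" by (rule of_nat_mono)
    then have "(real i + 1) * 2 ^ k \<le> 2 ^ (j + 1 - k) * 2 ^ k" by (intro mult_right_mono) auto
    also have "\<dots> = 2 * l" using that by (simp add: power_add[symmetric] l_def)
    finally have "a + (real i + 1) * 2 ^ k \<le> c0 + l" by (simp add: a_def)
    moreover have "0 \<le> real i * 2 ^ k" by simp
    ultimately show ?thesis unfolding D_def Q_def a_def subset_iff atLeastLessThan_iff by (intro allI impI) linarith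
  qed
  have DH: "D k i \<subseteq> Q" if "(k, i) \<in> H" for k i using that DQ by (auto simp: H_def)
  have heavy: "K * 2 ^ k \<le> 2 * f x" if H: "(k, i) \<in> H" and x: "x \<in> D k i" for k i x
  proof -
    obtain y where y: "y \<in> D k i" "K * 2 ^ k \<le> f y" "A \<le> f y" using H by (auto simp: H_def)
    have "\<bar>x - y\<bar> \<le> 2 ^ k" using x y(1) by (auto simp: D_def algebra_simps abs_le_iff)
    also have "\<dots> \<le> f y / K" using y(2) K by (simp add: field_simps)
    finally have "f y / 2 \<le> f x" using half[of x y] x y DH[OF H] by auto
    then show ?thesis using y(2) by linarith
  qed
  have Dm: "D k i \<in> sets lebesgue" "measure lebesgue (D k i) = 2 ^ k" "emeasure lebesgue (D k i) < \<infinity>" for k i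
    by (simp_all add: D_def algebra_simps)
  have Di: "integrable lebesgue (\<lambda>x. b * indicator (D k i) x)" for b :: real and k i
    by (intro integrable_mult_right integrable_real_indicator Dm)
  have DI: "(\<integral>x. b * indicator (D k i) x \<partial>lebesgue) = b * 2 ^ k" for b :: real and k i
    using Dm by simp
  \<comment> \<open>A heavy subinterval carries mass at least \<open>K * 4 ^ k / 2\<close>. The
    smallness assumption then keeps the radius of its bump below \<open>l / 4\<close>, hence its
    support within distance \<open>5 / 4 * l\<close> of \<open>c0\<close>.\<close>
  have Wk: "W * 2 ^ k \<le> l / 4" if H: "(k, i) \<in> H" for k i
  proof -
    have "(\<integral>x. K * 2 ^ k / 2 * indicator (D k i) x \<partial>lebesgue) \<le> (\<integral>x. indicator Q x * f x \<partial>lebesgue)"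
    proof (rule integral_mono[OF Di fi])
      show "K * 2 ^ k / 2 * indicator (D k i) x \<le> indicator Q x * f x" for x
        using heavy[OF H, of x] DH[OF H] f0[of x] by (auto simp: indicator_def)
    qed
    then have "K * 2 ^ k / 2 * 2 ^ k \<le> K * l\<^sup>2 / (32 * W\<^sup>2)" unfolding DI using small by (rule order_trans)
    then have "K * (2 ^ k * 2 ^ k) * (16 * W\<^sup>2) \<le> K * l\<^sup>2" using W0 by (simp add: field_simps)
    then have "(2 ^ k * 2 ^ k) * (16 * W\<^sup>2) \<le> l\<^sup>2" using K by (simp add: mult.assoc)
    then have "(W * 2 ^ k)\<^sup>2 \<le> (l / 4)\<^sup>2" by (simp add: power2_eq_square field_simps)
    then show ?thesis by (rule power2_le_imp_le) (use l in simp)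
  qed
  have KW: "6 * K \<le> e * W" using W W0 by (simp add: field_simps)
  \<comment> \<open>\<open>None\<close> is one wide bump over all of \<open>Q\<close> for the values
    below \<open>A\<close>; \<open>Some (k, i)\<close> is the bump over a heavy subinterval. On
    \<open>Q\<close> the wide bump is at least \<open>9 / 25 * (3 * A) \<ge> A\<close>; on its
    subinterval the other is at least \<open>2 * K * 2 ^ k\<close>.\<close>
  define c where "c t = (case t of None \<Rightarrow> c0 | Some (k, i) \<Rightarrow> a + (real i + 1 / 2) * 2 ^ k)" for t :: "(nat \<times> nat) option"
  define w where "w t = (case t of None \<Rightarrow> 5 / 4 * l | Some (k, i) \<Rightarrow> W * 2 ^ k)" for t :: "(nat \<times> nat) option"
  define h where "h t = (case t of None \<Rightarrow> 3 * A | Some (k, i) \<Rightarrow> 3 * K * 2 ^ k)" for t :: "(nat \<times> nat) option"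
  have "\<exists>u. integrable lborel u \<and> (\<forall>x. 0 \<le> u x \<and> (u x \<noteq> 0 \<longrightarrow> \<bar>x - c0\<bar> < 2 * (5 / 4 * l)) \<and> \<bar>u x - smear u x\<bar> \<le> e)
     \<and> (\<forall>t\<in>insert None (Some ` H). \<forall>x. bump (c t) (w t) (h t) x \<le> u x) \<and> integral\<^sup>L lborel u \<le> (\<Sum>t\<in>insert None (Some ` H). 4 * h t * w t)"
  \<comment> \<open>\<open>M\<close> is the largest height that a barrier of radius
    \<open>5 / 4 * l\<close> admits; the assumption \<open>A \<le> e * l / 20\<close> is what puts
    \<open>3 * A\<close> below it.\<close>
  proof (rule bump_regularization[where M = "e * (5 / 4 * l) / 8"])
    fix t assume t: "t \<in> insert None (Some ` H)"
    have "0 < w t \<and> 0 \<le> h t \<and> h t \<le> e * (5 / 4 * l) / 8 \<and> 2 * h t / w t \<le> e \<and> \<bar>c t - c0\<bar> + w t \<le> 5 / 4 * l"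
    proof (cases t)
      case None
      have "3 * A \<le> e * (5 / 4 * l) / 8" "2 * (3 * A) \<le> e * (5 / 4 * l)" using A by auto
      then show ?thesis using None l A by (simp add: w_def h_def c_def divide_le_eq)
    next
      case (Some p)
      then obtain k i where p: "t = Some (k, i)" "(k, i) \<in> H" using t by (cases p) auto
      note wk = Wk[OF p(2)]
      have "6 * K * 2 ^ k \<le> e * W * 2 ^ k" using KW by (intro mult_right_mono) auto
      also have "\<dots> = e * (W * 2 ^ k)" by simp
      also have "\<dots> \<le> e * (l / 4)" using wk e by (intro mult_left_mono) auto
      finally have 1: "3 * K * 2 ^ k \<le> e * (5 / 4 * l) / 8" using mult_pos_pos[OF e l] by simp
      have 2: "2 * (3 * K * 2 ^ k) / (W * 2 ^ k) \<le> e" using W by simp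
      let ?x = "a + (real i + 1 / 2) * 2 ^ k"
      have "?x \<in> D k i" by (simp add: D_def)
      then have "\<bar>?x - c0\<bar> \<le> l" using DH[OF p(2)] by (auto simp: Q_def abs_le_iff)
      then have "\<bar>?x - c0\<bar> + W * 2 ^ k \<le> 5 / 4 * l" using wk by simp
      then show ?thesis using p(1) W0 K 1 2 by (simp add: w_def h_def c_def)
    qed
    then show "0 < w t \<and> 0 \<le> h t \<and> h t \<le> e * (5 / 4 * l) / 8" "2 * h t / w t \<le> e" "\<bar>c t - c0\<bar> + w t \<le> 5 / 4 * l" by auto
  qed (use finH l e in auto)
  then obtain u where u: "integrable lborel u" "\<And>x. 0 \<le> u x" "\<And>x. u x \<noteq> 0 \<Longrightarrow> \<bar>x - c0\<bar> < 2 * (5 / 4 * l)"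
     "\<And>x. \<bar>u x - smear u x\<bar> \<le> e" "\<And>t x. t \<in> insert None (Some ` H) \<Longrightarrow> bump (c t) (w t) (h t) x \<le> u x"
     "integral\<^sup>L lborel u \<le> (\<Sum>t\<in>insert None (Some ` H). 4 * h t * w t)"
    by blast
  have cover: "f x \<le> u x + K" if x: "x \<in> Q" for x
  proof (cases "f x \<le> K \<or> f x \<le> A")
    case True
    have "A \<le> u x"
    proof -
      have "\<bar>(x - c0) / (5 / 4 * l)\<bar> \<le> 4 / 5" using x l by (auto simp: Q_def abs_divide divide_le_eq)
      then have "((x - c0) / (5 / 4 * l))\<^sup>2 \<le> (4 / 5)\<^sup>2" by (metis abs_ge_zero power2_abs power_mono)
      also have "(4 / 5 :: real)\<^sup>2 \<le> 2 / 3" by (simp add: power2_eq_square)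
      finally have "1 / 3 \<le> max 0 (1 - ((x - c0) / (5 / 4 * l))\<^sup>2)" by linarith
      then have "3 * A * (1 / 3) \<le> 3 * A * max 0 (1 - ((x - c0) / (5 / 4 * l))\<^sup>2)" by (rule mult_left_mono) (use A in simp)
      also have "\<dots> \<le> u x" using u(5)[of None x] by (simp add: bump_def c_def w_def h_def)
      finally show ?thesis by simp
    qed
    then show ?thesis using True u(2)[of x] K by linarith
  next
    case False
    \<comment> \<open>The largest scale \<open>k\<close> in \<open>P\<close> gives
      \<open>f x < 2 * K * 2 ^ k\<close>, a value that the bump reaches. The top scale
      \<open>j\<close> is ruled out because \<open>W * 2 ^ j \<le> l / 4\<close> contradicts
      \<open>2 \<le> W\<close>.\<close>
    define P where "P = {k. k \<le> j \<and> K * 2 ^ k \<le> f x}"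
    define k where "k = Max P"
    have finP: "finite P" by (simp add: P_def)
    have "0 \<in> P" using False by (simp add: P_def)
    then have kP: "k \<in> P" using finP unfolding k_def by (intro Max_in) auto
    have kj: "k \<le> j" "K * 2 ^ k \<le> f x" using kP by (auto simp: P_def)
    define i where "i = nat \<lfloor>(x - a) / 2 ^ k\<rfloor>"
    have xa: "0 \<le> x - a" "x - a < 2 * l" using x by (auto simp: Q_def a_def)
    then have i: "real i \<le> (x - a) / 2 ^ k" "(x - a) / 2 ^ k < real i + 1"
      by (auto simp: i_def of_nat_nat)
    have xD: "x \<in> D k i" using i by (simp add: D_def field_simps)
    have "real i < 2 ^ (j + 1 - k)"
    proof -
      have "(x - a) / 2 ^ k < 2 * l / 2 ^ k" using xa by (intro divide_strict_right_mono) auto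
      also have "2 * l / 2 ^ k = 2 ^ (j + 1 - k)" using kj by (simp add: l_def power_diff)
      finally show ?thesis using i by linarith
    qed
    then have "i < 2 ^ (j + 1 - k)" by (metis of_nat_less_iff of_nat_numeral of_nat_power)
    then have H: "(k, i) \<in> H" unfolding H_def using kj xD False by auto
    have "k \<noteq> j"
    proof
      assume "k = j"
      then have "W * l \<le> l / 4" using Wk[OF H] by (simp add: l_def)
      moreover have "2 * l \<le> W * l" using W l by (intro mult_right_mono) auto
      ultimately show False using l by simp
    qed
    moreover have "Suc k \<notin> P" using Max_ge[OF finP, of "Suc k"] unfolding k_def[symmetric] by auto
    ultimately have fx: "f x < K * 2 ^ Suc k" using kj(1) unfolding P_def by auto
    let ?r = "(x - (a + (real i + 1 / 2) * 2 ^ k)) / (W * 2 ^ k)"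
    have "\<bar>x - (a + (real i + 1 / 2) * 2 ^ k)\<bar> \<le> 2 ^ k / 2"
      using xD unfolding D_def atLeastLessThan_iff distrib_right by linarith
    also have "\<dots> \<le> 1 / 4 * (W * 2 ^ k)" using W by simp
    finally have "\<bar>?r\<bar> \<le> 1 / 4" using W0 by (simp add: abs_divide abs_mult divide_le_eq)
    then have "?r\<^sup>2 \<le> (1 / 4)\<^sup>2" by (metis abs_ge_zero power2_abs power_mono)
    also have "(1 / 4 :: real)\<^sup>2 \<le> 1 / 3" by (simp add: power2_eq_square)
    finally have "2 / 3 \<le> max 0 (1 - ?r\<^sup>2)" by linarith
    then have "3 * K * 2 ^ k * (2 / 3) \<le> 3 * K * 2 ^ k * max 0 (1 - ?r\<^sup>2)" by (rule mult_left_mono) (use K in simp)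
    also have "\<dots> \<le> u x" using u(5)[of "Some (k, i)" x] H by (simp add: bump_def c_def w_def h_def)
    finally show ?thesis using fx K by simp
  qed
  \<comment> \<open>Heavy subintervals may be nested, but those containing a given point have
    different scales, all with \<open>K * 2 ^ k \<le> 2 * f x\<close>. So the sum is geometric and
    at most \<open>4 * f x\<close>.\<close>
  have cost: "(\<Sum>(k, i)\<in>H. K * 2 ^ k * 2 ^ k) \<le> 4 * m"
  proof -
    have "(\<Sum>(k, i)\<in>H. K * 2 ^ k * 2 ^ k) = (\<integral>x. (\<Sum>p\<in>H. K * 2 ^ fst p * indicator (D (fst p) (snd p)) x) \<partial>lebesgue)"
      by (subst Bochner_Integration.integral_sum[OF Di]) (simp only: DI case_prod_unfold)
    also have "\<dots> \<le> (\<integral>x. 4 * (indicator Q x * f x) \<partial>lebesgue)"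
    proof (rule integral_mono)
      fix x
      define Hx where "Hx = {p \<in> H. x \<in> D (fst p) (snd p)}"
      have inj: "inj_on fst Hx"
      proof (rule inj_onI)
        fix p q assume pq: "p \<in> Hx" "q \<in> Hx" "fst p = fst q"
        have "real (snd p) * 2 ^ fst p < (real (snd q) + 1) * 2 ^ fst p" "real (snd q) * 2 ^ fst p < (real (snd p) + 1) * 2 ^ fst p"
          using pq unfolding Hx_def D_def mem_Collect_eq atLeastLessThan_iff pq(3) by linarith+
        then have "snd p = snd q" by simp
        then show "p = q" using pq(3) by (simp add: prod_eq_iff)
      qed
      have "(\<Sum>p\<in>H. K * 2 ^ fst p * indicator (D (fst p) (snd p)) x) = (\<Sum>p\<in>Hx. K * 2 ^ fst p)"
        unfolding Hx_def using finH by (intro sum.mono_neutral_cong_right) (auto simp: indicator_def)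
      also have "\<dots> = (\<Sum>k\<in>fst ` Hx. K * 2 ^ k)" using inj by (simp add: sum.reindex)
      also have "\<dots> \<le> 2 * (2 * f x)"
      proof (rule sum_powers_le[OF K])
        show "finite (fst ` Hx)" using finH by (simp add: Hx_def)
        show "K * 2 ^ k \<le> 2 * f x" if "k \<in> fst ` Hx" for k using that heavy[of _ _ x] by (auto simp: Hx_def)
      qed (use f0 in simp)
      finally have "(\<Sum>p\<in>H. K * 2 ^ fst p * indicator (D (fst p) (snd p)) x) \<le> 4 * f x" by simp
      moreover have "(\<Sum>p\<in>H. K * 2 ^ fst p * indicator (D (fst p) (snd p)) x) = 0" if "x \<notin> Q"
        using DH that by (intro sum.neutral) (force simp: indicator_def)
      ultimately show "(\<Sum>p\<in>H. K * 2 ^ fst p * indicator (D (fst p) (snd p)) x) \<le> 4 * (indicator Q x * f x)"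
        by (auto simp: indicator_def)
    qed (intro Bochner_Integration.integrable_sum Di integrable_mult_right fi)+
    finally show ?thesis by (simp add: m_def)
  qed
  \<comment> \<open>The wide bump costs \<open>4 * (3 * A) * (5 / 4 * l)\<close>, a heavy
    subinterval \<open>12 * W * K * 4 ^ k\<close>.\<close>
  have "(\<Sum>t\<in>insert None (Some ` H). 4 * h t * w t) = 15 * A * l + (\<Sum>p\<in>H. 4 * h (Some p) * w (Some p))"
    using finH by (simp add: sum.reindex h_def w_def)
  also have "(\<Sum>p\<in>H. 4 * h (Some p) * w (Some p)) = 12 * W * (\<Sum>(k, i)\<in>H. K * 2 ^ k * 2 ^ k)"
    unfolding sum_distrib_left by (intro sum.cong) (auto simp: h_def w_def)
  also have "\<dots> \<le> 12 * W * (4 * m)" using cost W0 by (intro mult_left_mono) auto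
  finally have "integral\<^sup>L lborel u \<le> 48 * W * m + 15 * A * l" using u(6) by simp
  then show ?thesis using u(1-4) cover unfolding m_def by (intro exI[of _ u]) auto
qed

section \<open>Summation over dyadic scales\<close>

lemma dyadic_index:
  fixes x :: real
  assumes "2 ^ N \<le> x"
  shows "\<exists>n\<ge>N. 2 ^ n \<le> x \<and> x < 2 ^ (n + 1)"
proof -
  obtain n0 where n0: "x < 2 ^ n0" using real_arch_pow[of 2 x] by auto
  define k where "k = (LEAST n. x < 2 ^ n)"
  have k: "x < 2 ^ k" unfolding k_def using n0 by (rule LeastI)
  have "N < k"
  proof (rule ccontr)
    assume "\<not> N < k"
    then have "(2::real) ^ k \<le> 2 ^ N" by (intro power_increasing) auto
    then show False using k assms by linarith
  qed
  moreover have "\<not> x < 2 ^ (k - 1)"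
    using not_less_Least[of "k - 1" "\<lambda>n. x < 2 ^ n"] \<open>N < k\<close> by (simp add: k_def[symmetric])
  ultimately show ?thesis using k by (intro exI[of _ "k - 1"]) auto
qed

lemma smear_far_bound:
  assumes u: "integrable lborel u" and u0: "\<And>y. 0 \<le> u y"
    and d: "0 < d" "\<And>y. u y \<noteq> 0 \<Longrightarrow> d \<le> \<bar>x - y\<bar>"
  shows "smear u x \<le> integral\<^sup>L lborel u / d\<^sup>2"
proof -
  have "(\<integral>y. pker 1 (x - y) * u y \<partial>lborel) \<le> (\<integral>y. 1 / d\<^sup>2 * u y \<partial>lborel)"
  proof (rule integral_mono)
    show "integrable lborel (\<lambda>y. pker 1 (x - y) * u y)"
      using u by (intro integrable_pker_1_mult integrable_imp_poisson_integrable)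
    show "integrable lborel (\<lambda>y. 1 / d\<^sup>2 * u y)" using u by (intro integrable_mult_right)
    fix y
    show "pker 1 (x - y) * u y \<le> 1 / d\<^sup>2 * u y"
    proof (cases "u y = 0")
      case False
      then have "d\<^sup>2 \<le> (x - y)\<^sup>2" using d by (metis less_imp_le power2_abs power_mono)
      then have "pker 1 (x - y) \<le> 1 / d\<^sup>2" unfolding pker_def using d
        by (intro frac_le) auto
      then show ?thesis using u0 by (intro mult_right_mono) auto
    qed simp
  qed
  then have 1: "pi * smear u x \<le> integral\<^sup>L lborel u / d\<^sup>2" by (simp add: smear_def)
  have "1 * smear u x \<le> pi * smear u x"
    using smear_nonneg[OF u0] pi_ge_two by (intro mult_right_mono) auto
  then show ?thesis using 1 by simp
qed

text \<open>At each point at most four pieces are near; the others contribute their far field, summed by \<open>T\<close>.\<close>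

lemma sum_separated_pieces:
  fixes u :: "nat \<Rightarrow> real \<Rightarrow> real" and l :: "nat \<Rightarrow> real"
  assumes l: "\<And>i. l i = 2 ^ (i + N)"
    and u: "\<And>i. integrable lborel (u i)" and u0: "\<And>i y. 0 \<le> u i y"
    and supp: "\<And>i y. u i y \<noteq> 0 \<Longrightarrow> \<bar>y - 3 * l i\<bar> < 5 / 2 * l i"
    and e: "\<And>i x. \<bar>u i x - smear (u i) x\<bar> \<le> e"
    and T: "\<And>i. 100 * integral\<^sup>L lborel (u i) / (l i)\<^sup>2 \<le> T i" "summable T" "suminf T \<le> e"
  shows "\<exists>v. poisson_integrable v \<and> (\<forall>i x. u i x \<le> v x) \<and> (\<forall>x. 0 \<le> v x) \<and> (\<forall>x. \<bar>v x - smear v x\<bar> \<le> 5 * e)"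
proof -
  have l0: "0 < l i" for i by (simp add: l)
  have mu: "0 \<le> integral\<^sup>L lborel (u i)" for i using u0 by simp
  have T0: "0 \<le> T i" for i
  proof -
    have "0 \<le> 100 * integral\<^sup>L lborel (u i) / (l i)\<^sup>2" using mu by simp
    then show ?thesis using T(1) by (rule order_trans)
  qed
  have e0: "0 \<le> e" using e[of 0 0] by linarith
  have [measurable]: "u i \<in> borel_measurable borel" for i using u[of i] by auto
  \<comment> \<open>The supports have radius \<open>5 / 2 * l i\<close>; the radius
    \<open>13 / 5 * l i\<close> leaves a gap of \<open>l i / 10\<close>, which is where the factor
    100 in the hypothesis on \<open>T\<close> comes from.\<close>
  define S where "S x = {i. \<bar>x - 3 * l i\<bar> < 13 / 5 * l i}" for x
  \<comment> \<open>Membership forces \<open>2 / 5 * l i < x\<close> and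
    \<open>x < 28 / 5 * l i\<close>, so the lengths of two members have ratio below 14, less than
    \<open>2 ^ 4\<close>.\<close>
  have Sclose: "i < i' + 4" if "i \<in> S x" "i' \<in> S x" for i i' x
  proof (rule ccontr)
    assume "\<not> i < i' + 4"
    then have "(2::real) ^ (4 + (i' + N)) \<le> 2 ^ (i + N)" by (intro power_increasing) auto
    then have "16 * l i' \<le> l i" by (simp add: l power_add)
    moreover have "2 / 5 * l i < x" "x < 28 / 5 * l i'" using that unfolding S_def mem_Collect_eq abs_less_iff by linarith+
    ultimately show False using l0[of i'] by linarith
  qed
  have S: "finite (S x)" "card (S x) \<le> 4" for x
  proof -
    have "\<exists>i0. S x \<subseteq> {i0..<i0 + 4}"
    proof (cases "S x = {}")
      case False
      define i0 where "i0 = (LEAST i. i \<in> S x)"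
      have "i0 \<in> S x" unfolding i0_def using False by (metis LeastI ex_in_conv)
      then have "S x \<subseteq> {i0..<i0 + 4}" using Sclose[of _ x i0] by (auto simp: i0_def intro: Least_le)
      then show ?thesis by blast
    qed auto
    then obtain i0 where i0: "S x \<subseteq> {i0..<i0 + 4}" by blast
    show "finite (S x)" using i0 by (rule finite_subset) simp
    show "card (S x) \<le> 4" using card_mono[OF _ i0] by simp
  qed
  have suppS: "i \<in> S x" if "u i x \<noteq> 0" for i x
    using supp[OF that] l0[of i] by (auto simp: S_def)
  have far: "smear (u i) x \<le> T i" if "i \<notin> S x" for i x
  proof -
    have "smear (u i) x \<le> integral\<^sup>L lborel (u i) / (l i / 10)\<^sup>2"
    proof (rule smear_far_bound[OF u u0])
      fix y assume "u i y \<noteq> 0"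
      from supp[OF this] show "l i / 10 \<le> \<bar>x - y\<bar>"
        using that unfolding S_def mem_Collect_eq by linarith
    qed (use l0 in simp)
    also have "\<dots> = 100 * integral\<^sup>L lborel (u i) / (l i)\<^sup>2" by (simp add: power2_eq_square)
    finally show ?thesis using T(1)[of i] by linarith
  qed
  have fin: "finite {i. u i x \<noteq> 0}" for x by (rule finite_subset[OF _ S(1)[of x]]) (use suppS in auto)
  have su: "summable (\<lambda>i. u i x)" for x by (rule summable_finite[OF fin]) simp
  define v where "v x = (\<Sum>i. u i x)" for x
  have uv: "u i x \<le> v x" for i x
  proof -
    have "(\<Sum>i\<in>{i}. u i x) \<le> v x" unfolding v_def by (rule sum_le_suminf[OF su]) (use u0 in auto)
    then show ?thesis by simp
  qed
  have v0: "0 \<le> v x" for x using u0[of 0 x] uv[of 0 x] by linarith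
  have [measurable]: "v \<in> borel_measurable borel" unfolding v_def by measurable
  have "integrable lborel (\<lambda>y. \<Sum>i. u i y / (1 + y\<^sup>2))"
  proof (rule integrable_suminf)
    show pu: "integrable lborel (\<lambda>y. u i y / (1 + y\<^sup>2))" for i
      using integrable_imp_poisson_integrable[OF u] by (simp add: poisson_integrable_def)
    show "AE y in lborel. summable (\<lambda>i. norm (u i y / (1 + y\<^sup>2)))"
      using u0 by (intro AE_I2) (simp add: summable_divide su add_nonneg_nonneg)
    show "summable (\<lambda>i. \<integral>y. norm (u i y / (1 + y\<^sup>2)) \<partial>lborel)"
    proof (rule summable_comparison_test'[OF T(2)])
      fix i :: nat
      have "(\<integral>y. norm (u i y / (1 + y\<^sup>2)) \<partial>lborel) \<le> (\<integral>y. 100 / (l i)\<^sup>2 * u i y \<partial>lborel)"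
      proof (rule integral_mono)
        fix y
        show "norm (u i y / (1 + y\<^sup>2)) \<le> 100 / (l i)\<^sup>2 * u i y"
        proof (cases "u i y = 0")
          case False
          then have "l i / 10 \<le> y" using supp[OF False] by linarith
          then have "(l i / 10)\<^sup>2 \<le> y\<^sup>2" using l0[of i] by (intro power_mono) auto
          then have "(l i)\<^sup>2 / 100 \<le> 1 + y\<^sup>2" by (simp add: power_divide)
          then have "u i y / (1 + y\<^sup>2) \<le> u i y / ((l i)\<^sup>2 / 100)"
            using l0[of i] u0[of i y] by (intro divide_left_mono) (auto intro!: mult_pos_pos add_pos_nonneg)
          then show ?thesis using u0[of i y] by (simp add: mult.commute)
        qed simp
      qed (intro integrable_norm integrable_mult_right pu u)+
      also have "\<dots> \<le> T i" using T(1)[of i] by simp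
      finally show "norm (\<integral>y. norm (u i y / (1 + y\<^sup>2)) \<partial>lborel) \<le> T i"
        using u0 by simp
    qed
  qed
  moreover have "(\<Sum>i. u i y / (1 + y\<^sup>2)) = v y / (1 + y\<^sup>2)" for y
    unfolding v_def using su by (rule suminf_divide)
  ultimately have pv: "poisson_integrable v" by (simp add: poisson_integrable_def)
  have sd: "summable (\<lambda>i. e * indicator (S x) i + T i)" for x
    by (intro summable_add T summable_mult summable_finite[OF S(1)[of x]]) simp
  have d: "\<bar>u i x - smear (u i) x\<bar> \<le> e * indicator (S x) i + T i" for i x
  proof (cases "i \<in> S x")
    case True
    then show ?thesis using e[of i x] T0[of i] by simp
  next
    case False
    then have "u i x = 0" using suppS by blast
    then show ?thesis using far[OF False] smear_nonneg[of "u i" x, OF u0] False by simp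
  qed
  have sa: "summable (\<lambda>i. \<bar>u i x - smear (u i) x\<bar>)" for x
    by (rule summable_comparison_test'[OF sd]) (use d in auto)
  have sdiff: "summable (\<lambda>i. u i x - smear (u i) x)" for x
    using sa by (rule summable_rabs_cancel)
  have ss: "summable (\<lambda>i. smear (u i) x)" for x
    using summable_diff[OF su[of x] sdiff[of x]] by simp
  have smv: "smear v x = (\<Sum>i. smear (u i) x)" for x
  proof -
    have ii: "integrable lborel (\<lambda>y. pker 1 (x - y) * u i y)" for i
      by (intro integrable_pker_1_mult integrable_imp_poisson_integrable u)
    have eq: "(\<integral>y. pker 1 (x - y) * u i y \<partial>lborel) = pi * smear (u i) x" for i by (simp add: smear_def)
    have "(\<integral>y. (\<Sum>i. pker 1 (x - y) * u i y) \<partial>lborel) = (\<Sum>i. \<integral>y. pker 1 (x - y) * u i y \<partial>lborel)"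
    proof (rule integral_suminf[OF ii])
      show "AE y in lborel. summable (\<lambda>i. norm (pker 1 (x - y) * u i y))"
        using u0 by (intro AE_I2) (simp add: summable_mult su pker_nonneg abs_mult)
      show "summable (\<lambda>i. \<integral>y. norm (pker 1 (x - y) * u i y) \<partial>lborel)"
        using u0 ss by (simp add: abs_mult pker_nonneg eq summable_mult)
    qed
    also have "\<dots> = pi * (\<Sum>i. smear (u i) x)" unfolding eq using ss by (rule suminf_mult)
    finally show ?thesis unfolding v_def smear_def using su by (simp add: suminf_mult)
  qed
  have "\<bar>v x - smear v x\<bar> \<le> 5 * e" for x
  proof -
    have "v x - smear v x = (\<Sum>i. u i x - smear (u i) x)"
      unfolding smv v_def using su ss by (rule suminf_diff)
    also have "\<bar>\<dots>\<bar> \<le> (\<Sum>i. \<bar>u i x - smear (u i) x\<bar>)" using sa by (rule summable_rabs)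
    also have "\<dots> \<le> (\<Sum>i. e * indicator (S x) i + T i)" using d sa sd by (intro suminf_le)
    also have "\<dots> = (\<Sum>i. e * indicator (S x) i) + suminf T"
      by (intro suminf_add[symmetric] T summable_mult summable_finite[OF S(1)[of x]]) simp
    also have "(\<Sum>i. e * indicator (S x) i) = (\<Sum>i\<in>S x. e)"
      by (subst suminf_finite[OF S(1)[of x]]) auto
    also have "\<dots> \<le> 4 * e" using S(2)[of x] e0 by (simp add: mult_right_mono)
    finally show ?thesis using T(3) by simp
  qed
  then show ?thesis using pv uv v0 by blast
qed

text \<open>In units of \<open>4 ^ n\<close> both costs at scale \<open>n\<close> form convergent
  series: the mass of \<open>f\<close> by Poisson integrability, the threshold term as
  \<open>A n / 2 ^ n\<close>. Discarding finitely many scales therefore meets the smallness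
  conditions of \<open>interval_majorant\<close> and bounds the total far field; this is why
  domination starts only at \<open>R\<close>.\<close>

lemma half_line_majorant:
  fixes f :: "real \<Rightarrow> real" and A :: "nat \<Rightarrow> real"
  defines "Q \<equiv> \<lambda>n::nat. {3 * 2 ^ n - 2 ^ n..<3 * 2 ^ n + (2::real) ^ n}"
  assumes K: "0 < K" and e: "0 < e" and f0: "\<And>x. 0 \<le> f x"
    and fi: "integrable lebesgue (\<lambda>x. f x / (1 + x\<^sup>2))"
    and A: "\<And>n. 0 \<le> A n" "summable (\<lambda>n. A n / 2 ^ n)"
    and half: "\<And>n x y. x \<in> Q n \<Longrightarrow> y \<in> Q n \<Longrightarrow> A n \<le> f y \<Longrightarrow> \<bar>x - y\<bar> \<le> f y / K \<Longrightarrow> f y / 2 \<le> f x"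
  shows "\<exists>v R. poisson_integrable v \<and> (\<forall>x. 0 \<le> v x) \<and> (\<forall>x. \<bar>v x - smear v x\<bar> \<le> e) \<and> (\<forall>x\<ge>R. f x \<le> v x + K)"
proof -
  \<comment> \<open>\<open>sum_separated_pieces\<close> loses a factor 5.\<close>
  define e' where "e' = e / 5"
  have e': "0 < e'" using e by (simp add: e'_def)
  \<comment> \<open>The width factor that brings twice the height over the width of a bump,
    \<open>6 * K / W\<close>, below \<open>e'\<close>.\<close>
  define W where "W = max 2 (6 * K / e')"
  have W: "2 \<le> W" "6 * K / W \<le> e'"
  proof -
    show "2 \<le> W" by (simp add: W_def)
    have "6 * K / e' \<le> W" by (simp add: W_def)
    then show "6 * K / W \<le> e'" using e' \<open>2 \<le> W\<close> by (simp add: field_simps)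
  qed
  define m where "m n = (\<integral>x. indicator (Q n) x * f x \<partial>lebesgue)" for n
  have pos: "0 < 1 + x\<^sup>2" for x :: real by (simp add: add_pos_nonneg)
  have Qb: "x\<^sup>2 + 1 \<le> 17 * 4 ^ n" if "x \<in> Q n" for x n
  proof -
    have "0 \<le> x" "x \<le> 4 * 2 ^ n" using that zero_le_power[of "2::real" n] unfolding Q_def by auto
    then have "x\<^sup>2 \<le> (4 * 2 ^ n)\<^sup>2" by (intro power_mono) auto
    also have "\<dots> = 16 * 4 ^ n" by (simp add: power_mult_distrib power2_eq_square flip: power_mult_distrib)
    finally have "x\<^sup>2 \<le> 16 * 4 ^ n" .
    moreover have "(1::real) \<le> 4 ^ n" by simp
    ultimately show ?thesis by linarith
  qed
  have Qm: "Q n \<in> sets lebesgue" for n by (simp add: Q_def)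
  have le: "indicator (Q n) x * f x \<le> 17 * 4 ^ n * (indicator (Q n) x * (f x / (1 + x\<^sup>2)))" for n x
  proof (cases "x \<in> Q n")
    case True
    have "f x = (x\<^sup>2 + 1) * (f x / (1 + x\<^sup>2))" using pos[of x] by (simp add: field_simps)
    also have "\<dots> \<le> 17 * 4 ^ n * (f x / (1 + x\<^sup>2))"
      using Qb[OF True] f0[of x] pos[of x] by (intro mult_right_mono) auto
    finally show ?thesis using True by simp
  qed simp
  have gi: "integrable lebesgue (\<lambda>x. indicator (Q n) x * (f x / (1 + x\<^sup>2)))" for n
    using integrable_mult_indicator[OF Qm[of n] fi] by simp
  have gi': "integrable lebesgue (\<lambda>x. 17 * 4 ^ n * (indicator (Q n) x * (f x / (1 + x\<^sup>2))))" for n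
    by (intro integrable_mult_right gi)
  have fm: "f \<in> borel_measurable lebesgue"
  proof -
    have 1: "(\<lambda>x. f x / (1 + x\<^sup>2)) \<in> borel_measurable lebesgue" using fi by auto
    have 2: "(\<lambda>x::real. 1 + x\<^sup>2) \<in> borel_measurable lebesgue" by (rule measurable_completion) measurable
    have "(\<lambda>x. (1 + x\<^sup>2) * (f x / (1 + x\<^sup>2))) = f"
      using pos by (intro ext) (simp add: less_imp_neq[symmetric])
    then show ?thesis using borel_measurable_times[OF 2 1] by simp
  qed
  have fQ: "integrable lebesgue (\<lambda>x. indicator (Q n) x * f x)" for n
  proof (rule Bochner_Integration.integrable_bound[OF gi'])
    show "(\<lambda>x. indicator (Q n) x * f x) \<in> borel_measurable lebesgue"
      using fm Qm by (intro borel_measurable_times borel_measurable_indicator)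
    show "AE x in lebesgue. norm (indicator (Q n) x * f x) \<le> norm (17 * 4 ^ n * (indicator (Q n) x * (f x / (1 + x\<^sup>2))))"
    proof (rule AE_I2)
      fix x
      have "0 \<le> indicator (Q n) x * f x" using f0 by simp
      then show "norm (indicator (Q n) x * f x) \<le> norm (17 * 4 ^ n * (indicator (Q n) x * (f x / (1 + x\<^sup>2))))"
        using le[where n = n and x = x] unfolding real_norm_def by linarith
    qed
  qed
  have m0: "0 \<le> m n" for n unfolding m_def using f0 by (intro Bochner_Integration.integral_nonneg) simp
  define g where "g n = (\<integral>x. indicator (Q n) x * (f x / (1 + x\<^sup>2)) \<partial>lebesgue)" for n
  have g0: "0 \<le> g n" for n unfolding g_def using f0 by (intro Bochner_Integration.integral_nonneg) (simp add: add_nonneg_nonneg)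
  have disj: "disjoint_family_on Q UNIV"
  proof -
    have "Q n \<inter> Q n' = {}" if "n < n'" for n n'
    proof -
      have "(2::real) ^ Suc n \<le> 2 ^ n'" using that by (intro power_increasing) auto
      then show ?thesis unfolding Q_def by auto
    qed
    then show ?thesis unfolding disjoint_family_on_def by (metis Int_commute linorder_neqE_nat)
  qed
  have "summable g"
  proof (rule summableI_nonneg_bounded)
    fix n
    have "(\<Sum>i<n. g i) = (\<integral>x. (\<Sum>i<n. indicator (Q i) x * (f x / (1 + x\<^sup>2))) \<partial>lebesgue)"
      unfolding g_def by (rule Bochner_Integration.integral_sum[symmetric]) (rule gi)
    also have "\<dots> \<le> (\<integral>x. f x / (1 + x\<^sup>2) \<partial>lebesgue)"
    proof (rule integral_mono[OF _ fi])
      show "integrable lebesgue (\<lambda>x. \<Sum>i<n. indicator (Q i) x * (f x / (1 + x\<^sup>2)))"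
        by (intro Bochner_Integration.integrable_sum gi)
      fix x
      have d: "disjoint_family_on Q {..<n}" using disj by (rule disjoint_family_on_mono[rotated]) simp
      have "(\<Sum>i<n. indicator (Q i) x * (f x / (1 + x\<^sup>2))) = indicator (\<Union> (Q ` {..<n})) x * (f x / (1 + x\<^sup>2))"
        unfolding sum_distrib_right[symmetric] by (subst indicator_UN_disjoint[OF _ d]) auto
      also have "\<dots> \<le> 1 * (f x / (1 + x\<^sup>2))"
        using f0[of x] pos[of x] by (intro mult_right_mono) (auto split: split_indicator)
      finally show "(\<Sum>i<n. indicator (Q i) x * (f x / (1 + x\<^sup>2))) \<le> f x / (1 + x\<^sup>2)" by simp
    qed
    finally show "(\<Sum>i<n. g i) \<le> (\<integral>x. f x / (1 + x\<^sup>2) \<partial>lebesgue)" .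
  qed (rule g0)
  note sg = this
  have mg: "m n / 4 ^ n \<le> 17 * g n" for n
  proof -
    have "m n \<le> (\<integral>x. 17 * 4 ^ n * (indicator (Q n) x * (f x / (1 + x\<^sup>2))) \<partial>lebesgue)"
      unfolding m_def by (rule integral_mono[OF fQ gi' le])
    also have "\<dots> = 17 * 4 ^ n * g n" unfolding g_def by (rule integral_mult_right_zero)
    finally show ?thesis by (simp add: field_simps)
  qed
  have sm: "summable (\<lambda>n. m n / 4 ^ n)"
  proof -
    have "summable (\<lambda>n. 17 * g n)" using sg by (rule summable_mult)
    then show ?thesis
    proof (rule summable_comparison_test'[where N = 0])
      show "norm (m n / 4 ^ n) \<le> 17 * g n" for n using mg[of n] m0[of n] by simp
    qed
  qed
  \<comment> \<open>The mass bound of \<open>interval_majorant\<close>, times 100 and divided by the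
    squared length: \<open>100 * 48\<close> and \<open>100 * 15\<close>.\<close>
  define T where "T n = 4800 * W * (m n / 4 ^ n) + 1500 * (A n / 2 ^ n)" for n
  have sT: "summable T" unfolding T_def by (intro summable_add summable_mult sm A)
  have ev1: "\<forall>\<^sub>F n in sequentially. m n / 4 ^ n < K / (32 * W\<^sup>2)"
    using summable_LIMSEQ_zero[OF sm] K W by (intro order_tendstoD) auto
  have ev2: "\<forall>\<^sub>F n in sequentially. A n / 2 ^ n < e' / 20"
    using summable_LIMSEQ_zero[OF A(2)] e' by (intro order_tendstoD) auto
  obtain N1 where N1: "\<And>n. n \<ge> N1 \<Longrightarrow> m n / 4 ^ n < K / (32 * W\<^sup>2) \<and> A n / 2 ^ n < e' / 20"
    using eventually_conj[OF ev1 ev2] unfolding eventually_sequentially by blast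
  obtain N2 where N2: "\<And>n. n \<ge> N2 \<Longrightarrow> norm (\<Sum>i. T (i + n)) < e'"
    using suminf_exist_split[OF e' sT] by blast
  define N where "N = max N1 N2"
  define l where "l i = (2::real) ^ (i + N)" for i
  have l2: "(l i)\<^sup>2 = 4 ^ (i + N)" for i by (simp add: l_def power2_eq_square flip: power_mult_distrib)
  have "\<exists>u. integrable lborel u \<and> (\<forall>x. 0 \<le> u x \<and> (u x \<noteq> 0 \<longrightarrow> \<bar>x - 3 * l i\<bar> < 5 / 2 * l i) \<and> \<bar>u x - smear u x\<bar> \<le> e')
     \<and> (\<forall>x\<in>Q (i + N). f x \<le> u x + K) \<and> integral\<^sup>L lborel u \<le> 48 * W * m (i + N) + 15 * A (i + N) * l i" for i
    unfolding Q_def m_def l_def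
  proof (rule interval_majorant[OF K e' W A(1) _ f0])
    have n: "N1 \<le> i + N" by (simp add: N_def)
    show "A (i + N) \<le> e' * 2 ^ (i + N) / 20" using N1[OF n] by (simp add: field_simps)
    show "integrable lebesgue (\<lambda>x. indicator {3 * 2 ^ (i + N) - 2 ^ (i + N)..<3 * 2 ^ (i + N) + (2::real) ^ (i + N)} x * f x)"
      using fQ[of "i + N"] unfolding Q_def .
    show "f y / 2 \<le> f x" if "x \<in> {3 * 2 ^ (i + N) - 2 ^ (i + N)..<3 * 2 ^ (i + N) + (2::real) ^ (i + N)}"
       "y \<in> {3 * 2 ^ (i + N) - 2 ^ (i + N)..<3 * 2 ^ (i + N) + (2::real) ^ (i + N)}" "A (i + N) \<le> f y" "\<bar>x - y\<bar> \<le> f y / K" for x y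
      using half[of x "i + N" y] that unfolding Q_def by blast
    have "m (i + N) \<le> K / (32 * W\<^sup>2) * 4 ^ (i + N)" using N1[OF n] by (simp add: divide_less_eq)
    then show "(\<integral>x. indicator {3 * 2 ^ (i + N) - 2 ^ (i + N)..<3 * 2 ^ (i + N) + (2::real) ^ (i + N)} x * f x \<partial>lebesgue)
      \<le> K * (2 ^ (i + N))\<^sup>2 / (32 * W\<^sup>2)"
      using l2[of i] unfolding m_def Q_def l_def by simp
  qed
  then obtain u where u: "\<And>i. integrable lborel (u i)" "\<And>i x. 0 \<le> u i x" "\<And>i x. u i x \<noteq> 0 \<Longrightarrow> \<bar>x - 3 * l i\<bar> < 5 / 2 * l i"
     "\<And>i x. \<bar>u i x - smear (u i) x\<bar> \<le> e'" "\<And>i x. x \<in> Q (i + N) \<Longrightarrow> f x \<le> u i x + K"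
     "\<And>i. integral\<^sup>L lborel (u i) \<le> 48 * W * m (i + N) + 15 * A (i + N) * l i"
    by metis
  have "\<exists>v. poisson_integrable v \<and> (\<forall>i x. u i x \<le> v x) \<and> (\<forall>x. 0 \<le> v x) \<and> (\<forall>x. \<bar>v x - smear v x\<bar> \<le> 5 * e')"
  proof (rule sum_separated_pieces[OF l_def u(1-4)])
    show "summable (\<lambda>i. T (i + N))" using sT by (rule summable_ignore_initial_segment)
    show "(\<Sum>i. T (i + N)) \<le> e'" using N2[of N] by (simp add: N_def)
    show "100 * integral\<^sup>L lborel (u i) / (l i)\<^sup>2 \<le> T (i + N)" for i
    proof -
      have l0: "0 < l i" by (simp add: l_def)
      have "100 * integral\<^sup>L lborel (u i) / (l i)\<^sup>2 \<le> 100 * (48 * W * m (i + N) + 15 * A (i + N) * l i) / (l i)\<^sup>2"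
        using u(6)[of i] by (intro divide_right_mono) auto
      also have "\<dots> = 4800 * W * (m (i + N) / (l i)\<^sup>2) + 1500 * (A (i + N) / l i)"
        using l0 by (simp add: field_simps power2_eq_square)
      also have "\<dots> = T (i + N)" unfolding T_def l2 by (simp add: l_def)
      finally show ?thesis .
    qed
  qed
  then obtain v where v: "poisson_integrable v" "\<And>i x. u i x \<le> v x" "\<And>x. 0 \<le> v x" "\<And>x. \<bar>v x - smear v x\<bar> \<le> 5 * e'"
    by blast
  have "f x \<le> v x + K" if x: "2 ^ (N + 1) \<le> x" for x
  proof -
    obtain n where n: "N + 1 \<le> n" "2 ^ n \<le> x" "x < 2 ^ (n + 1)" using dyadic_index[OF x] by blast
    \<comment> \<open>\<open>Q (n - 1)\<close> is the interval from \<open>2 ^ n\<close> to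
      \<open>2 ^ (n + 1)\<close>; hence the threshold \<open>2 ^ (N + 1)\<close> for
      \<open>x\<close>.\<close>
    then have "(2::real) ^ n = 2 * 2 ^ (n - 1)" by (cases n) auto
    then have "x \<in> Q (n - 1)" using n by (simp add: Q_def)
    moreover have "n - 1 = (n - 1 - N) + N" using n by simp
    ultimately show ?thesis using u(5)[of x "n - 1 - N"] v(2)[of "n - 1 - N" x] by simp
  qed
  then show ?thesis using v unfolding e'_def by (intro exI[of _ v] exI[of _ "2 ^ (N + 1)"]) auto
qed

section \<open>Functions of class V\<close>

lemma poisson_integrable_add:
  "poisson_integrable u \<Longrightarrow> poisson_integrable v \<Longrightarrow> poisson_integrable (\<lambda>x. u x + v x)"
  by (auto simp: poisson_integrable_def add_divide_distrib intro: borel_measurable_add)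

lemma poisson_integrable_const: "poisson_integrable (\<lambda>x. c)"
proof -
  have "integrable lborel (\<lambda>y. c * pker 1 y)" by (intro integrable_mult_right pker_integral) simp
  then show ?thesis by (simp add: poisson_integrable_def pker_def)
qed

lemma poisson_integrable_reflect:
  assumes "poisson_integrable u"
  shows "poisson_integrable (\<lambda>x. u (- x))"
proof -
  have [measurable]: "u \<in> borel_measurable borel" using assms by (simp add: poisson_integrable_def)
  have "integrable lborel (\<lambda>y. u (0 + (-1) * y) / (1 + (0 + (-1) * y)\<^sup>2))"
    using assms by (intro lborel_integrable_real_affine[where f = "\<lambda>y. u y / (1 + y\<^sup>2)"]) (auto simp: poisson_integrable_def)
  then show ?thesis by (simp add: poisson_integrable_def)
qed

lemma smear_add:
  assumes "poisson_integrable u" "poisson_integrable v"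
  shows "smear (\<lambda>x. u x + v x) x = smear u x + smear v x"
  using assms by (simp add: smear_def distrib_left integrable_pker_1_mult add_divide_distrib)

lemma smear_const: "smear (\<lambda>x. c) x = c"
  using integrable_pker_shift[of 1 x] by (simp add: smear_def pker_commute[of 1 x])

lemma smear_reflect: "smear (\<lambda>x. u (- x)) x = smear u (- x)"
proof -
  have "(\<integral>y. pker 1 (- x - y) * u y \<partial>lborel) = \<bar>-1\<bar> *\<^sub>R (\<integral>y. pker 1 (- x - (0 + (-1) * y)) * u (0 + (-1) * y) \<partial>lborel)"
    by (rule lborel_integral_real_affine) simp
  moreover have "pker 1 (- x - (0 + (-1) * y)) = pker 1 (x - y)" for y
    using pker_minus[of 1 "x - y"] by (simp add: algebra_simps)
  ultimately show ?thesis by (simp add: smear_def)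
qed

text \<open>The left half-line is treated as a reflected right one, and \<open>smear\<close>
  commutes with reflection. Each side takes half of \<open>e\<close>; both majorants are
  nonnegative, so adding one does not spoil the other. A constant covers the compact middle and the
  defect \<open>K\<close>, and does not affect the difference from the average.\<close>

lemma two_sided_majorant:
  fixes f :: "real \<Rightarrow> real" and A A' :: "nat \<Rightarrow> real"
  defines "Q \<equiv> \<lambda>n::nat. {2 * 2 ^ n..4 * (2::real) ^ n}"
  assumes K: "0 < K" and e: "0 < e" and f0: "\<And>x. 0 \<le> f x" and cont: "continuous_on UNIV f"
    and fi: "integrable lebesgue (\<lambda>x. f x / (1 + x\<^sup>2))"
    and A: "\<And>n. 0 \<le> A n" "summable (\<lambda>n. A n / 2 ^ n)"
    and A': "\<And>n. 0 \<le> A' n" "summable (\<lambda>n. A' n / 2 ^ n)"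
    and half: "\<And>n x y. x \<in> Q n \<Longrightarrow> y \<in> Q n \<Longrightarrow> A n \<le> f y \<Longrightarrow> \<bar>x - y\<bar> \<le> f y / K \<Longrightarrow> f y / 2 \<le> f x"
    and half': "\<And>n x y. x \<in> Q n \<Longrightarrow> y \<in> Q n \<Longrightarrow> A' n \<le> f (- y) \<Longrightarrow> \<bar>x - y\<bar> \<le> f (- y) / K \<Longrightarrow> f (- y) / 2 \<le> f (- x)"
  shows "\<exists>v. poisson_integrable v \<and> (\<forall>x. f x \<le> v x) \<and> (\<forall>x. \<bar>v x - smear v x\<bar> \<le> e)"
proof -
  have e2: "0 < e / 2" using e by simp
  have Q: "x \<in> Q n" if "x \<in> {3 * 2 ^ n - 2 ^ n..<3 * 2 ^ n + 2 ^ n}" for x n using that by (simp add: Q_def)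
  have fi': "integrable lebesgue (\<lambda>x. f (- x) / (1 + x\<^sup>2))"
  proof -
    have [measurable]: "f \<in> borel_measurable borel" using cont by (rule borel_measurable_continuous_onI)
    have "integrable lborel (\<lambda>x. f x / (1 + x\<^sup>2))"
      using fi by (subst (asm) integrable_completion) auto
    then have "integrable lborel (\<lambda>x. f (0 + (-1) * x) / (1 + (0 + (-1) * x)\<^sup>2))"
      by (rule lborel_integrable_real_affine[where f = "\<lambda>x. f x / (1 + x\<^sup>2)"]) simp
    then show ?thesis by (intro integrable_lborel_imp_lebesgue) simp
  qed
  have "\<exists>v R. poisson_integrable v \<and> (\<forall>x. 0 \<le> v x) \<and> (\<forall>x. \<bar>v x - smear v x\<bar> \<le> e / 2) \<and> (\<forall>x\<ge>R. f x \<le> v x + K)"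
    by (rule half_line_majorant[OF K e2 f0 fi A]) (use half Q in blast)+
  then obtain v R where v: "poisson_integrable v" "\<And>x. 0 \<le> v x" "\<And>x. \<bar>v x - smear v x\<bar> \<le> e / 2" "\<And>x. R \<le> x \<Longrightarrow> f x \<le> v x + K"
    by blast
  have "\<exists>v R. poisson_integrable v \<and> (\<forall>x. 0 \<le> v x) \<and> (\<forall>x. \<bar>v x - smear v x\<bar> \<le> e / 2) \<and> (\<forall>x\<ge>R. f (- x) \<le> v x + K)"
    by (rule half_line_majorant[OF K e2 f0 fi' A']) (use half' Q in blast)+
  then obtain v' R' where v': "poisson_integrable v'" "\<And>x. 0 \<le> v' x" "\<And>x. \<bar>v' x - smear v' x\<bar> \<le> e / 2" "\<And>x. R' \<le> x \<Longrightarrow> f (- x) \<le> v' x + K"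
    by blast
  have "compact (f ` {- R'..R})" using cont by (intro compact_continuous_image continuous_on_subset[OF cont]) auto
  then obtain B where B: "\<And>x. - R' \<le> x \<Longrightarrow> x \<le> R \<Longrightarrow> f x \<le> B"
    using bounded_has_Sup(1)[of "f ` {- R'..R}"] compact_imp_bounded
    by (metis atLeastAtMost_iff empty_iff imageI)
  define C where "C = max K B"
  define w where "w x = v x + v' (- x) + C" for x
  have pr: "poisson_integrable (\<lambda>x. v' (- x))" using v'(1) by (rule poisson_integrable_reflect)
  have pw: "poisson_integrable w" unfolding w_def
    by (rule poisson_integrable_add[OF poisson_integrable_add[OF v(1) pr] poisson_integrable_const])
  have sw: "smear w x = smear v x + smear v' (- x) + C" for x
    unfolding w_def smear_add[OF poisson_integrable_add[OF v(1) pr] poisson_integrable_const]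
      smear_add[OF v(1) pr] smear_const smear_reflect ..
  have "\<bar>w x - smear w x\<bar> \<le> e" for x
    unfolding sw w_def using v(3)[of x] v'(3)[of "- x"] by linarith
  moreover have "f x \<le> w x" for x
  proof -
    consider "R \<le> x" | "R' \<le> - x" | "- R' \<le> x" "x \<le> R" by linarith
    then show ?thesis
    proof cases
      case 1
      then show ?thesis using v(4)[of x] v'(2)[of "- x"] by (simp add: w_def C_def)
    next
      case 2
      then show ?thesis using v'(4)[of "- x"] v(2)[of x] by (simp add: w_def C_def)
    next
      case 3
      then show ?thesis using B[of x] v(2)[of x] v'(2)[of "- x"] by (simp add: w_def C_def)
    qed
  qed
  ultimately show ?thesis using pw by blast
qed

section \<open>Regularity on dyadic intervals\<close>

lemma abs_cont_on_imp_continuous: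
  assumes "\<And>a b. abs_cont_on {a..b} \<phi>"
  shows "continuous_on UNIV \<phi>"
proof -
  have "\<exists>d>0. \<forall>y. dist y x < d \<longrightarrow> dist (\<phi> y) (\<phi> x) < e" if e: "0 < e" for x e :: real
  proof -
    obtain d where d: "d > 0" and D: "\<And>(n::nat) (a :: nat \<Rightarrow> real) (b :: nat \<Rightarrow> real).
        (\<forall>i<n. a i \<le> b i \<and> {a i..b i} \<subseteq> {x - 1..x + 1}) \<and> disjoint_family_on (\<lambda>i. {a i<..<b i}) {..<n} \<and>
        (\<Sum>i<n. b i - a i) < d \<Longrightarrow> (\<Sum>i<n. \<bar>\<phi> (b i) - \<phi> (a i)\<bar>) < e"
      using assms[of "x - 1" "x + 1"] e unfolding abs_cont_on_def by meson
    have "dist (\<phi> y) (\<phi> x) < e" if y: "dist y x < min d 1" for y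
    proof -
      have "\<bar>\<phi> (max x y) - \<phi> (min x y)\<bar> < e"
        using D[of 1 "\<lambda>_. min x y" "\<lambda>_. max x y"] y
        by (cases "x \<le> y") (auto simp: dist_real_def disjoint_family_on_def)
      then show ?thesis by (simp add: dist_real_def max_def min_def abs_minus_commute split: if_splits)
    qed
    then show ?thesis using d by (intro exI[of _ "min d 1"]) auto
  qed
  then show ?thesis by (auto simp: continuous_on_iff)
qed

text \<open>Reflection turns the half-open \<open>J j\<close> with negative \<open>j\<close> into
  intervals open at the other end; on closures both half-lines satisfy the same condition.\<close>

lemma hoelder_on_closure:
  assumes h: "hoelder_on \<beta> C S \<phi>" and cont: "continuous_on UNIV \<phi>" and \<beta>: "0 < \<beta>"
  shows "hoelder_on \<beta> C (closure S) \<phi>"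
proof -
  have closed: "closed {x. \<bar>\<phi> x - \<phi> y\<bar> \<le> C * \<bar>x - y\<bar> powr \<beta>}" for y
  proof (rule closed_Collect_le)
    show "continuous_on UNIV (\<lambda>x. \<bar>\<phi> x - \<phi> y\<bar>)" by (intro continuous_intros cont)
    show "continuous_on UNIV (\<lambda>x. C * \<bar>x - y\<bar> powr \<beta>)"
      by (intro continuous_on_mult continuous_on_powr' continuous_intros) (use \<beta> in auto)
  qed
  have 1: "\<bar>\<phi> x - \<phi> y\<bar> \<le> C * \<bar>x - y\<bar> powr \<beta>" if "x \<in> closure S" "y \<in> S" for x y
    using closure_minimal[OF _ closed[of y], of S] h that by (auto simp: hoelder_on_def)
  have 2: "\<bar>\<phi> x - \<phi> y\<bar> \<le> C * \<bar>x - y\<bar> powr \<beta>" if x: "x \<in> closure S" and y: "y \<in> closure S" for x y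
  proof -
    have "S \<subseteq> {y. \<bar>\<phi> y - \<phi> x\<bar> \<le> C * \<bar>y - x\<bar> powr \<beta>}" using 1[OF x] by (auto simp: abs_minus_commute)
    then have "y \<in> {y. \<bar>\<phi> y - \<phi> x\<bar> \<le> C * \<bar>y - x\<bar> powr \<beta>}"
      using closure_minimal[OF _ closed[of x]] y by blast
    then show ?thesis by (simp add: abs_minus_commute)
  qed
  then show ?thesis by (simp add: hoelder_on_def)
qed

text \<open>Within distance \<open>\<phi> y\<close> the oscillation is at most
  \<open>\<kappa> * \<phi> y powr \<beta>\<close>, which is at most half of \<open>\<phi> y\<close>
  exactly when \<open>2 * \<kappa> \<le> \<phi> y powr (1 - \<beta>)\<close>. This is the origin of
  the threshold and explains the exponent in the definition of \<open>V\<close>.\<close>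

lemma hoelder_half:
  fixes \<phi> :: "real \<Rightarrow> real"
  assumes h: "\<bar>\<phi> x - \<phi> y\<bar> \<le> \<kappa> * \<bar>x - y\<bar> powr \<beta>" and \<beta>: "0 < \<beta>" "\<beta> < 1" and \<kappa>: "0 \<le> \<kappa>" and pos: "0 < \<phi> y"
    and large: "(2 * \<kappa>) powr (1 / (1 - \<beta>)) \<le> \<phi> y" and close: "\<bar>x - y\<bar> \<le> \<phi> y"
  shows "\<phi> y / 2 \<le> \<phi> x"
proof -
  have "((2 * \<kappa>) powr (1 / (1 - \<beta>))) powr (1 - \<beta>) \<le> \<phi> y powr (1 - \<beta>)"
    using large \<beta> by (intro powr_mono2) auto
  then have "2 * \<kappa> \<le> \<phi> y powr (1 - \<beta>)" using \<beta> \<kappa> by (simp add: powr_powr)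
  then have "2 * \<kappa> * \<phi> y powr \<beta> \<le> \<phi> y powr (1 - \<beta>) * \<phi> y powr \<beta>" by (intro mult_right_mono) auto
  also have "\<dots> = \<phi> y" using pos by (simp add: powr_add[symmetric])
  finally have "2 * (\<kappa> * \<phi> y powr \<beta>) \<le> \<phi> y" by simp
  moreover have "\<kappa> * \<bar>x - y\<bar> powr \<beta> \<le> \<kappa> * \<phi> y powr \<beta>"
    using close \<kappa> \<beta> by (intro mult_left_mono powr_mono2) auto
  ultimately show ?thesis using h by linarith
qed

text \<open>Used with \<open>i n = n + 1\<close> and \<open>i n = - n - 1\<close> for the positive
  and the negative dyadic intervals. The shift by one between \<open>n\<close> and the index of
  \<open>J\<close> accounts for the factor 2 in the proof.\<close>

lemma summable_dyadic:
  fixes A :: "int \<Rightarrow> real"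
  assumes A: "\<And>j. 0 \<le> A j" and s: "(\<lambda>j. 2 powr (- real_of_int \<bar>j\<bar>) * A j) summable_on UNIV"
    and i: "inj i" "\<And>n. \<bar>i n\<bar> = int n + 1"
  shows "summable (\<lambda>n. A (i n) / 2 ^ n)"
proof -
  have "(\<lambda>j. 2 powr (- real_of_int \<bar>j\<bar>) * A j) summable_on range i"
    using s by (rule summable_on_subset_banach) simp
  then have "((\<lambda>j. 2 powr (- real_of_int \<bar>j\<bar>) * A j) \<circ> i) summable_on UNIV"
    using summable_on_reindex[OF i(1)] by blast
  then have "summable ((\<lambda>j. 2 powr (- real_of_int \<bar>j\<bar>) * A j) \<circ> i)"
    using A by (subst (asm) summable_on_UNIV_nonneg_real_iff) auto
  then have "summable (\<lambda>n. 2 * ((\<lambda>j. 2 powr (- real_of_int \<bar>j\<bar>) * A j) \<circ> i) n)" by (rule summable_mult)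
  moreover have "2 * ((\<lambda>j. 2 powr (- real_of_int \<bar>j\<bar>) * A j) \<circ> i) n = A (i n) / 2 ^ n" for n
  proof -
    have "2 powr (- real_of_int \<bar>i n\<bar>) = 2 powr (- real (n + 1))" by (simp add: i algebra_simps)
    also have "\<dots> = 1 / 2 ^ (n + 1)" by (simp only: powr_minus powr_realpow inverse_eq_divide zero_less_numeral)
    finally show ?thesis by simp
  qed
  ultimately show ?thesis by (simp only:)
qed

lemma V_majorant:
  assumes \<beta>: "0 < \<beta>" "\<beta> \<le> 1" and pos: "\<And>x. 0 < \<Omega> x"
    and int: "integrable poisson_measure \<Omega>" and V: "\<Omega> \<in> V \<beta>" and e: "0 < e"
  shows "\<exists>v. poisson_integrable v \<and> (\<forall>x. \<Omega> x \<le> v x) \<and> (\<forall>x. \<bar>v x - smear v x\<bar> \<le> e)"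
proof -
  have \<Omega>m: "\<Omega> \<in> borel_measurable lebesgue"
    using borel_measurable_integrable[OF int] by (simp add: poisson_measure_def)
  have 2: "(\<lambda>x::real. 1 / (1 + x\<^sup>2)) \<in> borel_measurable lebesgue" by (rule measurable_completion) measurable
  have fi: "integrable lebesgue (\<lambda>x. \<Omega> x / (1 + x\<^sup>2))"
    using int unfolding poisson_measure_def
    by (subst (asm) integrable_density[OF \<Omega>m 2]) (auto simp: add_nonneg_nonneg)
  show ?thesis
  proof (cases "\<beta> = 1")
    case True
    then obtain C where C: "C-lipschitz_on UNIV \<Omega>" using V by (auto simp: V_def)
    have C0: "0 \<le> C" using C by (rule lipschitz_on_nonneg)
    \<comment> \<open>In the Lipschitz case the threshold is 0 and the radius is shortened instead,
      by \<open>K = 2 * C + 1\<close>: the oscillation is then at most the fraction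
      \<open>C / (2 * C + 1) \<le> 1 / 2\<close> of the value.\<close>
    have key: "\<Omega> y / 2 \<le> \<Omega> x" if "\<bar>x - y\<bar> \<le> \<Omega> y / (2 * C + 1)" for x y
    proof -
      have "\<bar>\<Omega> x - \<Omega> y\<bar> \<le> C * \<bar>x - y\<bar>" using lipschitz_onD[OF C, of x y] by (simp add: dist_real_def)
      also have "\<dots> \<le> C * (\<Omega> y / (2 * C + 1))" using that C0 by (rule mult_left_mono)
      also have "\<dots> \<le> \<Omega> y / 2" using C0 pos[of y] by (simp add: field_simps)
      finally show ?thesis by linarith
    qed
    show ?thesis
    proof (rule two_sided_majorant[of "2 * C + 1" e \<Omega> "\<lambda>_. 0" "\<lambda>_. 0"])
      show "continuous_on UNIV \<Omega>" using C by (rule lipschitz_on_continuous_on)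
      show "\<Omega> y / 2 \<le> \<Omega> x" if "\<bar>x - y\<bar> \<le> \<Omega> y / (2 * C + 1)" for x y using key that .
      show "\<Omega> (- y) / 2 \<le> \<Omega> (- x)" if "\<bar>x - y\<bar> \<le> \<Omega> (- y) / (2 * C + 1)" for x y
        using key[of "- x" "- y"] that by (simp add: abs_minus_commute)
    qed (use C0 e fi pos in \<open>auto intro: less_imp_le\<close>)
  next
    case False
    then have \<beta>1: "\<beta> < 1" using \<beta> by simp
    obtain \<kappa> where ac: "\<And>a b. abs_cont_on {a..b} \<Omega>" and \<kappa>: "\<And>j. 0 \<le> \<kappa> j" "\<And>j. hoelder_on \<beta> (\<kappa> j) (J j) \<Omega>"
      and s: "(\<lambda>j. 2 powr (- real_of_int \<bar>j\<bar>) * \<kappa> j powr (1 / (1 - \<beta>))) summable_on UNIV"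
      using V False by (auto simp: V_def)
    have cont: "continuous_on UNIV \<Omega>" using ac by (rule abs_cont_on_imp_continuous)
    \<comment> \<open>The factor 2 inside the power only multiplies the series in the definition of
      \<open>V\<close> by \<open>2 powr (1 / (1 - \<beta>))\<close>.\<close>
    define A where "A j = (2 * \<kappa> j) powr (1 / (1 - \<beta>))" for j
    have A0: "0 \<le> A j" for j by (simp add: A_def)
    have "(\<lambda>j. 2 powr (1 / (1 - \<beta>)) * (2 powr (- real_of_int \<bar>j\<bar>) * \<kappa> j powr (1 / (1 - \<beta>)))) summable_on UNIV"
      using s by (rule summable_on_cmult_right)
    then have sA: "(\<lambda>j. 2 powr (- real_of_int \<bar>j\<bar>) * A j) summable_on UNIV"
      using \<kappa>(1) by (simp add: A_def powr_mult mult_ac)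
    have key: "\<Omega> y / 2 \<le> \<Omega> x" if "x \<in> closure (J j)" "y \<in> closure (J j)" "A j \<le> \<Omega> y" "\<bar>x - y\<bar> \<le> \<Omega> y / 1" for x y j
    proof (rule hoelder_half[where \<phi> = \<Omega>, OF _ \<beta>(1) \<beta>1 \<kappa>(1)[of j] pos])
      show "\<bar>\<Omega> x - \<Omega> y\<bar> \<le> \<kappa> j * \<bar>x - y\<bar> powr \<beta>"
        using hoelder_on_closure[OF \<kappa>(2) cont \<beta>(1), of j] that by (simp add: hoelder_on_def)
    qed (use that in \<open>simp_all add: A_def\<close>)
    have Jp: "closure (J (int n + 1)) = {2 * 2 ^ n..4 * 2 ^ n}" for n
      by (simp add: J_def nat_add_distrib)
    have Jn: "- x \<in> closure (J (- int n - 1))" if "x \<in> {2 * 2 ^ n..4 * 2 ^ n}" for n x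
    proof -
      have "nat (1 + int n) = n + 1" by simp
      then have "J (- int n - 1) = {- (4 * 2 ^ n)..<- (2 * 2 ^ n)}" by (simp add: J_def)
      then show ?thesis using that by simp
    qed
    show ?thesis
    proof (rule two_sided_majorant[of 1 e \<Omega> "\<lambda>n. A (int n + 1)" "\<lambda>n. A (- int n - 1)"])
      show "summable (\<lambda>n. A (int n + 1) / 2 ^ n)" "summable (\<lambda>n. A (- int n - 1) / 2 ^ n)"
        by (intro summable_dyadic[OF A0 sA]; simp add: inj_def)+
      show "\<Omega> y / 2 \<le> \<Omega> x" if "x \<in> {2 * 2 ^ n..4 * 2 ^ n}" "y \<in> {2 * 2 ^ n..4 * 2 ^ n}"
        "A (int n + 1) \<le> \<Omega> y" "\<bar>x - y\<bar> \<le> \<Omega> y / 1" for n x y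
        using key[of x "int n + 1" y] that unfolding Jp by blast
      show "\<Omega> (- y) / 2 \<le> \<Omega> (- x)" if "x \<in> {2 * 2 ^ n..4 * 2 ^ n}" "y \<in> {2 * 2 ^ n..4 * 2 ^ n}"
        "A (- int n - 1) \<le> \<Omega> (- y)" "\<bar>x - y\<bar> \<le> \<Omega> (- y) / 1" for n x y
        using key[OF Jn[OF that(1)] Jn[OF that(2)] that(3)] that(4) by (simp add: abs_minus_commute)
    qed (use e fi pos cont A0 in \<open>auto intro: less_imp_le\<close>)
  qed
qed

theorem lemma1:
  fixes \<beta> :: real and \<Omega> :: "real \<Rightarrow> real"
  assumes "0 < \<beta>" and "\<beta> \<le> 1"
    and "\<And>x. 0 < \<Omega> x"
    and "integrable poisson_measure \<Omega>"
    and "\<Omega> \<in> V \<beta>"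
  shows "\<forall>\<epsilon>>0. \<exists>\<Omega>\<^sub>1 :: real \<Rightarrow> real.
           (\<forall>x. \<Omega> x \<le> \<Omega>\<^sub>1 x) \<and>
           integrable poisson_measure \<Omega>\<^sub>1 \<and>
           (\<exists>g. is_hilbert_transform \<Omega>\<^sub>1 g \<and> \<epsilon>-lipschitz_on UNIV g)"
proof (intro allI impI)
  fix \<epsilon> :: real assume "0 < \<epsilon>"
  define e where "e = \<epsilon> / pi\<^sup>2"
  have e: "0 < e" "pi\<^sup>2 * e = \<epsilon>" using \<open>0 < \<epsilon>\<close> by (simp_all add: e_def)
  obtain v where v: "poisson_integrable v" "\<And>x. \<Omega> x \<le> v x" "\<And>x. \<bar>v x - smear v x\<bar> \<le> e"
    using V_majorant[OF assms e(1)] by blast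
  \<comment> \<open>Adding the constant makes up for the loss of \<open>e\<close> in
    \<open>hilbert_transform_lipschitz_majorant\<close> and leaves \<open>v - smear v\<close>
    unchanged.\<close>
  let ?w = "\<lambda>x. v x + e"
  have "poisson_integrable ?w" by (rule poisson_integrable_add[OF v(1) poisson_integrable_const])
  moreover have "0 \<le> ?w x" for x using v(2)[of x] assms(3)[of x] e(1) by linarith
  moreover have "\<bar>?w x - smear ?w x\<bar> \<le> e" for x
    using v(3)[of x] by (simp add: smear_add[OF v(1) poisson_integrable_const] smear_const)
  ultimately obtain F g where F: "\<And>x. ?w x - e \<le> F x" "integrable poisson_measure F"
      "is_hilbert_transform F g" "(pi\<^sup>2 * e)-lipschitz_on UNIV g"
    using hilbert_transform_lipschitz_majorant[of ?w e] by blast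
  have "\<Omega> x \<le> F x" for x using F(1)[of x] v(2)[of x] by simp
  with F(2-4) show "\<exists>\<Omega>\<^sub>1. (\<forall>x. \<Omega> x \<le> \<Omega>\<^sub>1 x) \<and> integrable poisson_measure \<Omega>\<^sub>1 \<and>
           (\<exists>g. is_hilbert_transform \<Omega>\<^sub>1 g \<and> \<epsilon>-lipschitz_on UNIV g)"
    unfolding e(2) by blast
qed

end
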